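(* Work in $\mathsf{ZF}$. The following are equivalent: (1) Łoś's theorem holds. (2) For every structure $M$ and ultrafilter $U$ over a set $I$, the ultrapower ${}^I M/U$ is $\Sigma_2$-elementarily equivalent to $M$. (3) For every family $\{M_i \mid i \in I\}$ of pairwise isomorphic structures with the same language and every ultrafilter $U$ over $I$, if $\prod_{i \in I} M_i \neq \emptyset$ then $\prod_{i \in I} M_i/U$ is $\Sigma_1$-elementarily equivalent to $M_i$ for every $i \in I$. (4) For every two structures $M$ and $N$ with the same language and every ultrafilter $U$ over a set $I$, if there are elementary embeddings $j:M \to N$ and $j':N \to M$, then ${}^I M/U$ and ${}^I N/U$ are $\Sigma_2$-elementarily equivalent. (5) For every two families $\{M_i \mid i \in I\}$, $\{N_i \mid i \in I\}$ of structures with the same language and every ultrafilter $U$ over $I$, if each $M_i$ is isomorphic to $N_i$ and both $\prod_{i \in I} M_i$ and $\prod_{i \in I} N_i$ are non-empty, then $\prod_{i \in I} M_i/U$ is $\Sigma_1$-elementarily equivalent to $\prod_{i \in I} N_i/U$. (6) For every two families $\{M_i \mid i \in I\}$, $\{N_i \mid i \in I\}$ of structures with the same language and every ultrafilter $U$ over $I$, if each $M_i$ is isomorphic to $N_i$ and both $\prod_{i \in I} M_i$ and $\prod_{i \in I} N_i$ are non-empty, then $\prod_{i \in I} M_i/U$ is isomorphic to $\prod_{i \in I} N_i/U$.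
   Context: Everything is in $\mathsf{ZF}$ (no Axiom of Choice). Filters are proper; structures are first-order structures in some language. For an ultrafilter $U$ over $I$ and a family of structures $\{M_i \mid i\in I\}$, the ultraproduct $\prod_{i\in I} M_i/U$ has universe the set of equivalence classes $[f]$ of $f \in \prod_{i\in I} M_i$ under $f \sim g \iff \{i \mid f(i)=g(i)\}\in U$, with relations interpreted by $R([f_0],\dots,[f_n]) \iff \{i \mid M_i\models R(f_0(i),\dots,f_n(i))\}\in U$ (and similarly for constants and functions); when all $M_i = M$ this is the ultrapower ${}^I M/U$. "Łoś's theorem" is the statement: for every family $\{M_i \mid i \in I\}$ of structures with the same language $\mathcal{L}$ and every ultrafilter $U$ over $I$ with $\prod_{i \in I} M_i \neq \emptyset$, for every $\mathcal{L}$-formula $\varphi(v_0,\dots,v_n)$ and $f_0,\dots,f_n \in \prod_{i\in I} M_i$, $\prod_{i \in I} M_i/U \models \varphi([f_0],\dots,[f_n])$ iff $\{i \in I \mid M_i \models \varphi(f_0(i),\dots,f_n(i))\} \in U$. Two structures are $\Sigma_n$-elementarily equivalent if they satisfy the same $\Sigma_n$ sentences. *)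

theory Defs
  imports Main
begin

text \<open>
  HOL has a choice operator, so a theorem of ZF cannot be rendered by HOL's own sets and functions:
  there Los's theorem is simply true. "ZF proves \<open>\<theta>\<close>" is instead rendered as "\<open>\<theta>\<close> holds in every
  model \<open>(V, E)\<close> of first-order ZF" (the two agree by the completeness theorem). The model need not
  be well-founded, its \<open>\<omega>\<close> may be nonstandard, and Separation and Replacement are postulated only
  for first-order formulas with parameters. Postulating them for all HOL predicates would make the
  model inherit the Axiom of Choice from HOL.

  All further notions (ultrafilters, languages, structures, formulas, satisfaction, ...) are notions
  of the model: every quantifier ranges over elements of \<open>V\<close>, and in particular languages and
  formulas are elements of \<open>V\<close>.
\<close>

section \<open>Models of ZF\<close>

datatype set_fm =
    Mem nat nat
  | Equal nat nat
  | Neg set_fm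
  | Conj set_fm set_fm
  | Exists nat set_fm

primrec set_sat :: "('v \<Rightarrow> 'v \<Rightarrow> bool) \<Rightarrow> set_fm \<Rightarrow> (nat \<Rightarrow> 'v) \<Rightarrow> bool" where
  "set_sat E (Mem i j) e \<longleftrightarrow> E (e i) (e j)"
| "set_sat E (Equal i j) e \<longleftrightarrow> e i = e j"
| "set_sat E (Neg \<phi>) e \<longleftrightarrow> \<not> set_sat E \<phi> e"
| "set_sat E (Conj \<phi> \<psi>) e \<longleftrightarrow> set_sat E \<phi> e \<and> set_sat E \<psi> e"
| "set_sat E (Exists k \<phi>) e \<longleftrightarrow> (\<exists>a. set_sat E \<phi> (e(k := a)))"

text \<open>\<open>E x y\<close> is read "\<open>x\<close> is an element of \<open>y\<close>".\<close>

locale membership =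
  fixes E :: "'v \<Rightarrow> 'v \<Rightarrow> bool"

locale ZF_model = membership E for E :: "'v \<Rightarrow> 'v \<Rightarrow> bool" +
  assumes extensionality: "\<forall>x y. (\<forall>z. E z x \<longleftrightarrow> E z y) \<longrightarrow> x = y"
    and foundation: "\<forall>x. (\<exists>y. E y x) \<longrightarrow> (\<exists>y. E y x \<and> \<not> (\<exists>z. E z x \<and> E z y))"
    and pairing: "\<forall>x y. \<exists>p. \<forall>z. E z p \<longleftrightarrow> z = x \<or> z = y"
    and union: "\<forall>x. \<exists>u. \<forall>z. E z u \<longleftrightarrow> (\<exists>y. E y x \<and> E z y)"
    and power_set: "\<forall>x. \<exists>p. \<forall>y. E y p \<longleftrightarrow> (\<forall>z. E z y \<longrightarrow> E z x)"
    and infinity: "\<exists>x. (\<exists>y. E y x \<and> (\<forall>z. \<not> E z y)) \<and>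
          (\<forall>y. E y x \<longrightarrow> (\<exists>s. E s x \<and> (\<forall>z. E z s \<longleftrightarrow> E z y \<or> z = y)))"
    and separation: "\<forall>\<phi> e a. \<exists>b. \<forall>x. E x b \<longleftrightarrow> E x a \<and> set_sat E \<phi> (e(0 := x))"
    and replacement: "\<forall>\<phi> e a.
          (\<forall>x y z. E x a \<and> set_sat E \<phi> (e(0 := x, 1 := y)) \<and> set_sat E \<phi> (e(0 := x, 1 := z))
             \<longrightarrow> y = z)
          \<longrightarrow> (\<exists>b. \<forall>y. E y b \<longleftrightarrow> (\<exists>x. E x a \<and> set_sat E \<phi> (e(0 := x, 1 := y))))"

context membership
begin

section \<open>Basic set theory in the model\<close>

definition elts :: "'v \<Rightarrow> 'v set" where
  "elts a = {x. E x a}"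

text \<open>
  \<open>vset S\<close> is the element of the model with extension \<open>S\<close>. It is applied below only to first-order
  definable classes, each of which ZF proves to be a set under the hypotheses where it is used.
\<close>

definition vset :: "'v set \<Rightarrow> 'v" where
  "vset S = (THE a. elts a = S)"

definition vpair :: "'v \<Rightarrow> 'v \<Rightarrow> 'v" where
  "vpair x y = vset {vset {x}, vset {x, y}}"

definition vfst :: "'v \<Rightarrow> 'v" where
  "vfst p = (THE x. \<exists>y. p = vpair x y)"

definition vsnd :: "'v \<Rightarrow> 'v" where
  "vsnd p = (THE y. \<exists>x. p = vpair x y)"

definition vsucc :: "'v \<Rightarrow> 'v" where
  "vsucc x = vset (insert x (elts x))"

primrec numeral_code :: "nat \<Rightarrow> 'v" where
  "numeral_code 0 = vset {}"
| "numeral_code (Suc n) = vsucc (numeral_code n)"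

definition omega :: 'v where
  "omega = vset {n. \<forall>X. vset {} \<in> elts X \<and> (\<forall>x\<in>elts X. vsucc x \<in> elts X) \<longrightarrow> n \<in> elts X}"

definition function_on :: "'v \<Rightarrow> 'v \<Rightarrow> bool" where
  "function_on a f \<longleftrightarrow>
     (\<forall>p\<in>elts f. \<exists>x\<in>elts a. \<exists>y. p = vpair x y) \<and> (\<forall>x\<in>elts a. \<exists>!y. vpair x y \<in> elts f)"

definition app :: "'v \<Rightarrow> 'v \<Rightarrow> 'v" where
  "app f x = (if \<exists>!y. vpair x y \<in> elts f then THE y. vpair x y \<in> elts f else vset {})"

definition vdom :: "'v \<Rightarrow> 'v" where
  "vdom f = vset {x. \<exists>y. vpair x y \<in> elts f}"

definition funs :: "'v \<Rightarrow> 'v \<Rightarrow> 'v" where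
  "funs a b = vset {f. function_on a f \<and> (\<forall>x\<in>elts a. app f x \<in> elts b)}"

definition vlam :: "'v \<Rightarrow> ('v \<Rightarrow> 'v) \<Rightarrow> 'v" where
  "vlam a b = vset ((\<lambda>x. vpair x (b x)) ` elts a)"

definition vcomp :: "'v \<Rightarrow> 'v \<Rightarrow> 'v" where
  "vcomp g f = vlam (vdom f) (\<lambda>x. app g (app f x))"

definition vupd :: "'v \<Rightarrow> 'v \<Rightarrow> 'v \<Rightarrow> 'v" where
  "vupd f k a = vlam (vset (insert k (elts (vdom f)))) (\<lambda>x. if x = k then a else app f x)"

definition least_closed :: "('v \<Rightarrow> bool) \<Rightarrow> 'v" where
  "least_closed C = vset {x. \<forall>Y. C Y \<longrightarrow> x \<in> elts Y}"

definition ultrafilter :: "'v \<Rightarrow> 'v \<Rightarrow> bool" where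
  "ultrafilter I U \<longleftrightarrow>
     (\<forall>X\<in>elts U. elts X \<subseteq> elts I) \<and>
     I \<in> elts U \<and> vset {} \<notin> elts U \<and>
     (\<forall>X\<in>elts U. \<forall>Y\<in>elts U. vset (elts X \<inter> elts Y) \<in> elts U) \<and>
     (\<forall>X\<in>elts U. \<forall>Y. elts X \<subseteq> elts Y \<and> elts Y \<subseteq> elts I \<longrightarrow> Y \<in> elts U) \<and>
     (\<forall>X. elts X \<subseteq> elts I \<longrightarrow> X \<in> elts U \<or> vset (elts I - elts X) \<in> elts U)"

section \<open>Languages and structures\<close>

text \<open>
  A language is a pair of arity functions, one on the relation symbols and one on the function
  symbols; constants are function symbols of arity \<open>0\<close>. A structure is a triple consisting of a
  nonempty universe and the interpretations of the relation and of the function symbols. An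
  \<open>n\<close>-tuple is a function with domain the von Neumann natural number \<open>n\<close>.
\<close>

definition is_language :: "'v \<Rightarrow> bool" where
  "is_language L \<longleftrightarrow> (\<exists>rs fs r f. L = vpair r f \<and>
     r \<in> elts (funs rs (vset (elts omega - {vset {}}))) \<and> f \<in> elts (funs fs omega))"

definition rel_syms :: "'v \<Rightarrow> 'v" where
  "rel_syms L = vdom (vfst L)"

definition rel_arity :: "'v \<Rightarrow> 'v \<Rightarrow> 'v" where
  "rel_arity L R = app (vfst L) R"

definition fun_syms :: "'v \<Rightarrow> 'v" where
  "fun_syms L = vdom (vsnd L)"

definition fun_arity :: "'v \<Rightarrow> 'v \<Rightarrow> 'v" where
  "fun_arity L F = app (vsnd L) F"

definition is_structure :: "'v \<Rightarrow> 'v \<Rightarrow> bool" where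
  "is_structure L M \<longleftrightarrow> (\<exists>A r f. M = vpair A (vpair r f) \<and> elts A \<noteq> {} \<and>
     function_on (rel_syms L) r \<and>
     (\<forall>R\<in>elts (rel_syms L). elts (app r R) \<subseteq> elts (funs (rel_arity L R) A)) \<and>
     function_on (fun_syms L) f \<and>
     (\<forall>F\<in>elts (fun_syms L). app f F \<in> elts (funs (funs (fun_arity L F) A) A)))"

definition universe :: "'v \<Rightarrow> 'v" where
  "universe M = vfst M"

definition rel_int :: "'v \<Rightarrow> 'v \<Rightarrow> 'v" where
  "rel_int M R = app (vfst (vsnd M)) R"

definition fun_int :: "'v \<Rightarrow> 'v \<Rightarrow> 'v" where
  "fun_int M F = app (vsnd (vsnd M)) F"

definition isomorphic :: "'v \<Rightarrow> 'v \<Rightarrow> 'v \<Rightarrow> bool" where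
  "isomorphic L M N \<longleftrightarrow> (\<exists>h\<in>elts (funs (universe M) (universe N)).
     bij_betw (app h) (elts (universe M)) (elts (universe N)) \<and>
     (\<forall>R\<in>elts (rel_syms L). \<forall>x\<in>elts (funs (rel_arity L R) (universe M)).
        x \<in> elts (rel_int M R) \<longleftrightarrow> vcomp h x \<in> elts (rel_int N R)) \<and>
     (\<forall>F\<in>elts (fun_syms L). \<forall>x\<in>elts (funs (fun_arity L F) (universe M)).
        app h (app (fun_int M F) x) = app (fun_int N F) (vcomp h x)))"

section \<open>Formulas\<close>

definition Var_code :: "'v \<Rightarrow> 'v" where
  "Var_code k = vpair (numeral_code 0) k"

definition Fun_code :: "'v \<Rightarrow> 'v \<Rightarrow> 'v" where
  "Fun_code F u = vpair (numeral_code 1) (vpair F u)"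

definition Eq_code :: "'v \<Rightarrow> 'v \<Rightarrow> 'v" where
  "Eq_code t u = vpair (numeral_code 0) (vpair t u)"

definition Rel_code :: "'v \<Rightarrow> 'v \<Rightarrow> 'v" where
  "Rel_code R u = vpair (numeral_code 1) (vpair R u)"

definition Neg_code :: "'v \<Rightarrow> 'v" where
  "Neg_code \<phi> = vpair (numeral_code 2) \<phi>"

definition Conj_code :: "'v \<Rightarrow> 'v \<Rightarrow> 'v" where
  "Conj_code \<phi> \<psi> = vpair (numeral_code 3) (vpair \<phi> \<psi>)"

definition Ex_code :: "'v \<Rightarrow> 'v \<Rightarrow> 'v" where
  "Ex_code k \<phi> = vpair (numeral_code 4) (vpair k \<phi>)"

definition All_code :: "'v \<Rightarrow> 'v \<Rightarrow> 'v" where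
  "All_code k \<phi> = Neg_code (Ex_code k (Neg_code \<phi>))"

text \<open>\<open>terms_in L X\<close>: the \<open>L\<close>-terms all of whose variables \<open>v\<^sub>k\<close> have index \<open>k\<close> in \<open>X\<close>.\<close>

definition terms_in :: "'v \<Rightarrow> 'v \<Rightarrow> 'v" where
  "terms_in L X = least_closed (\<lambda>T.
     (\<forall>k\<in>elts X. Var_code k \<in> elts T) \<and>
     (\<forall>F\<in>elts (fun_syms L). \<forall>u\<in>elts (funs (fun_arity L F) T). Fun_code F u \<in> elts T))"

text \<open>
  \<open>formulas_in L X\<close>: the \<open>L\<close>-formulas whose free variables have index in \<open>X\<close>. The inductive
  definition is simultaneous for all subsets \<open>X\<close> of \<open>\<omega>\<close>, as binding \<open>v\<^sub>k\<close> passes from the index set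
  \<open>X \<union> {k}\<close> to \<open>X\<close>. So \<open>formulas_in L n\<close> with \<open>n \<in> \<omega>\<close> consists of the formulas
  \<open>\<phi>(v\<^sub>0, \<dots>, v\<^sub>n\<^sub>-\<^sub>1)\<close>, and \<open>formulas_in L \<emptyset>\<close> of the sentences.
\<close>

definition formula_pairs :: "'v \<Rightarrow> 'v" where
  "formula_pairs L = least_closed (\<lambda>W. \<forall>X. elts X \<subseteq> elts omega \<longrightarrow>
     (\<forall>t\<in>elts (terms_in L X). \<forall>u\<in>elts (terms_in L X). vpair X (Eq_code t u) \<in> elts W) \<and>
     (\<forall>R\<in>elts (rel_syms L). \<forall>u\<in>elts (funs (rel_arity L R) (terms_in L X)).
        vpair X (Rel_code R u) \<in> elts W) \<and>
     (\<forall>\<phi>. vpair X \<phi> \<in> elts W \<longrightarrow> vpair X (Neg_code \<phi>) \<in> elts W) \<and>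
     (\<forall>\<phi> \<psi>. vpair X \<phi> \<in> elts W \<and> vpair X \<psi> \<in> elts W \<longrightarrow> vpair X (Conj_code \<phi> \<psi>) \<in> elts W) \<and>
     (\<forall>k\<in>elts omega. \<forall>\<phi>. vpair (vset (insert k (elts X))) \<phi> \<in> elts W \<longrightarrow>
        vpair X (Ex_code k \<phi>) \<in> elts W))"

definition formulas_in :: "'v \<Rightarrow> 'v \<Rightarrow> 'v" where
  "formulas_in L X = vset {\<phi>. vpair X \<phi> \<in> elts (formula_pairs L)}"

definition qf_formulas :: "'v \<Rightarrow> 'v" where
  "qf_formulas L = least_closed (\<lambda>Q.
     (\<forall>t\<in>elts (terms_in L omega). \<forall>u\<in>elts (terms_in L omega). Eq_code t u \<in> elts Q) \<and>
     (\<forall>R\<in>elts (rel_syms L). \<forall>u\<in>elts (funs (rel_arity L R) (terms_in L omega)).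
        Rel_code R u \<in> elts Q) \<and>
     (\<forall>\<phi>\<in>elts Q. Neg_code \<phi> \<in> elts Q) \<and>
     (\<forall>\<phi>\<in>elts Q. \<forall>\<psi>\<in>elts Q. Conj_code \<phi> \<psi> \<in> elts Q))"

text \<open>
  Prenex formulas with \<open>n\<close> alternating, possibly empty blocks of like quantifiers; a block has
  finitely many quantifiers in the sense of the model.
\<close>

fun Sigma_formulas :: "nat \<Rightarrow> 'v \<Rightarrow> 'v" and Pi_formulas :: "nat \<Rightarrow> 'v \<Rightarrow> 'v" where
  "Sigma_formulas 0 L = qf_formulas L"
| "Pi_formulas 0 L = qf_formulas L"
| "Sigma_formulas (Suc n) L = least_closed (\<lambda>Q. elts (Pi_formulas n L) \<subseteq> elts Q \<and>
     (\<forall>k\<in>elts omega. \<forall>\<phi>\<in>elts Q. Ex_code k \<phi> \<in> elts Q))"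
| "Pi_formulas (Suc n) L = least_closed (\<lambda>Q. elts (Sigma_formulas n L) \<subseteq> elts Q \<and>
     (\<forall>k\<in>elts omega. \<forall>\<phi>\<in>elts Q. All_code k \<phi> \<in> elts Q))"

section \<open>Satisfaction\<close>

text \<open>
  An assignment is a function \<open>s\<close> from a set \<open>X\<close> of variable indices to the universe; it is used
  with the terms and formulas over that index set \<open>X\<close>.
\<close>

definition is_term_eval :: "'v \<Rightarrow> 'v \<Rightarrow> 'v \<Rightarrow> 'v \<Rightarrow> bool" where
  "is_term_eval L M s v \<longleftrightarrow>
     v \<in> elts (funs (terms_in L (vdom s)) (universe M)) \<and>
     (\<forall>k\<in>elts (vdom s). app v (Var_code k) = app s k) \<and>
     (\<forall>F\<in>elts (fun_syms L). \<forall>u\<in>elts (funs (fun_arity L F) (terms_in L (vdom s))).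
        app v (Fun_code F u) = app (fun_int M F) (vcomp v u))"

definition term_eval :: "'v \<Rightarrow> 'v \<Rightarrow> 'v \<Rightarrow> 'v" where
  "term_eval L M s = (THE v. is_term_eval L M s v)"

text \<open>Tarski's clauses for a set \<open>S\<close> of pairs \<open>(\<phi>, s)\<close>.\<close>

definition is_satisfaction :: "'v \<Rightarrow> 'v \<Rightarrow> 'v \<Rightarrow> bool" where
  "is_satisfaction L M S \<longleftrightarrow>
     (\<forall>X s. elts X \<subseteq> elts omega \<and> s \<in> elts (funs X (universe M)) \<longrightarrow>
       (\<forall>t\<in>elts (terms_in L X). \<forall>u\<in>elts (terms_in L X).
          vpair (Eq_code t u) s \<in> elts S \<longleftrightarrow> app (term_eval L M s) t = app (term_eval L M s) u) \<and>
       (\<forall>R\<in>elts (rel_syms L). \<forall>u\<in>elts (funs (rel_arity L R) (terms_in L X)).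
          vpair (Rel_code R u) s \<in> elts S \<longleftrightarrow> vcomp (term_eval L M s) u \<in> elts (rel_int M R)) \<and>
       (\<forall>\<phi>\<in>elts (formulas_in L X).
          vpair (Neg_code \<phi>) s \<in> elts S \<longleftrightarrow> vpair \<phi> s \<notin> elts S) \<and>
       (\<forall>\<phi>\<in>elts (formulas_in L X). \<forall>\<psi>\<in>elts (formulas_in L X).
          vpair (Conj_code \<phi> \<psi>) s \<in> elts S \<longleftrightarrow> vpair \<phi> s \<in> elts S \<and> vpair \<psi> s \<in> elts S) \<and>
       (\<forall>k\<in>elts omega. \<forall>\<phi>\<in>elts (formulas_in L (vset (insert k (elts X)))).
          vpair (Ex_code k \<phi>) s \<in> elts S \<longleftrightarrow>
            (\<exists>a\<in>elts (universe M). vpair \<phi> (vupd s k a) \<in> elts S)))"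

definition satisfies :: "'v \<Rightarrow> 'v \<Rightarrow> 'v \<Rightarrow> 'v \<Rightarrow> bool" where
  "satisfies L M \<phi> s \<longleftrightarrow> (\<exists>S. is_satisfaction L M S \<and> vpair \<phi> s \<in> elts S)"

definition Sigma_equivalent :: "nat \<Rightarrow> 'v \<Rightarrow> 'v \<Rightarrow> 'v \<Rightarrow> bool" where
  "Sigma_equivalent n L M N \<longleftrightarrow>
     (\<forall>\<phi>\<in>elts (Sigma_formulas n L) \<inter> elts (formulas_in L (vset {})).
        satisfies L M \<phi> (vset {}) \<longleftrightarrow> satisfies L N \<phi> (vset {}))"

definition elementary_embedding :: "'v \<Rightarrow> 'v \<Rightarrow> 'v \<Rightarrow> 'v \<Rightarrow> bool" where
  "elementary_embedding L M N j \<longleftrightarrow>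
     j \<in> elts (funs (universe M) (universe N)) \<and>
     (\<forall>n\<in>elts omega. \<forall>\<phi>\<in>elts (formulas_in L n). \<forall>s\<in>elts (funs n (universe M)).
        satisfies L M \<phi> s \<longleftrightarrow> satisfies L N \<phi> (vcomp j s))"

section \<open>Ultraproducts\<close>

definition structure_family :: "'v \<Rightarrow> 'v \<Rightarrow> 'v \<Rightarrow> bool" where
  "structure_family L I M \<longleftrightarrow> function_on I M \<and> (\<forall>i\<in>elts I. is_structure L (app M i))"

definition product :: "'v \<Rightarrow> 'v \<Rightarrow> 'v" where
  "product I M = vset {f. function_on I f \<and> (\<forall>i\<in>elts I. app f i \<in> elts (universe (app M i)))}"

definition ultra_class :: "'v \<Rightarrow> 'v \<Rightarrow> 'v \<Rightarrow> 'v \<Rightarrow> 'v" where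
  "ultra_class I U M f =
     vset {g \<in> elts (product I M). vset {i \<in> elts I. app f i = app g i} \<in> elts U}"

text \<open>For a tuple \<open>f = (f\<^sub>0, f\<^sub>1, \<dots>)\<close> of elements of the product, the tuples \<open>([f\<^sub>0], [f\<^sub>1], \<dots>)\<close> and
  \<open>(f\<^sub>0(i), f\<^sub>1(i), \<dots>)\<close>.\<close>

definition tuple_class :: "'v \<Rightarrow> 'v \<Rightarrow> 'v \<Rightarrow> 'v \<Rightarrow> 'v" where
  "tuple_class I U M f = vlam (vdom f) (\<lambda>k. ultra_class I U M (app f k))"

definition tuple_at :: "'v \<Rightarrow> 'v \<Rightarrow> 'v" where
  "tuple_at f i = vlam (vdom f) (\<lambda>k. app (app f k) i)"

definition ultraproduct :: "'v \<Rightarrow> 'v \<Rightarrow> 'v \<Rightarrow> 'v \<Rightarrow> 'v" where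
  "ultraproduct L I U M =
     vpair (vset (ultra_class I U M ` elts (product I M)))
       (vpair
         (vlam (rel_syms L) (\<lambda>R. vset {tuple_class I U M f | f.
            f \<in> elts (funs (rel_arity L R) (product I M)) \<and>
            vset {i \<in> elts I. tuple_at f i \<in> elts (rel_int (app M i) R)} \<in> elts U}))
         (vlam (fun_syms L) (\<lambda>F. vset {
            vpair (tuple_class I U M f)
              (ultra_class I U M (vlam I (\<lambda>i. app (fun_int (app M i) F) (tuple_at f i)))) | f.
            f \<in> elts (funs (fun_arity L F) (product I M))})))"

definition ultrapower :: "'v \<Rightarrow> 'v \<Rightarrow> 'v \<Rightarrow> 'v \<Rightarrow> 'v" where
  "ultrapower L I U M = ultraproduct L I U (vlam I (\<lambda>_. M))"

section \<open>The six statements\<close>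

definition Los_theorem :: bool where
  "Los_theorem \<longleftrightarrow> (\<forall>L I U M.
     is_language L \<and> ultrafilter I U \<and> structure_family L I M \<and> elts (product I M) \<noteq> {} \<longrightarrow>
     (\<forall>n\<in>elts omega. \<forall>\<phi>\<in>elts (formulas_in L n). \<forall>f\<in>elts (funs n (product I M)).
        satisfies L (ultraproduct L I U M) \<phi> (tuple_class I U M f) \<longleftrightarrow>
        vset {i \<in> elts I. satisfies L (app M i) \<phi> (tuple_at f i)} \<in> elts U))"

definition ultrapowers_Sigma2_equivalent :: bool where
  "ultrapowers_Sigma2_equivalent \<longleftrightarrow> (\<forall>L I U M.
     is_language L \<and> is_structure L M \<and> ultrafilter I U \<longrightarrow>
     Sigma_equivalent 2 L (ultrapower L I U M) M)"

definition isomorphic_factors_Sigma1_equivalent :: bool where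
  "isomorphic_factors_Sigma1_equivalent \<longleftrightarrow> (\<forall>L I U M.
     is_language L \<and> structure_family L I M \<and> ultrafilter I U \<and>
     (\<forall>i\<in>elts I. \<forall>j\<in>elts I. isomorphic L (app M i) (app M j)) \<and>
     elts (product I M) \<noteq> {} \<longrightarrow>
     (\<forall>i\<in>elts I. Sigma_equivalent 1 L (ultraproduct L I U M) (app M i)))"

definition biembeddable_ultrapowers_Sigma2_equivalent :: bool where
  "biembeddable_ultrapowers_Sigma2_equivalent \<longleftrightarrow> (\<forall>L I U M N.
     is_language L \<and> is_structure L M \<and> is_structure L N \<and> ultrafilter I U \<and>
     (\<exists>j. elementary_embedding L M N j) \<and> (\<exists>j'. elementary_embedding L N M j') \<longrightarrow>
     Sigma_equivalent 2 L (ultrapower L I U M) (ultrapower L I U N))"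

definition isomorphic_families_Sigma1_equivalent :: bool where
  "isomorphic_families_Sigma1_equivalent \<longleftrightarrow> (\<forall>L I U M N.
     is_language L \<and> structure_family L I M \<and> structure_family L I N \<and> ultrafilter I U \<and>
     (\<forall>i\<in>elts I. isomorphic L (app M i) (app N i)) \<and>
     elts (product I M) \<noteq> {} \<and> elts (product I N) \<noteq> {} \<longrightarrow>
     Sigma_equivalent 1 L (ultraproduct L I U M) (ultraproduct L I U N))"

definition isomorphic_families_isomorphic_ultraproducts :: bool where
  "isomorphic_families_isomorphic_ultraproducts \<longleftrightarrow> (\<forall>L I U M N.
     is_language L \<and> structure_family L I M \<and> structure_family L I N \<and> ultrafilter I U \<and>
     (\<forall>i\<in>elts I. isomorphic L (app M i) (app N i)) \<and>
     elts (product I M) \<noteq> {} \<and> elts (product I N) \<noteq> {} \<longrightarrow>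
     isomorphic L (ultraproduct L I U M) (ultraproduct L I U N))"

end

end

theory Submission imports Defs begin

text \<open>
  All six statements are equivalent to choice modulo ultrafilters: if \<open>U\<close> is an ultrafilter over
  \<open>I\<close> and all \<open>A\<^sub>i\<close> are nonempty, then some function on \<open>I\<close> chooses from \<open>A\<^sub>i\<close> for
  \<open>U\<close>-almost all \<open>i\<close>. This is what the quantifier step of Los's theorem needs, and it makes it possible to
  glue isomorphisms \<open>M\<^sub>i \<cong> N\<^sub>i\<close>.

  Conversely, let \<open>A\<^sub>i\<close> be nonempty. (2) Some structure on a set containing \<open>I\<close> and all
  \<open>A\<^sub>i\<close> satisfies \<open>\<forall>x \<exists>y R(x, y)\<close>, where \<open>R(i, y)\<close> means \<open>y \<in> A\<^sub>i\<close>; a witness for the class of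
  the identity of \<open>I\<close> in the ultrapower is a choice function. (3), (5), (6) If \<open>Z\<close> contains all
  \<open>A\<^sub>i\<close> and is closed under pairing, then all \<open>A\<^sub>i \<times> Z\<close> are equinumerous with \<open>Z\<close>, though not uniformly. With a
  point added they form a family of isomorphic structures whose ultraproduct has a second element
  only if there is a choice function. (4) A choice function is coded by an equivalence relation
  with infinitely many infinite classes, and elementarily embedded in both directions with one on
  which choice is definable.

  In a model of ZF, all sets used must come from instances of Separation and Replacement, so that
  definability with parameters has to be tracked throughout.
\<close>

text \<open>Statements (4), (5) and (6) compare two ultraproducts, so one of the two must be known
  outright. Its family is constant, or choice for its relation is definable, and the sentence at
  issue is evaluated there without choice; the other ultraproduct inherits the truth value and with
  it a choice function. Two sentences suffice and explain the levels: that some point has no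
  successor is Sigma_2, that two points differ is Sigma_1.

  The point added to the sets A_i x Z keeps the product nonempty: a member of the product of the
  sets A_i x Z alone would already be a choice function.

  The natural numbers of the model may be nonstandard, so tuples and formulas need not be finite in
  the sense of HOL. Selecting representatives for a tuple of classes, intersecting finitely many
  members of \<open>U\<close> and running through formulas are therefore inductions inside the
  model, on first-order predicates only. Statement (6) is obtained from choice modulo ultrafilters
  directly, because an isomorphism has to be constructed and not merely a sentence
  transferred.\<close>

section \<open>First-order definability\<close>

named_theorems fo_intros

context membership
begin

text \<open>
  \<open>fo P\<close>: the class \<open>P\<close> of environments is first-order definable with parameters. Asking for a
  formula for every renaming \<open>r\<close> of the variables and every allocation \<open>q\<close> of the parameters makes
  the notion closed under quantification without any substitution lemma. Predicates are written in
  de Bruijn style: a quantifier binds \<open>e 0\<close> and shifts \<open>e\<close>.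
\<close>

definition fo_on :: "nat set \<Rightarrow> 'v set \<Rightarrow> ((nat \<Rightarrow> 'v) \<Rightarrow> bool) \<Rightarrow> bool" where
  "fo_on F C P \<longleftrightarrow> finite F \<and> finite C \<and> (\<forall>e e'. (\<forall>i\<in>F. e i = e' i) \<longrightarrow> P e = P e') \<and>
     (\<forall>r q. \<exists>\<psi>. \<forall>e. (\<forall>c\<in>C. e (q c) = c) \<longrightarrow> set_sat E \<psi> e = P (\<lambda>n. e (r n)))"

definition fo :: "((nat \<Rightarrow> 'v) \<Rightarrow> bool) \<Rightarrow> bool" where
  "fo P \<longleftrightarrow> (\<exists>F C. fo_on F C P)"

text \<open>The formulas of \<open>set_fm\<close> have no function symbols, so an operation counts
  as definable when its graph is. The value sits in \<open>e 0\<close>, and the environment of the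
  operation is shifted past it as under a quantifier.\<close>

definition ft :: "((nat \<Rightarrow> 'v) \<Rightarrow> 'v) \<Rightarrow> bool" where
  "ft T \<longleftrightarrow> fo (\<lambda>e. e 0 = T (\<lambda>n. e (Suc n)))"

lemma foI:
  assumes "finite F" "finite C" "\<And>e e'. (\<And>i. i \<in> F \<Longrightarrow> e i = e' i) \<Longrightarrow> P e = P e'"
    "\<And>r q. \<exists>\<psi>. \<forall>e. (\<forall>c\<in>C. e (q c) = c) \<longrightarrow> set_sat E \<psi> e = P (\<lambda>n. e (r n))"
  shows "fo P"
proof -
  have "fo_on F C P"
    unfolding fo_on_def
  proof (intro conjI allI impI)
    show "P e = P e'" if "\<forall>i\<in>F. e i = e' i" for e e'
      by (rule assms(3)) (use that in blast)
  qed (fact assms)+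
  then show ?thesis unfolding fo_def by blast
qed

lemma fo_on_cong: "fo_on F C P \<Longrightarrow> (\<And>i. i \<in> F \<Longrightarrow> e i = e' i) \<Longrightarrow> P e = P e'"
  unfolding fo_on_def by blast

lemma fo_on_formula:
  assumes "fo_on F C P"
  obtains \<psi> where "\<forall>e. (\<forall>c\<in>C. e (q c) = c) \<longrightarrow> set_sat E \<psi> e = P (\<lambda>n. e (r n))"
proof -
  have "\<forall>r q. \<exists>\<psi>. \<forall>e. (\<forall>c\<in>C. e (q c) = c) \<longrightarrow> set_sat E \<psi> e = P (\<lambda>n. e (r n))"
    using assms unfolding fo_on_def by (elim conjE)
  from spec[OF spec[OF this, of r], of q]
  obtain \<psi> where "\<forall>e. (\<forall>c\<in>C. e (q c) = c) \<longrightarrow> set_sat E \<psi> e = P (\<lambda>n. e (r n))" ..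
  then show thesis by (rule that)
qed

lemma fo_on_finite: "fo_on F C P \<Longrightarrow> finite F" "fo_on F C P \<Longrightarrow> finite C"
  unfolding fo_on_def by blast+

lemma fo_var_mem: "fo (\<lambda>e. E (e i) (e j))"
proof (rule foI[of "{i, j}" "{}"])
  show "\<exists>\<psi>. \<forall>e. (\<forall>c\<in>{}. e (q c) = c) \<longrightarrow> set_sat E \<psi> e = E (e (r i)) (e (r j))"
    for r :: "nat \<Rightarrow> nat" and q :: "'v \<Rightarrow> nat"
    by (rule exI[of _ "Mem (r i) (r j)"]) simp
qed auto

lemma fo_var_eq: "fo (\<lambda>e. e i = e j)"
proof (rule foI[of "{i, j}" "{}"])
  show "\<exists>\<psi>. \<forall>e. (\<forall>c\<in>{}. e (q c) = c) \<longrightarrow> set_sat E \<psi> e = (e (r i) = e (r j))"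
    for r :: "nat \<Rightarrow> nat" and q :: "'v \<Rightarrow> nat"
    by (rule exI[of _ "Equal (r i) (r j)"]) simp
qed auto

lemma fo_var_eq_const: "fo (\<lambda>e. e i = c)"
proof (rule foI[of "{i}" "{c}"])
  show "\<exists>\<psi>. \<forall>e. (\<forall>c\<in>{c}. e (q c) = c) \<longrightarrow> set_sat E \<psi> e = (e (r i) = c)"
    for r :: "nat \<Rightarrow> nat" and q :: "'v \<Rightarrow> nat"
    by (rule exI[of _ "Equal (r i) (q c)"]) simp
qed auto

lemma fo_not [fo_intros]:
  assumes "fo P" shows "fo (\<lambda>e. \<not> P e)"
proof -
  from assms obtain F C where *: "fo_on F C P"
    unfolding fo_def by blast
  show ?thesis
  proof (rule foI[OF fo_on_finite[OF *]])
    show "\<exists>\<psi>. \<forall>e. (\<forall>c\<in>C. e (q c) = c) \<longrightarrow> set_sat E \<psi> e = (\<not> P (\<lambda>n. e (r n)))" for r q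
    proof -
      obtain \<psi> where "\<forall>e. (\<forall>c\<in>C. e (q c) = c) \<longrightarrow> set_sat E \<psi> e = P (\<lambda>n. e (r n))"
        by (rule fo_on_formula[OF *, where q = q and r = r])
      then show ?thesis by (intro exI[of _ "Neg \<psi>"]) simp
    qed
    show "(\<not> P e) = (\<not> P e')" if "\<And>i. i \<in> F \<Longrightarrow> e i = e' i" for e e'
      using fo_on_cong[OF *, of e e'] that by simp
  qed
qed

lemma fo_conj [fo_intros]:
  assumes "fo P" "fo Q" shows "fo (\<lambda>e. P e \<and> Q e)"
proof -
  from assms obtain F C F' C' where *: "fo_on F C P" and **: "fo_on F' C' Q"
    unfolding fo_def by blast
  show ?thesis
  proof (rule foI[of "F \<union> F'" "C \<union> C'"])
    show "\<exists>\<psi>. \<forall>e. (\<forall>c\<in>C \<union> C'. e (q c) = c) \<longrightarrow>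
        set_sat E \<psi> e = (P (\<lambda>n. e (r n)) \<and> Q (\<lambda>n. e (r n)))" for r q
    proof -
      obtain \<psi> where "\<forall>e. (\<forall>c\<in>C. e (q c) = c) \<longrightarrow> set_sat E \<psi> e = P (\<lambda>n. e (r n))"
        by (rule fo_on_formula[OF *, where q = q and r = r])
      moreover obtain \<psi>' where
        "\<forall>e. (\<forall>c\<in>C'. e (q c) = c) \<longrightarrow> set_sat E \<psi>' e = Q (\<lambda>n. e (r n))"
        by (rule fo_on_formula[OF **, where q = q and r = r])
      ultimately show ?thesis by (intro exI[of _ "Conj \<psi> \<psi>'"]) simp
    qed
    show "(P e \<and> Q e) = (P e' \<and> Q e')" if "\<And>i. i \<in> F \<union> F' \<Longrightarrow> e i = e' i" for e e'
      using fo_on_cong[OF *, of e e'] fo_on_cong[OF **, of e e'] that by simp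
  qed (use fo_on_finite[OF *] fo_on_finite[OF **] in simp_all)
qed

text \<open>The bound variable gets an index \<open>k\<close> outside the renamed free variables and
  outside the slots of the parameters. Such a \<open>k\<close> exists because both sets are finite,
  which is why \<open>fo_on\<close> records a finite support.\<close>

lemma fo_ex [fo_intros]:
  assumes "fo (\<lambda>e. Q (e 0) (\<lambda>n. e (Suc n)))" shows "fo (\<lambda>e. \<exists>x. Q x e)"
proof -
  define P where "P = (\<lambda>e. Q (e 0) (\<lambda>n. e (Suc n)))"
  from assms obtain F C where *: "fo_on F C P"
    unfolding fo_def P_def[symmetric] by blast
  have Q: "Q x e = P (case_nat x e)" for x e
    by (simp add: P_def)
  \<comment> \<open>Removing the quantifier lowers all indices by one. Truncated subtraction also
    sends the bound index 0 to 0, which at worst enlarges the support.\<close>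
  show ?thesis
  proof (rule foI[of "(\<lambda>n. n - 1) ` F" C])
    fix r :: "nat \<Rightarrow> nat" and q :: "'v \<Rightarrow> nat"
    have "finite (r ` (\<lambda>n. n - 1) ` F \<union> q ` C)"
      using fo_on_finite[OF *] by simp
    from ex_new_if_finite[OF infinite_UNIV_nat this]
    obtain k where "k \<notin> r ` (\<lambda>n. n - 1) ` F \<union> q ` C" ..
    then have k: "c \<in> C \<Longrightarrow> q c \<noteq> k" "i \<in> F \<Longrightarrow> r (i - 1) \<noteq> k" for c i
      by (auto simp: image_iff)
    obtain \<psi> where \<psi>: "\<forall>e. (\<forall>c\<in>C. e (q c) = c) \<longrightarrow>
        set_sat E \<psi> e = P (\<lambda>n. e (case_nat k r n))"
      by (rule fo_on_formula[OF *, where q = q and r = "case_nat k r"])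
    have "set_sat E (Exists k \<psi>) e = (\<exists>x. Q x (\<lambda>n. e (r n)))" if e: "\<forall>c\<in>C. e (q c) = c" for e
    proof -
      have "set_sat E \<psi> (e(k := x)) = Q x (\<lambda>n. e (r n))" for x
      proof -
        have "set_sat E \<psi> (e(k := x)) = P (\<lambda>n. (e(k := x)) (case_nat k r n))"
          by (rule \<psi>[rule_format]) (use e k(1) in simp)
        also have "\<dots> = P (case_nat x (\<lambda>n. e (r n)))"
        proof (rule fo_on_cong[OF *])
          show "(e(k := x)) (case_nat k r i) = (case i of 0 \<Rightarrow> x | Suc n \<Rightarrow> e (r n))"
            if "i \<in> F" for i
            using k(2)[OF that] by (cases i) simp_all
        qed
        finally show ?thesis by (simp add: Q)
      qed
      then show ?thesis by simp
    qed
    then show "\<exists>\<psi>. \<forall>e. (\<forall>c\<in>C. e (q c) = c) \<longrightarrow> set_sat E \<psi> e = (\<exists>x. Q x (\<lambda>n. e (r n)))"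
      by (intro exI[of _ "Exists k \<psi>"] allI impI)
  next
    fix e e' :: "nat \<Rightarrow> 'v"
    assume ee: "\<And>i. i \<in> (\<lambda>n. n - 1) ` F \<Longrightarrow> e i = e' i"
    have "Q x e = Q x e'" for x
      unfolding Q
    proof (rule fo_on_cong[OF *])
      show "case_nat x e i = case_nat x e' i" if "i \<in> F" for i
        using ee[OF imageI[OF that]] by (cases i) simp_all
    qed
    then show "(\<exists>x. Q x e) = (\<exists>x. Q x e')" by simp
  qed (use fo_on_finite[OF *] in simp_all)
qed

text \<open>Since \<open>fo_on\<close> already quantifies over all renamings, it is enough to
  compose the two renamings.\<close>

lemma fo_rename:
  assumes "fo P" shows "fo (\<lambda>e. P (\<lambda>n. e (r n)))"
proof -
  from assms obtain F C where *: "fo_on F C P"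
    unfolding fo_def by blast
  show ?thesis
  proof (rule foI[of "r ` F" C])
    show "\<exists>\<psi>. \<forall>e. (\<forall>c\<in>C. e (q c) = c) \<longrightarrow> set_sat E \<psi> e = P (\<lambda>n. e (r' (r n)))" for r' q
    proof -
      obtain \<psi> where "\<forall>e. (\<forall>c\<in>C. e (q c) = c) \<longrightarrow> set_sat E \<psi> e = P (\<lambda>n. e (r' (r n)))"
        by (rule fo_on_formula[OF *, where q = q and r = "\<lambda>n. r' (r n)"])
      then show ?thesis by (intro exI[of _ \<psi>]) simp
    qed
    show "P (\<lambda>n. e (r n)) = P (\<lambda>n. e' (r n))" if "\<And>i. i \<in> r ` F \<Longrightarrow> e i = e' i" for e e'
      by (rule fo_on_cong[OF *]) (use that in simp)
  qed (use fo_on_finite[OF *] in simp_all)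
qed

lemma fo_const [fo_intros]: "fo (\<lambda>e. P)"
proof (cases P)
  case True
  then show ?thesis using fo_var_eq[of 0 0] by simp
next
  case False
  then show ?thesis using fo_not[OF fo_var_eq[of 0 0]] by simp
qed

lemma fo_disj [fo_intros]: "fo P \<Longrightarrow> fo Q \<Longrightarrow> fo (\<lambda>e. P e \<or> Q e)"
  using fo_not[OF fo_conj[OF fo_not fo_not, of P Q]] by simp

lemma fo_imp [fo_intros]: "fo P \<Longrightarrow> fo Q \<Longrightarrow> fo (\<lambda>e. P e \<longrightarrow> Q e)"
  unfolding imp_conv_disj by (intro fo_disj fo_not)

lemma fo_iff [fo_intros]: "fo P \<Longrightarrow> fo Q \<Longrightarrow> fo (\<lambda>e. P e \<longleftrightarrow> Q e)"
  unfolding iff_conv_conj_imp by (intro fo_conj fo_imp)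

lemma fo_all [fo_intros]: "fo (\<lambda>e. Q (e 0) (\<lambda>n. e (Suc n))) \<Longrightarrow> fo (\<lambda>e. \<forall>x. Q x e)"
  using fo_not[of "\<lambda>e. \<exists>x. \<not> Q x e"] fo_ex[of "\<lambda>x e. \<not> Q x e"]
    fo_not[of "\<lambda>e. Q (e 0) (\<lambda>n. e (Suc n))"] by simp

text \<open>A term is substituted through its graph, as in
  \<open>\<exists>x. x = T e \<and> Q x e\<close>, so that no substitution inside formulas is ever
  performed.\<close>

lemma fo_subst:
  assumes "ft T" "fo (\<lambda>e. Q (e 0) (\<lambda>n. e (Suc n)))" shows "fo (\<lambda>e. Q (T e) e)"
proof -
  have "fo (\<lambda>e. \<exists>x. x = T e \<and> Q x e)"
    using assms by (intro fo_ex fo_conj) (simp_all add: ft_def)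
  then show ?thesis by simp
qed

lemma ft_var [fo_intros]: "ft (\<lambda>e. e i)"
  unfolding ft_def by (rule fo_var_eq)

lemma ft_const [fo_intros]: "ft (\<lambda>e. c)"
  unfolding ft_def by (rule fo_var_eq_const)

lemma ft_rename: "ft T \<Longrightarrow> ft (\<lambda>e. T (\<lambda>n. e (r n)))"
  unfolding ft_def using fo_rename[of "\<lambda>e. e 0 = T (\<lambda>n. e (Suc n))" "case_nat 0 (\<lambda>n. Suc (r n))"]
  by simp

section \<open>Composition of definable predicates and operations with definable terms\<close>

lemma fo_pred1:
  assumes "fo (\<lambda>e. P (e 0))" "ft T" shows "fo (\<lambda>e. P (T e))"
  by (rule fo_subst[where Q = "\<lambda>x e. P x"]) (use assms in simp_all)

text \<open>The arguments are substituted one after the other. Each substitution introduces a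
  variable, past which the remaining terms must be shifted; the order of the variables is put right
  by a renaming at the end.\<close>

lemma fo_pred2:
  assumes P: "fo (\<lambda>e. P (e 0) (e 1))" and T: "ft T" "ft U" shows "fo (\<lambda>e. P (T e) (U e))"
proof (rule fo_subst[where Q = "\<lambda>x e. P x (U e)", OF T(1)])
  show "fo (\<lambda>e. P (e 0) (U (\<lambda>n. e (Suc n))))"
  proof (rule fo_subst[where Q = "\<lambda>x e. P (e 0) x"])
    show "fo (\<lambda>e. P (e (Suc 0)) (e 0))"
      using fo_rename[OF P, of "\<lambda>n. if n = 0 then 1 else 0"] by simp
  qed (rule ft_rename[OF T(2)])
qed

lemma fo_pred3:
  assumes P: "fo (\<lambda>e. P (e 0) (e 1) (e 2))" and T: "ft T" "ft U" "ft W"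
  shows "fo (\<lambda>e. P (T e) (U e) (W e))"
proof (rule fo_subst[where Q = "\<lambda>x e. P (T e) (U e) x", OF T(3)])
  let ?s = "\<lambda>e n. e (Suc n)"
  show "fo (\<lambda>e. P (T (?s e)) (U (?s e)) (e 0))"
  proof (rule fo_subst[where Q = "\<lambda>x e. P (T (?s e)) x (e 0)"])
    show "fo (\<lambda>e. P (T (?s (?s e))) (e 0) (e (Suc 0)))"
    proof (rule fo_subst[where Q = "\<lambda>x e. P x (e 0) (e 1)", unfolded One_nat_def])
      show "fo (\<lambda>e. P (e 0) (e (Suc 0)) (e (Suc (Suc 0))))"
        using P by (simp add: numeral_2_eq_2)
      show "ft (\<lambda>e. T (?s (?s e)))"
        using ft_rename[OF T(1), of "\<lambda>n. Suc (Suc n)"] by simp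
    qed
  qed (rule ft_rename[OF T(2)])
qed

lemma fo_pred4:
  assumes P: "fo (\<lambda>e. P (e 0) (e 1) (e 2) (e 3))" and T: "ft T" "ft U" "ft W" "ft Z"
  shows "fo (\<lambda>e. P (T e) (U e) (W e) (Z e))"
proof -
  have "fo (\<lambda>e. \<exists>w z. w = W e \<and> z = Z e \<and> P (T e) (U e) w z)"
  proof (intro fo_ex fo_conj)
    show "fo (\<lambda>e. e (Suc 0) = W (\<lambda>n. e (Suc (Suc n))))"
      by (rule fo_pred2[where P = "(=)", OF fo_var_eq ft_var ft_rename[OF T(3)]])
    show "fo (\<lambda>e. e 0 = Z (\<lambda>n. e (Suc (Suc n))))"
      by (rule fo_pred2[where P = "(=)", OF fo_var_eq ft_var ft_rename[OF T(4)]])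
    show "fo (\<lambda>e. P (T (\<lambda>n. e (Suc (Suc n)))) (U (\<lambda>n. e (Suc (Suc n)))) (e (Suc 0)) (e 0))"
    proof (rule fo_subst[where Q = "\<lambda>x e. P (T (\<lambda>n. e (Suc (Suc n)))) x (e (Suc 0)) (e 0)"])
      show "ft (\<lambda>e. U (\<lambda>n. e (Suc (Suc n))))" by (rule ft_rename[OF T(2)])
      show "fo (\<lambda>e. P (T (\<lambda>n. e (Suc (Suc (Suc n))))) (e 0) (e (Suc (Suc 0))) (e (Suc 0)))"
      proof (rule fo_subst[where Q = "\<lambda>x e. P x (e 0) (e (Suc (Suc 0))) (e (Suc 0))"])
        show "ft (\<lambda>e. T (\<lambda>n. e (Suc (Suc (Suc n)))))" by (rule ft_rename[OF T(1)])
        show "fo (\<lambda>e. P (e 0) (e (Suc 0)) (e (Suc (Suc (Suc 0)))) (e (Suc (Suc 0))))"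
          using fo_rename[OF P, of "\<lambda>n. if n = 2 then 3 else if n = 3 then 2 else n"]
          by (simp add: eval_nat_numeral)
      qed
    qed
  qed
  then show ?thesis by simp
qed

lemma ft_fun1:
  assumes "ft (\<lambda>e. G (e 0))" "ft T" shows "ft (\<lambda>e. G (T e))"
  unfolding ft_def
proof (rule fo_pred2[where P = "\<lambda>x y. x = G y", OF _ ft_var ft_rename[OF assms(2)]])
  show "fo (\<lambda>e. e 0 = G (e 1))"
    using assms(1) by (simp add: ft_def)
qed

lemma ft_fun2:
  assumes "ft (\<lambda>e. G (e 0) (e 1))" "ft T" "ft U" shows "ft (\<lambda>e. G (T e) (U e))"
  unfolding ft_def
proof (rule fo_pred3[where P = "\<lambda>x y z. x = G y z", OF _ ft_var ft_rename[OF assms(2)]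
      ft_rename[OF assms(3)]])
  show "fo (\<lambda>e. e 0 = G (e 1) (e 2))"
    using assms(1) by (simp add: ft_def numeral_2_eq_2)
qed

lemma ft_fun3:
  assumes "ft (\<lambda>e. G (e 0) (e 1) (e 2))" "ft T" "ft U" "ft W"
  shows "ft (\<lambda>e. G (T e) (U e) (W e))"
  unfolding ft_def
proof (rule fo_pred4[where P = "\<lambda>x y z w. x = G y z w", OF _ ft_var ft_rename[OF assms(2)]
      ft_rename[OF assms(3)] ft_rename[OF assms(4)]])
  show "fo (\<lambda>e. e 0 = G (e 1) (e 2) (e 3))"
    using assms(1) by (simp add: ft_def eval_nat_numeral)
qed

section \<open>Definability of set notation, bounded quantifiers and descriptions\<close>

lemma fo_mem [fo_intros]: "ft T \<Longrightarrow> ft U \<Longrightarrow> fo (\<lambda>e. E (T e) (U e))"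
  by (rule fo_pred2[where P = E, OF fo_var_mem])

lemma fo_eq [fo_intros]: "ft T \<Longrightarrow> ft U \<Longrightarrow> fo (\<lambda>e. T e = U e)"
  by (rule fo_pred2[where P = "(=)", OF fo_var_eq])

lemma fo_elts [fo_intros]: "ft T \<Longrightarrow> ft U \<Longrightarrow> fo (\<lambda>e. T e \<in> elts (U e))"
  by (simp add: elts_def fo_mem)

lemma fo_Collect [fo_intros]: "fo (\<lambda>e. P (T e) e) \<Longrightarrow> fo (\<lambda>e. T e \<in> {x. P x e})"
  by simp

lemma fo_in_empty [fo_intros]: "fo (\<lambda>e. T e \<in> {})"
  by (simp add: fo_const)

lemma fo_in_insert [fo_intros]:
  "fo (\<lambda>e. (T e :: 'v) = a e) \<Longrightarrow> fo (\<lambda>e. T e \<in> A e) \<Longrightarrow> fo (\<lambda>e. T e \<in> insert (a e) (A e))"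
  by (simp add: fo_disj)

lemma fo_in_Int [fo_intros]:
  "fo (\<lambda>e. T e \<in> A e) \<Longrightarrow> fo (\<lambda>e. T e \<in> B e) \<Longrightarrow> fo (\<lambda>e. T e \<in> A e \<inter> B e)"
  by (simp add: fo_conj)

lemma fo_in_Diff [fo_intros]:
  "fo (\<lambda>e. T e \<in> A e) \<Longrightarrow> fo (\<lambda>e. T e \<in> B e) \<Longrightarrow> fo (\<lambda>e. T e \<in> A e - B e)"
  by (simp add: fo_conj fo_not)

lemma fo_in_image [fo_intros]:
  "fo (\<lambda>e. \<exists>x. x \<in> A e \<and> T e = G e x) \<Longrightarrow> fo (\<lambda>e. (T e :: 'v) \<in> G e ` A e)"
  by (simp add: image_iff Bex_def)

lemma fo_Ball [fo_intros]:
  "fo (\<lambda>e. \<forall>x. x \<in> A e \<longrightarrow> P x e) \<Longrightarrow> fo (\<lambda>e. \<forall>x\<in>A e. P x e)"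
  by (simp add: Ball_def)

lemma fo_Bex [fo_intros]:
  "fo (\<lambda>e. \<exists>x. x \<in> A e \<and> P x e) \<Longrightarrow> fo (\<lambda>e. \<exists>x\<in>A e. P x e)"
  by (simp add: Bex_def)

lemma fo_subset [fo_intros]:
  "fo (\<lambda>e. \<forall>x. x \<in> A e \<longrightarrow> x \<in> B e) \<Longrightarrow> fo (\<lambda>e. (A e :: 'v set) \<subseteq> B e)"
  by (simp add: subset_iff)

lemma fo_set_eq [fo_intros]:
  "fo (\<lambda>e. \<forall>x. x \<in> A e \<longleftrightarrow> x \<in> B e) \<Longrightarrow> fo (\<lambda>e. (A e :: 'v set) = B e)"
  by (simp add: set_eq_iff)

lemma fo_Ex1 [fo_intros]:
  "fo (\<lambda>e. \<exists>x. P x e \<and> (\<forall>y. P y e \<longrightarrow> y = x)) \<Longrightarrow> fo (\<lambda>e. \<exists>!x. P x e)"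
  by (simp add: Ex1_def)

lemma fo_if [fo_intros]:
  "fo P \<Longrightarrow> fo Q \<Longrightarrow> fo R \<Longrightarrow> fo (\<lambda>e. if P e then Q e else R e)"
  using fo_conj[OF fo_imp[of P Q] fo_imp[of "\<lambda>e. \<not> P e" R, OF fo_not[of P]]]
  by (simp add: if_bool_eq_conj)

lemma ft_if [fo_intros]:
  assumes "fo P" "ft T" "ft U" shows "ft (\<lambda>e. if P e then T e else U e)"
proof -
  have "fo (\<lambda>e. if P (\<lambda>n. e (Suc n)) then e 0 = T (\<lambda>n. e (Suc n)) else e 0 = U (\<lambda>n. e (Suc n)))"
    using assms(2,3) unfolding ft_def by (rule fo_if[OF fo_rename[OF assms(1), of Suc]])
  also have "(\<lambda>e. if P (\<lambda>n. e (Suc n)) then e 0 = T (\<lambda>n. e (Suc n)) else e 0 = U (\<lambda>n. e (Suc n))) =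
      (\<lambda>e. e 0 = (if P (\<lambda>n. e (Suc n)) then T (\<lambda>n. e (Suc n)) else U (\<lambda>n. e (Suc n))))"
    by (rule ext) simp
  finally show ?thesis unfolding ft_def .
qed

lemma ft_The [fo_intros]:
  assumes "\<And>e x y. P x e \<Longrightarrow> P y e \<Longrightarrow> x = y" "fo (\<lambda>e. P (e 0) (\<lambda>n. e (Suc n)))"
  shows "ft (\<lambda>e. THE x. P x e)"
proof -
  have *: "y = (THE x. P x e) \<longleftrightarrow> P y e \<or> (\<not> (\<exists>x. P x e) \<and> y = (THE x. False))" for y e
  proof (cases "\<exists>x. P x e")
    case True
    then obtain x where "P x e" ..
    moreover from this have "(THE x. P x e) = x"
      using assms(1) by (intro the_equality) blast+
    ultimately show ?thesis using assms(1) by blast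
  next
    case False
    then have "(\<lambda>x. P x e) = (\<lambda>x. False)" "\<not> P y e" by blast+
    then show ?thesis by simp
  qed
  have "fo (\<lambda>e. \<exists>x. P x (\<lambda>n. e (Suc n)))"
    by (rule fo_rename[where r = Suc, OF fo_ex[where Q = P, OF assms(2)]])
  then show ?thesis
    unfolding ft_def * using assms(2) by (intro fo_disj fo_conj fo_not fo_var_eq_const)
qed

end

section \<open>Elementary set theory in the model\<close>

context ZF_model
begin

text \<open>The obligation that \<open>vset\<close> leaves open. That \<open>vset S\<close> is a
  definable term and that it has extension \<open>S\<close> are separate questions, and only the
  second needs this predicate.\<close>

definition is_set :: "'v set \<Rightarrow> bool" where
  "is_set S \<longleftrightarrow> (\<exists>a. elts a = S)"

lemma elts_inject: "elts a = elts b \<longleftrightarrow> a = b"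
  using extensionality unfolding elts_def by (auto simp: set_eq_iff)

lemma vset_elts [simp]: "vset (elts a) = a"
  unfolding vset_def by (simp add: elts_inject)

lemma elts_vset: "is_set S \<Longrightarrow> elts (vset S) = S"
  unfolding is_set_def by auto

lemma is_set_elts [simp]: "is_set (elts a)"
  unfolding is_set_def by blast

text \<open>By extensionality \<open>vset\<close> is a description with at most one witness. Hence
  definable membership suffices, even for environments in which the class is proper.\<close>

lemma ft_vset [fo_intros]:
  assumes "fo (\<lambda>e. e 0 \<in> S (\<lambda>n. e (Suc n)))" shows "ft (\<lambda>e. vset (S e))"
  unfolding vset_def
proof (rule ft_The)
  have "fo (\<lambda>e. e 0 \<in> S (\<lambda>n. e (Suc (Suc n))))"
    using fo_rename[OF assms, of "case_nat 0 (\<lambda>n. Suc (Suc n))"] by simp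
  then show "fo (\<lambda>e. elts (e 0) = S (\<lambda>n. e (Suc n)))"
    by (intro fo_set_eq fo_all fo_iff fo_elts ft_var)
qed (simp add: elts_inject[symmetric])

text \<open>The parameters are stored from index 2 on, since Separation uses index 0 and Replacement
  uses indices 0 and 1 for their own variables.\<close>

lemma environment_with_parameters:
  fixes C :: "'v set"
  assumes "finite C"
  obtains q e where "\<And>c. c \<in> C \<Longrightarrow> q c \<ge> (2::nat)" "\<And>c. c \<in> C \<Longrightarrow> e (q c) = c"
proof -
  obtain f :: "'v \<Rightarrow> nat" where f: "inj_on f C"
    using finite_imp_inj_to_nat_seg[OF assms] by blast
  show thesis
    by (rule that[of "\<lambda>c. Suc (Suc (f c))" "\<lambda>n. inv_into C f (n - 2)"]) (use f in simp_all)
qed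

lemma is_set_separation:
  assumes "fo (\<lambda>e. P (e 0))" shows "is_set {x \<in> elts a. P x}"
proof -
  obtain F C where *: "fo_on F C (\<lambda>e. P (e 0))"
    using assms unfolding fo_def by blast
  obtain q e where q: "\<And>c. c \<in> C \<Longrightarrow> q c \<ge> (2::nat)" "\<And>c. c \<in> C \<Longrightarrow> e (q c) = c"
    using environment_with_parameters[OF fo_on_finite(2)[OF *]] by blast
  obtain \<psi> where \<psi>: "\<forall>e. (\<forall>c\<in>C. e (q c) = c) \<longrightarrow> set_sat E \<psi> e = P (e 0)"
    by (rule fo_on_formula[OF *, where q = q and r = "\<lambda>n. n"])
  have "set_sat E \<psi> (e(0 := x)) = P x" for x
    using \<psi>[rule_format, of "e(0 := x)"] q by force
  moreover obtain b where "\<forall>x. E x b \<longleftrightarrow> E x a \<and> set_sat E \<psi> (e(0 := x))"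
    using separation by blast
  ultimately have "elts b = {x \<in> elts a. P x}"
    by (auto simp: elts_def)
  then show ?thesis unfolding is_set_def by blast
qed

lemma is_set_subset:
  assumes "fo (\<lambda>e. e 0 \<in> S)" "S \<subseteq> elts a" shows "is_set S"
proof -
  have "{x \<in> elts a. x \<in> S} = S" using assms(2) by blast
  then show ?thesis using is_set_separation[of "\<lambda>x. x \<in> S" a] assms(1) by simp
qed

lemma is_set_replacement:
  assumes "fo (\<lambda>e. R (e 0) (e 1))"
    and fn: "\<And>x y z. x \<in> elts a \<Longrightarrow> R x y \<Longrightarrow> R x z \<Longrightarrow> y = z"
  shows "is_set {y. \<exists>x\<in>elts a. R x y}"
proof -
  obtain F C where *: "fo_on F C (\<lambda>e. R (e 0) (e 1))"
    using assms unfolding fo_def by blast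
  obtain q e where q: "\<And>c. c \<in> C \<Longrightarrow> q c \<ge> (2::nat)" "\<And>c. c \<in> C \<Longrightarrow> e (q c) = c"
    using environment_with_parameters[OF fo_on_finite(2)[OF *]] by blast
  obtain \<psi> where \<psi>: "\<forall>e. (\<forall>c\<in>C. e (q c) = c) \<longrightarrow> set_sat E \<psi> e = R (e 0) (e 1)"
    by (rule fo_on_formula[OF *, where q = q and r = "\<lambda>n. n"])
  have sat: "set_sat E \<psi> (e(0 := x, 1 := y)) = R x y" for x y
    using \<psi>[rule_format, of "e(0 := x, 1 := y)"] q by force
  have "\<exists>b. \<forall>y. E y b \<longleftrightarrow> (\<exists>x. E x a \<and> set_sat E \<psi> (e(0 := x, 1 := y)))"
    using replacement[rule_format, of a \<psi> e] fn unfolding sat elts_def by blast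
  then obtain b where "\<forall>y. E y b \<longleftrightarrow> (\<exists>x. E x a \<and> R x y)"
    unfolding sat by blast
  then have "elts b = {y. \<exists>x\<in>elts a. R x y}"
    by (auto simp: elts_def)
  then show ?thesis unfolding is_set_def by blast
qed

lemma is_set_image:
  assumes "ft (\<lambda>e. G (e 0))" shows "is_set (G ` elts a)"
proof -
  have "fo (\<lambda>e. e 1 = G (e 0))"
    using assms by (intro fo_eq ft_var)
  then have "is_set {y. \<exists>x\<in>elts a. y = G x}"
    by (rule is_set_replacement) simp
  then show ?thesis by (simp add: image_def)
qed

lemma is_set_empty [simp]: "is_set {}"
proof -
  have "is_set {x \<in> elts undefined. False}"
    by (rule is_set_separation) (rule fo_const)
  then show ?thesis by simp
qed

lemma elts_empty [simp]: "elts (vset {}) = {}"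
  by (simp add: elts_vset)

lemma elts_eq_empty: "elts a = {} \<longleftrightarrow> a = vset {}"
  by (metis elts_empty vset_elts)

lemma is_set_doubleton [simp]: "is_set {x, y}"
proof -
  obtain p where "\<forall>z. E z p \<longleftrightarrow> z = x \<or> z = y" using pairing by blast
  then have "elts p = {x, y}" unfolding elts_def by auto
  then show ?thesis unfolding is_set_def by blast
qed

lemma is_set_singleton [simp]: "is_set {x}"
  using is_set_doubleton[of x x] by simp

lemma is_set_Union: "is_set (\<Union>y\<in>elts x. elts y)"
proof -
  obtain u where "\<forall>z. E z u \<longleftrightarrow> (\<exists>y. E y x \<and> E z y)" using union by blast
  then have "elts u = (\<Union>y\<in>elts x. elts y)" unfolding elts_def by auto
  then show ?thesis unfolding is_set_def by blast
qed

lemma is_set_Un: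
  assumes "is_set A" "is_set B" shows "is_set (A \<union> B)"
proof -
  have "is_set (\<Union>y\<in>elts (vset {vset A, vset B}). elts y)" by (rule is_set_Union)
  then show ?thesis by (simp add: elts_vset assms)
qed

lemma is_set_insert: "is_set A \<Longrightarrow> is_set (insert x A)"
  using is_set_Un[of "{x}" A] by simp

lemma is_set_insert_elts [simp]: "is_set (insert x (elts a))"
  by (simp add: is_set_insert)

lemma is_set_Un_elts [simp]: "is_set (elts a \<union> elts b)"
  by (simp add: is_set_Un)

lemma is_set_Int_elts [simp]: "is_set (elts a \<inter> elts b)"
  by (rule is_set_subset[of _ a]) (intro fo_intros, simp)

lemma is_set_Diff_elts [simp]: "is_set (elts a - elts b)"
  by (rule is_set_subset[of _ a]) (intro fo_intros, auto)

lemma is_set_Pow: "is_set {y. elts y \<subseteq> elts x}"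
proof -
  obtain p where "\<forall>y. E y p \<longleftrightarrow> (\<forall>z. E z y \<longrightarrow> E z x)" using power_set by blast
  then have "elts p = {y. elts y \<subseteq> elts x}" unfolding elts_def by auto
  then show ?thesis unfolding is_set_def by blast
qed

lemma is_set_UN:
  assumes "ft (\<lambda>e. G (e 0))" shows "is_set (\<Union>x\<in>elts a. elts (G x))"
proof -
  have "is_set (\<Union>y\<in>elts (vset (G ` elts a)). elts y)" by (rule is_set_Union)
  then show ?thesis by (simp add: elts_vset is_set_image assms)
qed

text \<open>Foundation applied to the singleton of \<open>a\<close>. Later it provides an element
  outside a given set, namely the set itself, and keeps successors distinct from their
  arguments.\<close>

lemma not_in_self: "a \<notin> elts a"
proof
  assume "a \<in> elts a"
  have "elts (vset {a}) = {a}" by (simp add: elts_vset)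
  then have "E z (vset {a}) \<longleftrightarrow> z = a" for z by (auto simp: elts_def)
  then have "\<not> (\<exists>z. E z a \<and> z = a)"
    using foundation[rule_format, of "vset {a}"] by auto
  with \<open>a \<in> elts a\<close> show False by (auto simp: elts_def)
qed

section \<open>Ordered pairs and Cartesian products\<close>

lemma ft_vpair_var: "ft (\<lambda>e. vpair (e 0) (e 1))"
  unfolding vpair_def by (intro fo_intros)
lemmas ft_vpair [fo_intros] = ft_fun2[where G = vpair, OF ft_vpair_var]

lemma vpair_inject [simp]: "vpair x y = vpair x' y' \<longleftrightarrow> x = x' \<and> y = y'"
proof
  assume eq: "vpair x y = vpair x' y'"
  have el: "elts (vpair u v) = {vset {u}, vset {u, v}}" for u v
    by (simp add: vpair_def elts_vset)
  have inj: "vset A = vset B \<longleftrightarrow> A = B" if "is_set A" "is_set B" for A B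
    using elts_vset that by metis
  have "{vset {x}, vset {x, y}} = {vset {x'}, vset {x', y'}}"
    using eq el by metis
  then show "x = x' \<and> y = y'"
    by (auto simp: doubleton_eq_iff inj)
qed simp

lemma vfst_vpair [simp]: "vfst (vpair x y) = x"
  unfolding vfst_def by simp

lemma vsnd_vpair [simp]: "vsnd (vpair x y) = y"
  unfolding vsnd_def by simp

lemma ft_vfst_var: "ft (\<lambda>e. vfst (e 0))"
  unfolding vfst_def by (rule ft_The) (clarsimp, intro fo_intros)
lemmas ft_vfst [fo_intros] = ft_fun1[where G = vfst, OF ft_vfst_var]

lemma ft_vsnd_var: "ft (\<lambda>e. vsnd (e 0))"
  unfolding vsnd_def by (rule ft_The) (clarsimp, intro fo_intros)
lemmas ft_vsnd [fo_intros] = ft_fun1[where G = vsnd, OF ft_vsnd_var]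

definition vtimes :: "'v \<Rightarrow> 'v \<Rightarrow> 'v" where
  "vtimes a b = vset {p. \<exists>x\<in>elts a. \<exists>y\<in>elts b. p = vpair x y}"

lemma elts_vtimes: "elts (vtimes a b) = {p. \<exists>x\<in>elts a. \<exists>y\<in>elts b. p = vpair x y}"
proof -
  have eq: "{p. \<exists>x\<in>elts a. \<exists>y\<in>elts b. p = vpair x y} =
      (\<Union>x\<in>elts a. elts (vset (vpair x ` elts b)))"
    by (auto simp: elts_vset is_set_image[of "vpair _"] ft_vpair ft_const ft_var)
  have "is_set (\<Union>x\<in>elts a. elts (vset (vpair x ` elts b)))"
    by (rule is_set_UN) (intro fo_intros)
  then show ?thesis unfolding vtimes_def eq by (rule elts_vset)
qed

lemma vpair_in_vtimes [simp]: "vpair x y \<in> elts (vtimes a b) \<longleftrightarrow> x \<in> elts a \<and> y \<in> elts b"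
  by (auto simp: elts_vtimes)

lemma ft_vtimes_var: "ft (\<lambda>e. vtimes (e 0) (e 1))"
  unfolding vtimes_def by (intro fo_intros)
lemmas ft_vtimes [fo_intros] = ft_fun2[where G = vtimes, OF ft_vtimes_var]

subsection \<open>Functions\<close>

lemma fo_function_on_var: "fo (\<lambda>e. function_on (e 0) (e 1))"
  unfolding function_on_def by (intro fo_intros)
lemmas fo_function_on [fo_intros] = fo_pred2[where P = function_on, OF fo_function_on_var]

text \<open>The conditional and its default value are moved into a single description, to which
  \<open>ft_The\<close> applies.\<close>

lemma app_alt: "app f x = (THE z. (\<exists>!y. vpair x y \<in> elts f) \<and> vpair x z \<in> elts f \<or>
    \<not> (\<exists>!y. vpair x y \<in> elts f) \<and> z = vset {})"
  unfolding app_def by auto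

lemma ft_app_var: "ft (\<lambda>e. app (e 0) (e 1))"
  unfolding app_alt by (rule ft_The) (blast, intro fo_intros)
lemmas ft_app [fo_intros] = ft_fun2[where G = app, OF ft_app_var]

lemma app_eqI:
  assumes "function_on a f" "x \<in> elts a" "vpair x y \<in> elts f" shows "app f x = y"
proof -
  have "\<exists>!y. vpair x y \<in> elts f"
    using assms(1,2) unfolding function_on_def by blast
  with assms(3) show ?thesis unfolding app_def by (simp add: the1_equality)
qed

lemma vpair_app:
  assumes "function_on a f" "x \<in> elts a" shows "vpair x (app f x) \<in> elts f"
proof -
  obtain y where y: "vpair x y \<in> elts f"
    using assms unfolding function_on_def by blast
  then show ?thesis using app_eqI[OF assms y] by simp
qed

lemma function_on_elts:
  assumes f: "function_on a f" shows "elts f = {p. \<exists>x\<in>elts a. p = vpair x (app f x)}"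
proof (intro set_eqI iffI)
  fix p assume p: "p \<in> elts f"
  then obtain x y where "x \<in> elts a" "p = vpair x y"
    using f unfolding function_on_def by blast
  then show "p \<in> {p. \<exists>x\<in>elts a. p = vpair x (app f x)}"
    using app_eqI[OF f, of x y] p by blast
next
  fix p assume "p \<in> {p. \<exists>x\<in>elts a. p = vpair x (app f x)}"
  then show "p \<in> elts f" using vpair_app[OF f] by blast
qed

text \<open>Because of the common default value, two functions also agree outside their domains. The
  locality condition of \<open>recursion\<close> speaks of arbitrary predecessors and relies on
  this.\<close>

lemma app_undefined:
  assumes "function_on a f" "x \<notin> elts a" shows "app f x = vset {}"
proof -
  have "vpair x y \<notin> elts f" for y
    using assms by (simp add: function_on_elts)
  then show ?thesis by (simp add: app_def Ex1_def)
qed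

lemma function_eqI:
  assumes "function_on a f" "function_on a g" "\<And>x. x \<in> elts a \<Longrightarrow> app f x = app g x"
  shows "f = g"
proof -
  have "elts f = elts g"
    using assms by (simp add: function_on_elts)
  then show ?thesis by (simp add: elts_inject)
qed

lemma is_set_vdom: "is_set {x. \<exists>y. vpair x y \<in> elts f}"
proof (rule is_set_subset)
  show "fo (\<lambda>e. e 0 \<in> {x. \<exists>y. vpair x y \<in> elts f})" by (intro fo_intros)
  show "{x. \<exists>y. vpair x y \<in> elts f} \<subseteq> elts (vset (vfst ` elts f))"
    by (force simp: elts_vset is_set_image ft_vfst ft_var)
qed

lemma elts_vdom: "elts (vdom f) = {x. \<exists>y. vpair x y \<in> elts f}"
  unfolding vdom_def by (rule elts_vset[OF is_set_vdom])

lemma vdom_function_on [simp]: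
  assumes "function_on a f" shows "vdom f = a"
proof -
  have "elts (vdom f) = elts a"
    using function_on_elts[OF assms] unfolding elts_vdom by auto
  then show ?thesis by (simp add: elts_inject)
qed

lemma function_on_empty [simp]: "function_on (vset {}) (vset {})"
  by (simp add: function_on_def)

lemma function_on_empty_iff: "function_on (vset {}) f \<longleftrightarrow> f = vset {}"
  using function_eqI[of "vset {}" f "vset {}"] by auto

lemma vlam:
  assumes "ft (\<lambda>e. b (e 0))"
  shows function_on_vlam: "function_on a (vlam a b)"
    and app_vlam: "x \<in> elts a \<Longrightarrow> app (vlam a b) x = b x"
proof -
  have "ft (\<lambda>e. vpair (e 0) (b (e 0)))"
    using assms by (intro fo_intros)
  then have *: "elts (vlam a b) = (\<lambda>x. vpair x (b x)) ` elts a"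
    unfolding vlam_def by (rule elts_vset[OF is_set_image])
  show 1: "function_on a (vlam a b)"
    unfolding function_on_def * by auto
  show "app (vlam a b) x = b x" if "x \<in> elts a"
    by (rule app_eqI[OF 1 that]) (use that * in simp)
qed

text \<open>The substitute for a choice of values: where the value is unique, Replacement alone
  yields the function.\<close>

lemma function_by_description:
  assumes "fo (\<lambda>e. R (e 0) (e 1))" "\<And>x. x \<in> elts a \<Longrightarrow> \<exists>!y. R x y"
  obtains f where "function_on a f" "\<And>x. x \<in> elts a \<Longrightarrow> R x (app f x)"
proof -
  have R: "fo (\<lambda>e. R (e i) (e j))" for i j
    using fo_pred2[where P = R, OF assms(1) ft_var ft_var] .
  \<comment> \<open>Unique existence is repeated inside the description, so that it is functional
    for every argument and not only on \<open>a\<close>, as \<open>ft_The\<close> demands.\<close>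
  define b where "b = (\<lambda>x. THE z. (\<exists>!y. R x y) \<and> R x z)"
  have "ft (\<lambda>e. b (e 0))"
    unfolding b_def
  proof (rule ft_The, blast)
    show "fo (\<lambda>e. (\<exists>!y. R (e (Suc 0)) y) \<and> R (e (Suc 0)) (e 0))"
      by (intro fo_intros R)
  qed
  note v = vlam[OF this]
  have "R x (b x)" if "x \<in> elts a" for x
    unfolding b_def using theI'[OF assms(2)[OF that]] assms(2)[OF that] by simp
  then show thesis by (intro that[of "vlam a b"]) (simp_all add: v)
qed

lemma elts_funs:
  "elts (funs a b) = {f. function_on a f \<and> (\<forall>x\<in>elts a. app f x \<in> elts b)}"
  unfolding funs_def
proof (rule elts_vset, rule is_set_subset)
  show "fo (\<lambda>e. e 0 \<in> {f. function_on a f \<and> (\<forall>x\<in>elts a. app f x \<in> elts b)})"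
    by (intro fo_intros)
  show "{f. function_on a f \<and> (\<forall>x\<in>elts a. app f x \<in> elts b)}
      \<subseteq> elts (vset {y. elts y \<subseteq> elts (vtimes a b)})"
    by (auto simp: elts_vset is_set_Pow function_on_elts)
qed

lemma in_funs: "f \<in> elts (funs a b) \<longleftrightarrow> function_on a f \<and> (\<forall>x\<in>elts a. app f x \<in> elts b)"
  by (simp add: elts_funs)

lemma funs_app: "f \<in> elts (funs a b) \<Longrightarrow> x \<in> elts a \<Longrightarrow> app f x \<in> elts b"
  by (simp add: in_funs)

lemma funs_vdom: "f \<in> elts (funs a b) \<Longrightarrow> vdom f = a"
  by (simp add: in_funs)

lemma funs_mono: "f \<in> elts (funs a b) \<Longrightarrow> elts b \<subseteq> elts c \<Longrightarrow> f \<in> elts (funs a c)"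
  by (auto simp: in_funs)

lemma funs_empty: "elts (funs (vset {}) b) = {vset {}}"
  by (auto simp: in_funs function_on_empty_iff)

lemma ft_vdom_var: "ft (\<lambda>e. vdom (e 0))"
  unfolding vdom_def by (intro fo_intros)
lemmas ft_vdom [fo_intros] = ft_fun1[where G = vdom, OF ft_vdom_var]

lemma ft_funs_var: "ft (\<lambda>e. funs (e 0) (e 1))"
  unfolding funs_def by (intro fo_intros)
lemmas ft_funs [fo_intros] = ft_fun2[where G = funs, OF ft_funs_var]

lemma ft_vcomp_var: "ft (\<lambda>e. vcomp (e 0) (e 1))"
  unfolding vcomp_def vlam_def by (intro fo_intros)
lemmas ft_vcomp [fo_intros] = ft_fun2[where G = vcomp, OF ft_vcomp_var]

lemma ft_vupd_var: "ft (\<lambda>e. vupd (e 0) (e 1) (e 2))"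
  unfolding vupd_def vlam_def by (intro fo_intros)
lemmas ft_vupd [fo_intros] = ft_fun3[where G = vupd, OF ft_vupd_var]

lemma function_on_vcomp: "function_on (vdom f) (vcomp g f)"
  unfolding vcomp_def by (rule function_on_vlam) (intro fo_intros)

lemma app_vcomp: "x \<in> elts (vdom f) \<Longrightarrow> app (vcomp g f) x = app g (app f x)"
  unfolding vcomp_def by (rule app_vlam) (intro fo_intros)

lemma vcomp_in_funs:
  "f \<in> elts (funs a b) \<Longrightarrow> (\<And>x. x \<in> elts b \<Longrightarrow> app g x \<in> elts c) \<Longrightarrow> vcomp g f \<in> elts (funs a c)"
  using function_on_vcomp[of f g] app_vcomp[of _ f g] by (auto simp: in_funs)

lemma vdom_vcomp [simp]: "vdom (vcomp g f) = vdom f"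
  using function_on_vcomp by (rule vdom_function_on)

lemma vupd:
  shows function_on_vupd: "function_on (vset (insert k (elts (vdom f)))) (vupd f k a)"
    and app_vupd: "x = k \<or> x \<in> elts (vdom f) \<Longrightarrow> app (vupd f k a) x = (if x = k then a else app f x)"
proof -
  have *: "ft (\<lambda>e. if e 0 = k then a else app f (e 0))" by (intro fo_intros)
  show "function_on (vset (insert k (elts (vdom f)))) (vupd f k a)"
    unfolding vupd_def by (rule function_on_vlam[OF *])
  show "app (vupd f k a) x = (if x = k then a else app f x)" if "x = k \<or> x \<in> elts (vdom f)"
    unfolding vupd_def by (rule app_vlam[OF *]) (use that in \<open>auto simp: elts_vset\<close>)
qed

lemma vdom_vupd [simp]: "vdom (vupd f k a) = vset (insert k (elts (vdom f)))"
  using function_on_vupd by (rule vdom_function_on)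

lemma vupd_in_funs:
  "f \<in> elts (funs X b) \<Longrightarrow> a \<in> elts b \<Longrightarrow> vupd f k a \<in> elts (funs (vset (insert k (elts X))) b)"
  using function_on_vupd[of k f a] app_vupd[of _ k f a] by (auto simp: in_funs elts_vset)

lemma vcomp_vupd:
  assumes "function_on X f" shows "vcomp g (vupd f k a) = vupd (vcomp g f) k (app g a)"
proof (rule function_eqI)
  let ?X = "vset (insert k (elts X))"
  show "function_on ?X (vcomp g (vupd f k a))" "function_on ?X (vupd (vcomp g f) k (app g a))"
    using function_on_vcomp[of "vupd f k a" g] function_on_vupd[of k "vcomp g f"] assms by simp_all
  show "app (vcomp g (vupd f k a)) x = app (vupd (vcomp g f) k (app g a)) x" if "x \<in> elts ?X" for x
    using that assms by (auto simp: app_vcomp app_vupd elts_vset)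
qed

section \<open>Natural numbers and recursion in the model\<close>

lemma elts_vsucc [simp]: "elts (vsucc x) = insert x (elts x)"
  unfolding vsucc_def by (simp add: elts_vset)

lemma ft_vsucc_var: "ft (\<lambda>e. vsucc (e 0))"
  unfolding vsucc_def by (intro fo_intros)
lemmas ft_vsucc [fo_intros] = ft_fun1[where G = vsucc, OF ft_vsucc_var]

lemma elts_omega: "elts omega =
    {n. \<forall>X. vset {} \<in> elts X \<and> (\<forall>x\<in>elts X. vsucc x \<in> elts X) \<longrightarrow> n \<in> elts X}"
proof -
  obtain x where "\<exists>y. E y x \<and> (\<forall>z. \<not> E z y)"
    and s: "\<forall>y. E y x \<longrightarrow> (\<exists>s. E s x \<and> (\<forall>z. E z s \<longleftrightarrow> E z y \<or> z = y))"
    using infinity by blast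
  then obtain y where "y \<in> elts x" "elts y = {}"
    unfolding elts_def by auto
  then have x0: "vset {} \<in> elts x" by (simp add: elts_eq_empty)
  have xs: "vsucc y \<in> elts x" if y: "y \<in> elts x" for y
  proof -
    obtain s where s: "E s x" "\<forall>z. E z s \<longleftrightarrow> E z y \<or> z = y"
      using s y unfolding elts_def by blast
    then have "s \<in> elts x" "elts s = insert y (elts y)"
      unfolding elts_def by auto
    then have "s = vsucc y" by (simp add: elts_inject[symmetric])
    then show ?thesis using \<open>s \<in> elts x\<close> by simp
  qed
  show ?thesis
    unfolding omega_def
  proof (rule elts_vset, rule is_set_subset)
    show "fo (\<lambda>e. e 0 \<in> {n. \<forall>X. vset {} \<in> elts X \<and> (\<forall>x\<in>elts X. vsucc x \<in> elts X) \<longrightarrow> n \<in> elts X})"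
      by (intro fo_intros)
    show "{n. \<forall>X. vset {} \<in> elts X \<and> (\<forall>x\<in>elts X. vsucc x \<in> elts X) \<longrightarrow> n \<in> elts X} \<subseteq> elts x"
      using x0 xs by blast
  qed
qed

lemma zero_omega [simp]: "vset {} \<in> elts omega"
  by (simp add: elts_omega)

lemma vsucc_omega [simp]: "n \<in> elts omega \<Longrightarrow> vsucc n \<in> elts omega"
  by (simp add: elts_omega)

text \<open>Only definable predicates are covered, because the set of all \<open>n\<close> in
  \<open>omega\<close> with \<open>P n\<close> must belong to the model. HOL induction would reach
  the standard numbers alone.\<close>

lemma omega_induct:
  assumes n: "n \<in> elts omega" and P: "fo (\<lambda>e. P (e 0))"
    and "P (vset {})" "\<And>n. n \<in> elts omega \<Longrightarrow> P n \<Longrightarrow> P (vsucc n)"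
  shows "P n"
proof -
  have el: "elts (vset {n \<in> elts omega. P n}) = {n \<in> elts omega. P n}"
    by (rule elts_vset[OF is_set_separation[OF P]])
  have "vset {} \<in> elts (vset {n \<in> elts omega. P n})"
    "\<forall>n\<in>elts (vset {n \<in> elts omega. P n}). vsucc n \<in> elts (vset {n \<in> elts omega. P n})"
    unfolding el using assms(3,4) by simp_all
  then have "n \<in> elts (vset {n \<in> elts omega. P n})"
    using n[unfolded elts_omega] by blast
  then show ?thesis unfolding el by simp
qed

lemma omega_subset:
  assumes "n \<in> elts omega" shows "elts n \<subseteq> elts omega"
  by (rule omega_induct[OF assms]) (intro fo_intros, auto)

lemma omega_elt_subset:
  assumes "n \<in> elts omega" "m \<in> elts n" shows "elts m \<subseteq> elts n"
proof -
  have "\<forall>m\<in>elts n. elts m \<subseteq> elts n"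
    by (rule omega_induct[OF assms(1)]) (intro fo_intros, auto)
  then show ?thesis using assms(2) by blast
qed

lemma zero_in_omega_elt:
  assumes "n \<in> elts omega" shows "vset {} = n \<or> vset {} \<in> elts n"
  by (rule omega_induct[OF assms]) (intro fo_intros, auto)

lemma vsucc_le:
  assumes "n \<in> elts omega" "m \<in> elts n" shows "vsucc m = n \<or> vsucc m \<in> elts n"
proof -
  have "\<forall>m\<in>elts n. vsucc m = n \<or> vsucc m \<in> elts n"
    by (rule omega_induct[OF assms(1)]) (intro fo_intros, auto)
  then show ?thesis using assms(2) by blast
qed

lemma omega_linear:
  assumes "m \<in> elts omega" "n \<in> elts omega" shows "m \<in> elts n \<or> m = n \<or> n \<in> elts m"
proof (rule omega_induct[OF assms(1)])
  show "vset {} \<in> elts n \<or> vset {} = n \<or> n \<in> elts (vset {})"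
    using zero_in_omega_elt[OF assms(2)] by blast
  show "vsucc m \<in> elts n \<or> vsucc m = n \<or> n \<in> elts (vsucc m)"
    if "m \<in> elts n \<or> m = n \<or> n \<in> elts m" for m
    using that vsucc_le[OF assms(2)] by auto
qed (intro fo_intros)

lemma omega_directed:
  assumes "m \<in> elts omega" "n \<in> elts omega"
  obtains k where "k \<in> elts omega" "elts m \<subseteq> elts k" "elts n \<subseteq> elts k"
proof -
  have "elts m \<subseteq> elts n \<or> elts n \<subseteq> elts m"
    using omega_linear[OF assms] omega_elt_subset assms by blast
  then show thesis using that assms by blast
qed

lemma numeral_code_omega [simp]: "numeral_code n \<in> elts omega"
  by (induction n) simp_all

lemma numeral_code_less: "m < n \<Longrightarrow> numeral_code m \<in> elts (numeral_code n)"
proof (induction n)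
  case (Suc n)
  then show ?case by (cases "m = n") simp_all
qed simp

lemma numeral_code_eq [simp]: "numeral_code m = numeral_code n \<longleftrightarrow> m = n"
  using numeral_code_less[of m n] numeral_code_less[of n m] not_in_self by (metis linorder_neqE_nat)

text \<open>A maximum of finitely many numbers, finite in the sense of the model. Monotonicity lets
  a common upper bound replace the old bound and the bound for the new index, so nothing has to be
  chosen.\<close>

lemma omega_bounded:
  assumes P: "fo (\<lambda>e. P (e 0) (e 1))"
    and mono: "\<And>k b c. b \<in> elts omega \<Longrightarrow> c \<in> elts omega \<Longrightarrow> elts b \<subseteq> elts c \<Longrightarrow> P k b \<Longrightarrow> P k c"
    and n: "n \<in> elts omega" "\<And>k. k \<in> elts n \<Longrightarrow> \<exists>b\<in>elts omega. P k b"
  obtains b where "b \<in> elts omega" "\<And>k. k \<in> elts n \<Longrightarrow> P k b"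
proof -
  have P': "fo (\<lambda>e. P (e i) (e j))" for i j
    using fo_pred2[where P = P, OF P ft_var ft_var] .
  have "(\<forall>k\<in>elts n. \<exists>b\<in>elts omega. P k b) \<longrightarrow> (\<exists>b\<in>elts omega. \<forall>k\<in>elts n. P k b)"
  proof (rule omega_induct[OF n(1)])
    fix n assume n: "n \<in> elts omega"
      "(\<forall>k\<in>elts n. \<exists>b\<in>elts omega. P k b) \<longrightarrow> (\<exists>b\<in>elts omega. \<forall>k\<in>elts n. P k b)"
    show "(\<forall>k\<in>elts (vsucc n). \<exists>b\<in>elts omega. P k b) \<longrightarrow> (\<exists>b\<in>elts omega. \<forall>k\<in>elts (vsucc n). P k b)"
    proof
      assume *: "\<forall>k\<in>elts (vsucc n). \<exists>b\<in>elts omega. P k b"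
      then obtain b where b: "b \<in> elts omega" "\<And>k. k \<in> elts n \<Longrightarrow> P k b" using n(2) by auto
      from * obtain c where c: "c \<in> elts omega" "P n c" by auto
      obtain d where d: "d \<in> elts omega" "elts b \<subseteq> elts d" "elts c \<subseteq> elts d"
        using omega_directed[OF b(1) c(1)] by blast
      have "P n d" by (rule mono[OF c(1) d(1,3) c(2)])
      moreover have "P k d" if "k \<in> elts n" for k by (rule mono[OF b(1) d(1,2) b(2)[OF that]])
      ultimately show "\<exists>b\<in>elts omega. \<forall>k\<in>elts (vsucc n). P k b"
        using d(1) by auto
    qed
  next
    show "fo (\<lambda>e. (\<forall>k\<in>elts (e 0). \<exists>b\<in>elts omega. P k b) \<longrightarrow> (\<exists>b\<in>elts omega. \<forall>k\<in>elts (e 0). P k b))"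
      by (intro fo_intros P')
  qed (use zero_omega in \<open>auto simp del: zero_omega\<close>)
  then show thesis using n(2) that by blast
qed

text \<open>Choice over an index set that is finite in the sense of the model is a theorem of ZF:
  the function is extended by one value at each induction step. It serves to pick representatives
  for a tuple of classes.\<close>

lemma finite_choice:
  assumes R: "fo (\<lambda>e. R (e 0) (e 1))" and n: "n \<in> elts omega" "\<And>k. k \<in> elts n \<Longrightarrow> \<exists>y. R k y"
  obtains f where "function_on n f" "\<And>k. k \<in> elts n \<Longrightarrow> R k (app f k)"
proof -
  have R': "ft T \<Longrightarrow> ft U \<Longrightarrow> fo (\<lambda>e. R (T e) (U e))" for T U
    by (rule fo_pred2[where P = R, OF R])
  have "(\<forall>k\<in>elts n. \<exists>y. R k y) \<longrightarrow> (\<exists>f. function_on n f \<and> (\<forall>k\<in>elts n. R k (app f k)))"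
  proof (rule omega_induct[OF n(1)])
    show "fo (\<lambda>e. (\<forall>k\<in>elts (e 0). \<exists>y. R k y) \<longrightarrow>
        (\<exists>f. function_on (e 0) f \<and> (\<forall>k\<in>elts (e 0). R k (app f k))))"
      by (intro fo_intros R')
    fix n assume n: "n \<in> elts omega"
      "(\<forall>k\<in>elts n. \<exists>y. R k y) \<longrightarrow> (\<exists>f. function_on n f \<and> (\<forall>k\<in>elts n. R k (app f k)))"
    show "(\<forall>k\<in>elts (vsucc n). \<exists>y. R k y) \<longrightarrow>
        (\<exists>f. function_on (vsucc n) f \<and> (\<forall>k\<in>elts (vsucc n). R k (app f k)))"
    proof
      assume *: "\<forall>k\<in>elts (vsucc n). \<exists>y. R k y"
      then obtain f where f: "function_on n f" "\<And>k. k \<in> elts n \<Longrightarrow> R k (app f k)" using n(2) by auto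
      from * obtain y where y: "R n y" by auto
      have "function_on (vsucc n) (vupd f n y)"
        using function_on_vupd[of n f y] f(1) by (simp add: vsucc_def)
      moreover have "R k (app (vupd f n y) k)" if "k \<in> elts (vsucc n)" for k
        using that f y by (auto simp: app_vupd)
      ultimately show "\<exists>f. function_on (vsucc n) f \<and> (\<forall>k\<in>elts (vsucc n). R k (app f k))"
        by blast
    qed
  qed (auto intro: exI[of _ "vset {}"])
  then show thesis using n(2) that by blast
qed

text \<open>The function is the union of all partial solutions with \<open>R\<close>-closed domain.\<close>

lemma recursion:
  assumes ind: "\<And>S. elts S \<subseteq> elts D \<Longrightarrow>
      (\<And>x. x \<in> elts D \<Longrightarrow> (\<And>y. y \<in> elts D \<Longrightarrow> R y x \<Longrightarrow> y \<in> elts S) \<Longrightarrow> x \<in> elts S) \<Longrightarrow>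
      elts D \<subseteq> elts S"
    and R: "fo (\<lambda>e. R (e 0) (e 1))" and H: "ft (\<lambda>e. H (e 0) (e 1))"
    and local: "\<And>x f g. x \<in> elts D \<Longrightarrow> (\<And>y. R y x \<Longrightarrow> app f y = app g y) \<Longrightarrow> H x f = H x g"
  obtains F where "function_on D F" "\<And>x. x \<in> elts D \<Longrightarrow> app F x = H x F"
proof -
  have R': "ft T \<Longrightarrow> ft U \<Longrightarrow> fo (\<lambda>e. R (T e) (U e))" for T U
    by (rule fo_pred2[where P = R, OF R])
  have H': "ft T \<Longrightarrow> ft U \<Longrightarrow> ft (\<lambda>e. H (T e) (U e))" for T U
    by (rule ft_fun2[where G = H, OF H])
  define good where "good f \<longleftrightarrow> function_on (vdom f) f \<and> elts (vdom f) \<subseteq> elts D \<and>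
    (\<forall>x\<in>elts (vdom f). (\<forall>y\<in>elts D. R y x \<longrightarrow> y \<in> elts (vdom f)) \<and> app f x = H x f)" for f
  have "fo (\<lambda>e. good (e 0))"
    unfolding good_def by (intro fo_intros R' H')
  then have good': "ft T \<Longrightarrow> fo (\<lambda>e. good (T e))" for T
    by (rule fo_pred1[where P = good])
  have good_fn: "function_on (vdom f) f" and good_dom: "elts (vdom f) \<subseteq> elts D" if "good f" for f
    using that unfolding good_def by blast+
  have good_closed: "y \<in> elts (vdom f)" if "good f" "x \<in> elts (vdom f)" "y \<in> elts D" "R y x" for f x y
    using that unfolding good_def by blast
  have good_app: "app f x = H x f" if "good f" "x \<in> elts (vdom f)" for f x
    using that unfolding good_def by blast
  have agree: "app f x = app g x"
    if f: "good f" and g: "good g" and x: "x \<in> elts (vdom f)" "x \<in> elts (vdom g)" for f g x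
  proof -
    define S where "S = vset {x \<in> elts D. x \<in> elts (vdom f) \<and> x \<in> elts (vdom g) \<longrightarrow> app f x = app g x}"
    have S: "elts S = {x \<in> elts D. x \<in> elts (vdom f) \<and> x \<in> elts (vdom g) \<longrightarrow> app f x = app g x}"
      unfolding S_def by (rule elts_vset[OF is_set_separation]) (intro fo_intros)
    have "elts D \<subseteq> elts S"
    proof (rule ind)
      fix x assume x: "x \<in> elts D" "\<And>y. y \<in> elts D \<Longrightarrow> R y x \<Longrightarrow> y \<in> elts S"
      have "app f x = app g x" if fx: "x \<in> elts (vdom f)" and gx: "x \<in> elts (vdom g)"
      proof -
        have "H x f = H x g"
        proof (rule local[OF x(1)])
          fix y assume y: "R y x"
          show "app f y = app g y"
          proof (cases "y \<in> elts D")
            case True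
            then have "y \<in> elts (vdom f)" "y \<in> elts (vdom g)"
              using good_closed[OF f fx True y] good_closed[OF g gx True y] by simp_all
            then show ?thesis using x(2)[OF True y] unfolding S by blast
          next
            case False
            then have "y \<notin> elts (vdom f)" "y \<notin> elts (vdom g)"
              using good_dom[OF f] good_dom[OF g] by blast+
            then show ?thesis
              using app_undefined[OF good_fn[OF f]] app_undefined[OF good_fn[OF g]] by simp
          qed
        qed
        then show ?thesis using good_app[OF f fx] good_app[OF g gx] by simp
      qed
      then show "x \<in> elts S" using x(1) S by blast
    qed (use S in blast)
    moreover have "x \<in> elts D" using x good_dom[OF f] by blast
    ultimately show ?thesis using x S by blast
  qed
  define G where "G = vset {p. \<exists>y\<in>elts D. \<exists>f. good f \<and> y \<in> elts (vdom f) \<and> p = vpair y (app f y)}"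
  have G: "elts G = {p. \<exists>y\<in>elts D. \<exists>f. good f \<and> y \<in> elts (vdom f) \<and> p = vpair y (app f y)}"
    unfolding G_def
  proof (rule elts_vset, rule is_set_replacement)
    show "fo (\<lambda>e. \<exists>f. good f \<and> e 0 \<in> elts (vdom f) \<and> e 1 = vpair (e 0) (app f (e 0)))"
      by (intro fo_intros good')
    fix x y z
    assume "\<exists>f. good f \<and> x \<in> elts (vdom f) \<and> y = vpair x (app f x)"
      "\<exists>f. good f \<and> x \<in> elts (vdom f) \<and> z = vpair x (app f x)"
    then obtain f g where "good f" "good g" "x \<in> elts (vdom f)" "x \<in> elts (vdom g)"
      and "y = vpair x (app f x)" "z = vpair x (app g x)" by (elim exE conjE)
    then show "y = z" using agree[of f g x] by simp
  qed
  define S where "S = vset {y \<in> elts D. \<exists>f. good f \<and> y \<in> elts (vdom f)}"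
  have S: "elts S = {y \<in> elts D. \<exists>f. good f \<and> y \<in> elts (vdom f)}"
    unfolding S_def by (rule elts_vset[OF is_set_separation]) (intro fo_intros good')
  have GS: "function_on S G"
    unfolding function_on_def
  proof (intro conjI ballI)
    show "\<exists>x\<in>elts S. \<exists>y. p = vpair x y" if "p \<in> elts G" for p
      using that unfolding S G by blast
    fix x assume "x \<in> elts S"
    then obtain f where f: "good f" "x \<in> elts (vdom f)" "x \<in> elts D" unfolding S by blast
    show "\<exists>!y. vpair x y \<in> elts G"
    proof (rule ex1I[of _ "app f x"])
      show "vpair x (app f x) \<in> elts G" unfolding G using f by blast
      show "y = app f x" if "vpair x y \<in> elts G" for y
        using that agree[OF _ f(1) _ f(2)] unfolding G by auto
    qed
  qed
  have Gapp: "app G y = app f y" if "good f" "y \<in> elts (vdom f)" for f y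
  proof (rule app_eqI[OF GS])
    have "y \<in> elts D" using that good_dom by blast
    then show "y \<in> elts S" "vpair y (app f y) \<in> elts G" unfolding S G using that by blast+
  qed
  have SD: "elts S \<subseteq> elts D" using S by blast
  have Gclosed: "y \<in> elts S" if x: "x \<in> elts S" and y: "y \<in> elts D" "R y x" for x y
  proof -
    obtain f where "good f" "x \<in> elts (vdom f)" using x unfolding S by blast
    then have "y \<in> elts (vdom f)" using y good_closed by blast
    then show ?thesis using \<open>good f\<close> y unfolding S by blast
  qed
  have Geq: "app G x = H x G" if x: "x \<in> elts S" for x
  proof -
    obtain f where f: "good f" "x \<in> elts (vdom f)" using x unfolding S by blast
    then have "app G x = H x f" using Gapp good_app by simp
    also have "\<dots> = H x G"
    proof (rule local)
      show "x \<in> elts D" using x SD by blast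
      fix y assume y: "R y x"
      show "app f y = app G y"
      proof (cases "y \<in> elts D")
        case True
        then have "y \<in> elts (vdom f)" using good_closed[OF f True y] by simp
        then show ?thesis using Gapp[OF f(1)] by simp
      next
        case False
        then have "y \<notin> elts (vdom f)" "y \<notin> elts S" using good_dom[OF f(1)] SD by blast+
        then show ?thesis using app_undefined[OF good_fn[OF f(1)]] app_undefined[OF GS] by simp
      qed
    qed
    finally show ?thesis .
  qed
  have "elts D \<subseteq> elts S"
  proof (rule ind[OF SD])
    fix x assume x: "x \<in> elts D" "\<And>y. y \<in> elts D \<Longrightarrow> R y x \<Longrightarrow> y \<in> elts S"
    show "x \<in> elts S"
    proof (rule ccontr)
      assume xS: "x \<notin> elts S"
      \<comment> \<open>If all predecessors of \<open>x\<close> are in the domain but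
        \<open>x\<close> is not, one more value gives a larger partial solution. This contradicts
        the fact that \<open>S\<close> collects the domains of all of them.\<close>
      define G' where "G' = vupd G x (H x G)"
      have dom: "elts (vdom G') = insert x (elts S)" and fn: "function_on (vdom G') G'"
        unfolding G'_def using GS function_on_vupd[of x G "H x G"] by (simp_all add: elts_vset)
      have app': "app G' y = app G y" if "y \<noteq> x" for y
      proof (cases "y \<in> elts S")
        case True
        then show ?thesis using that GS unfolding G'_def by (simp add: app_vupd)
      next
        case False
        then show ?thesis using that dom app_undefined[OF fn] app_undefined[OF GS] by simp
      qed
      have appx: "app G' x = H x G" unfolding G'_def by (simp add: app_vupd)
      \<comment> \<open>Overriding the value at \<open>x\<close> must not affect any value of
        \<open>H\<close> on the new domain. If \<open>x\<close> were a predecessor of one of its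
        points, including \<open>x\<close> itself, the closure properties would already put
        \<open>x\<close> into \<open>S\<close>.\<close>
      have ne: "y \<noteq> x" if z: "z \<in> elts (vdom G')" "R y z" for y z
      proof
        assume yx: "y = x"
        consider "z = x" | "z \<in> elts S" using z(1) dom by blast
        then have "x \<in> elts S"
          by cases (use z(2) x(2)[OF x(1)] Gclosed[OF _ x(1)] yx in simp_all)
        with xS show False ..
      qed
      have "good G'"
        unfolding good_def
      proof (intro conjI ballI impI)
        show "function_on (vdom G') G'" by (rule fn)
        show "elts (vdom G') \<subseteq> elts D" using SD x(1) by (simp add: dom)
        fix z assume z: "z \<in> elts (vdom G')"
        show "y \<in> elts (vdom G')" if "y \<in> elts D" "R y z" for y
          using z that dom x(2)[of y] Gclosed[of z y] by auto
        have "H z G = H z G'"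
          by (rule local) (use z dom SD x(1) app' ne[OF z] in auto)
        moreover have "app G' z = H z G"
          using z dom appx app' Geq by (cases "z = x") auto
        ultimately show "app G' z = H z G'" by simp
      qed
      moreover have "x \<in> elts (vdom G')" by (simp add: dom)
      ultimately have "x \<in> elts S" using x(1) unfolding S by blast
      with xS show False ..
    qed
  qed
  then have "S = D" using SD by (simp add: elts_inject[symmetric])
  then show thesis using that GS Geq by blast
qed

text \<open>Induction along membership, in the form of the first hypothesis of
  \<open>recursion\<close>.\<close>

lemma omega_strong_induct:
  assumes S: "elts S \<subseteq> elts omega"
    "\<And>x. x \<in> elts omega \<Longrightarrow> (\<And>y. y \<in> elts omega \<Longrightarrow> y \<in> elts x \<Longrightarrow> y \<in> elts S) \<Longrightarrow> x \<in> elts S"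
  shows "elts omega \<subseteq> elts S"
proof
  fix n assume n: "n \<in> elts omega"
  have "elts n \<subseteq> elts S"
  proof (rule omega_induct[OF n])
    show "fo (\<lambda>e. elts (e 0) \<subseteq> elts S)" by (intro fo_intros)
    show "elts (vsucc m) \<subseteq> elts S" if "m \<in> elts omega" "elts m \<subseteq> elts S" for m
      using S(2)[OF that(1)] that by auto
  qed simp
  then show "n \<in> elts S" using S(2)[OF n] by blast
qed

text \<open>The closure is \<open>\<Union>\<^sub>n F(n)\<close> with \<open>F(n) = A \<union> \<omega> \<union> \<Union>\<^sub>m\<^sub><\<^sub>n P(F(m))\<close>.\<close>

lemma finitary_closure:
  obtains H where "elts A \<subseteq> elts H" "elts omega \<subseteq> elts H"
    "\<And>x y. x \<in> elts H \<Longrightarrow> y \<in> elts H \<Longrightarrow> vpair x y \<in> elts H"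
    "\<And>n f. n \<in> elts omega \<Longrightarrow> f \<in> elts (funs n H) \<Longrightarrow> f \<in> elts H"
proof -
  define step where "step = (\<lambda>n f. vset {y. y \<in> elts A \<or> y \<in> elts omega \<or>
      (\<exists>m\<in>elts n. elts y \<subseteq> elts (app f m))})"
  obtain F where F: "function_on omega F" "\<And>n. n \<in> elts omega \<Longrightarrow> app F n = step n F"
  proof (rule recursion[of omega "\<lambda>m n. m \<in> elts n" step])
    show "ft (\<lambda>e. step (e 0) (e 1))" unfolding step_def by (intro fo_intros)
    show "step x f = step x g" if "\<And>y. y \<in> elts x \<Longrightarrow> app f y = app g y" for x f g
      unfolding step_def using that by simp
    show "fo (\<lambda>e. e 0 \<in> elts (e 1))" by (intro fo_intros)
  qed (use omega_strong_induct in blast)+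
  have elF: "elts (app F n) = {y. y \<in> elts A \<or> y \<in> elts omega \<or>
      (\<exists>m\<in>elts n. elts y \<subseteq> elts (app F m))}" if "n \<in> elts omega" for n
  proof -
    let ?P = "\<lambda>m. vset {y. elts y \<subseteq> elts (app F m)}"
    have "is_set (elts A \<union> elts omega \<union> (\<Union>m\<in>elts n. elts (?P m)))"
      by (intro is_set_Un is_set_elts is_set_UN fo_intros)
    moreover have "elts A \<union> elts omega \<union> (\<Union>m\<in>elts n. elts (?P m)) =
        {y. y \<in> elts A \<or> y \<in> elts omega \<or> (\<exists>m\<in>elts n. elts y \<subseteq> elts (app F m))}"
      by (auto simp: elts_vset is_set_Pow)
    ultimately show ?thesis unfolding F(2)[OF that] step_def by (simp add: elts_vset)
  qed
  have Fmono: "elts (app F m) \<subseteq> elts (app F n)"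
    if "m \<in> elts omega" "n \<in> elts omega" "elts m \<subseteq> elts n" for m n
    using that elF by auto
  have Fsub: "y \<in> elts (app F (vsucc n))" if "n \<in> elts omega" "elts y \<subseteq> elts (app F n)" for n y
    using that elF by simp
  have Fpair: "vpair x y \<in> elts (app F (vsucc (vsucc n)))"
    if "n \<in> elts omega" "x \<in> elts (app F n)" "y \<in> elts (app F n)" for n x y
    unfolding vpair_def using that by (intro Fsub) (auto simp: elts_vset intro!: Fsub)
  define H where "H = vset (\<Union>n\<in>elts omega. elts (app F n))"
  have H: "elts H = (\<Union>n\<in>elts omega. elts (app F n))"
    unfolding H_def by (rule elts_vset[OF is_set_UN]) (intro fo_intros)
  show thesis
  proof (rule that[of H])
    show "elts A \<subseteq> elts H" "elts omega \<subseteq> elts H"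
      unfolding H using elF[of "vset {}"] zero_omega by blast+
    show "vpair x y \<in> elts H" if xy: "x \<in> elts H" "y \<in> elts H" for x y
    proof -
      obtain m n where mn: "m \<in> elts omega" "x \<in> elts (app F m)" "n \<in> elts omega" "y \<in> elts (app F n)"
        using xy unfolding H by blast
      obtain k where k: "k \<in> elts omega" "elts m \<subseteq> elts k" "elts n \<subseteq> elts k"
        using omega_directed[OF mn(1,3)] by blast
      then have "x \<in> elts (app F k)" "y \<in> elts (app F k)"
        using Fmono mn by blast+
      then have "vpair x y \<in> elts (app F (vsucc (vsucc k)))" by (rule Fpair[OF k(1)])
      then show ?thesis unfolding H by (rule UN_I[rotated]) (simp add: k(1))
    qed
    show "f \<in> elts H" if n: "n \<in> elts omega" and f: "f \<in> elts (funs n H)" for n f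
    proof -
      \<comment> \<open>All entries of the tuple lie in one stage, because its length is finite in
        the sense of the model.\<close>
      obtain b where b: "b \<in> elts omega" "\<And>k. k \<in> elts n \<Longrightarrow> app f k \<in> elts (app F b)"
      proof (rule omega_bounded[where P = "\<lambda>k b. app f k \<in> elts (app F b)" and n = n])
        show "fo (\<lambda>e. app f (e 0) \<in> elts (app F (e 1)))" by (intro fo_intros)
        show "\<exists>b\<in>elts omega. app f k \<in> elts (app F b)" if "k \<in> elts n" for k
          using funs_app[OF f that] unfolding H by blast
      qed (use Fmono n in blast)+
      \<comment> \<open>A Kuratowski pair lies two stages above its components, so \<open>f\<close>
        as a set of pairs lies three stages above \<open>b\<close>. The argument \<open>k\<close> of
        each pair is available because every stage contains \<open>omega\<close>.\<close>
      have "elts f \<subseteq> elts (app F (vsucc (vsucc b)))"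
      proof
        fix p assume "p \<in> elts f"
        then obtain k where k: "k \<in> elts n" "p = vpair k (app f k)"
          using f function_on_elts by (auto simp: in_funs)
        have "k \<in> elts omega" using omega_subset[OF n] k(1) by blast
        then have "k \<in> elts (app F b)" using elF[OF b(1)] by simp
        then show "p \<in> elts (app F (vsucc (vsucc b)))"
          unfolding k(2) using Fpair[OF b(1)] b(2)[OF k(1)] by blast
      qed
      then have "f \<in> elts (app F (vsucc (vsucc (vsucc b))))"
        using b(1) by (intro Fsub) simp_all
      then show ?thesis unfolding H by (rule UN_I[rotated]) (simp add: b(1))
    qed
  qed
qed

section \<open>Terms and formulas\<close>

text \<open>An intersection over all closed sets is a set as soon as one closed set exists. For
  terms and formulas such a bound is cut from \<open>finitary_closure\<close>.\<close>

lemma elts_least_closed: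
  assumes "fo (\<lambda>e. C (e 0))" "C Y"
  shows "elts (least_closed C) = {x. \<forall>Y. C Y \<longrightarrow> x \<in> elts Y}"
  unfolding least_closed_def
proof (rule elts_vset, rule is_set_subset)
  show "fo (\<lambda>e. e 0 \<in> {x. \<forall>Y. C Y \<longrightarrow> x \<in> elts Y})"
    by (intro fo_intros fo_pred1[where P = C, OF assms(1)])
  show "{x. \<forall>Y. C Y \<longrightarrow> x \<in> elts Y} \<subseteq> elts Y" using assms(2) by blast
qed

lemma ft_rel_syms_var: "ft (\<lambda>e. rel_syms (e 0))"
  unfolding rel_syms_def by (intro fo_intros)
lemmas ft_rel_syms [fo_intros] = ft_fun1[where G = rel_syms, OF ft_rel_syms_var]

lemma ft_fun_syms_var: "ft (\<lambda>e. fun_syms (e 0))"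
  unfolding fun_syms_def by (intro fo_intros)
lemmas ft_fun_syms [fo_intros] = ft_fun1[where G = fun_syms, OF ft_fun_syms_var]

lemma ft_rel_arity_var: "ft (\<lambda>e. rel_arity (e 0) (e 1))"
  unfolding rel_arity_def by (intro fo_intros)
lemmas ft_rel_arity [fo_intros] = ft_fun2[where G = rel_arity, OF ft_rel_arity_var]

lemma ft_fun_arity_var: "ft (\<lambda>e. fun_arity (e 0) (e 1))"
  unfolding fun_arity_def by (intro fo_intros)
lemmas ft_fun_arity [fo_intros] = ft_fun2[where G = fun_arity, OF ft_fun_arity_var]

lemma ft_universe_var: "ft (\<lambda>e. universe (e 0))"
  unfolding universe_def by (intro fo_intros)
lemmas ft_universe [fo_intros] = ft_fun1[where G = universe, OF ft_universe_var]

lemma ft_rel_int_var: "ft (\<lambda>e. rel_int (e 0) (e 1))"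
  unfolding rel_int_def by (intro fo_intros)
lemmas ft_rel_int [fo_intros] = ft_fun2[where G = rel_int, OF ft_rel_int_var]

lemma ft_fun_int_var: "ft (\<lambda>e. fun_int (e 0) (e 1))"
  unfolding fun_int_def by (intro fo_intros)
lemmas ft_fun_int [fo_intros] = ft_fun2[where G = fun_int, OF ft_fun_int_var]

lemma ft_codes [fo_intros]:
  "ft T \<Longrightarrow> ft (\<lambda>e. Var_code (T e))"
  "ft T \<Longrightarrow> ft U \<Longrightarrow> ft (\<lambda>e. Fun_code (T e) (U e))"
  "ft T \<Longrightarrow> ft U \<Longrightarrow> ft (\<lambda>e. Eq_code (T e) (U e))"
  "ft T \<Longrightarrow> ft U \<Longrightarrow> ft (\<lambda>e. Rel_code (T e) (U e))"
  "ft T \<Longrightarrow> ft (\<lambda>e. Neg_code (T e))"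
  "ft T \<Longrightarrow> ft U \<Longrightarrow> ft (\<lambda>e. Conj_code (T e) (U e))"
  "ft T \<Longrightarrow> ft U \<Longrightarrow> ft (\<lambda>e. Ex_code (T e) (U e))"
  unfolding Var_code_def Fun_code_def Eq_code_def Rel_code_def Neg_code_def Conj_code_def
    Ex_code_def by (intro ft_vpair ft_const; assumption)+

lemmas code_defs = Var_code_def Fun_code_def Eq_code_def Rel_code_def Neg_code_def
  Conj_code_def Ex_code_def

lemma code_eq [simp]:
  "Var_code k = Var_code k' \<longleftrightarrow> k = k'"
  "Fun_code F u = Fun_code F' u' \<longleftrightarrow> F = F' \<and> u = u'"
  "Var_code k \<noteq> Fun_code F u"
  "Fun_code F u \<noteq> Var_code k"
  unfolding code_defs by (simp_all del: numeral_code.simps)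

lemma language_arity:
  assumes "is_language L"
  shows fun_arity_omega: "F \<in> elts (fun_syms L) \<Longrightarrow> fun_arity L F \<in> elts omega"
    and rel_arity_omega: "R \<in> elts (rel_syms L) \<Longrightarrow> rel_arity L R \<in> elts omega"
proof -
  obtain rs fs r f where L: "L = vpair r f" "r \<in> elts (funs rs (vset (elts omega - {vset {}})))"
      "f \<in> elts (funs fs omega)"
    using assms unfolding is_language_def by blast
  have *: "is_set (elts omega - {vset {}})"
    using is_set_Diff_elts[of omega "vset {vset {}}"] by (simp add: elts_vset)
  have "rel_syms L = rs" "fun_syms L = fs"
    using L by (simp_all add: rel_syms_def fun_syms_def funs_vdom)
  then show "F \<in> elts (fun_syms L) \<Longrightarrow> fun_arity L F \<in> elts omega"
    and "R \<in> elts (rel_syms L) \<Longrightarrow> rel_arity L R \<in> elts omega"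
    using funs_app[OF L(2)] funs_app[OF L(3)] L(1) *
    by (simp_all add: rel_arity_def fun_arity_def elts_vset)
qed

lemma structure_components:
  assumes "is_structure L M"
  shows universe_nonempty: "elts (universe M) \<noteq> {}"
    and fun_int_funs: "F \<in> elts (fun_syms L) \<Longrightarrow>
      fun_int M F \<in> elts (funs (funs (fun_arity L F) (universe M)) (universe M))"
proof -
  obtain A r f where M: "M = vpair A (vpair r f)" "elts A \<noteq> {}"
    "\<forall>F\<in>elts (fun_syms L). app f F \<in> elts (funs (funs (fun_arity L F) A) A)"
    using assms unfolding is_structure_def by blast
  then show "elts (universe M) \<noteq> {}"
    "F \<in> elts (fun_syms L) \<Longrightarrow>
      fun_int M F \<in> elts (funs (funs (fun_arity L F) (universe M)) (universe M))"
    unfolding universe_def fun_int_def by simp_all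
qed

lemma ft_terms_in_var: "ft (\<lambda>e. terms_in (e 0) (e 1))"
  unfolding terms_in_def least_closed_def by (intro fo_intros)
lemmas ft_terms_in [fo_intros] = ft_fun2[where G = terms_in, OF ft_terms_in_var]

context
  fixes L assumes L: "is_language L"
begin

definition term_closed :: "'v \<Rightarrow> 'v \<Rightarrow> bool" where
  "term_closed X T \<longleftrightarrow> (\<forall>k\<in>elts X. Var_code k \<in> elts T) \<and>
     (\<forall>F\<in>elts (fun_syms L). \<forall>u\<in>elts (funs (fun_arity L F) T). Fun_code F u \<in> elts T)"

lemma elts_terms_in: "elts (terms_in L X) = {t. \<forall>T. term_closed X T \<longrightarrow> t \<in> elts T}"
proof -
  obtain H where H: "elts (vset (elts X \<union> elts (fun_syms L))) \<subseteq> elts H" "elts omega \<subseteq> elts H"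
    "\<And>x y. x \<in> elts H \<Longrightarrow> y \<in> elts H \<Longrightarrow> vpair x y \<in> elts H"
    "\<And>n f. n \<in> elts omega \<Longrightarrow> f \<in> elts (funs n H) \<Longrightarrow> f \<in> elts H"
    using finitary_closure by metis
  have "numeral_code n \<in> elts H" for n using H(2) by (meson numeral_code_omega subsetD)
  moreover have "elts X \<subseteq> elts H" "elts (fun_syms L) \<subseteq> elts H"
    using H(1) by (simp_all add: elts_vset)
  ultimately have "term_closed X H"
    unfolding term_closed_def code_defs using fun_arity_omega[OF L]
    by (intro conjI ballI H(3)) (blast intro: H(4))+
  moreover have "fo (\<lambda>e. term_closed X (e 0))"
    unfolding term_closed_def by (intro fo_intros)
  ultimately show ?thesis
    using elts_least_closed[of "term_closed X" H] unfolding terms_in_def term_closed_def by simp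
qed

lemma Var_in_terms: "k \<in> elts X \<Longrightarrow> Var_code k \<in> elts (terms_in L X)"
  by (simp add: elts_terms_in term_closed_def)

lemma Fun_in_terms:
  assumes F: "F \<in> elts (fun_syms L)" and u: "u \<in> elts (funs (fun_arity L F) (terms_in L X))"
  shows "Fun_code F u \<in> elts (terms_in L X)"
  unfolding elts_terms_in
proof (intro CollectI allI impI)
  fix T assume T: "term_closed X T"
  then have "elts (terms_in L X) \<subseteq> elts T" unfolding elts_terms_in by blast
  then have "u \<in> elts (funs (fun_arity L F) T)" by (rule funs_mono[OF u])
  then show "Fun_code F u \<in> elts T" using T F unfolding term_closed_def by blast
qed

lemma term_induct:
  assumes t: "t \<in> elts (terms_in L X)" and P: "fo (\<lambda>e. P (e 0))"
    and Var: "\<And>k. k \<in> elts X \<Longrightarrow> P (Var_code k)"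
    and Fun: "\<And>F u. F \<in> elts (fun_syms L) \<Longrightarrow> u \<in> elts (funs (fun_arity L F) (terms_in L X)) \<Longrightarrow>
      (\<And>j. j \<in> elts (fun_arity L F) \<Longrightarrow> P (app u j)) \<Longrightarrow> P (Fun_code F u)"
  shows "P t"
proof -
  have T: "elts (vset {t \<in> elts (terms_in L X). P t}) = {t \<in> elts (terms_in L X). P t}" (is "elts ?T = _")
    by (rule elts_vset[OF is_set_separation[OF P]])
  have "term_closed X ?T"
    unfolding term_closed_def
  proof (intro conjI ballI)
    show "Var_code k \<in> elts ?T" if "k \<in> elts X" for k
      using Var Var_in_terms that unfolding T by blast
    fix F u assume F: "F \<in> elts (fun_syms L)" and u: "u \<in> elts (funs (fun_arity L F) ?T)"
    have "u \<in> elts (funs (fun_arity L F) (terms_in L X))"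
      using funs_mono[OF u] T by blast
    moreover have "P (app u j)" if "j \<in> elts (fun_arity L F)" for j
      using funs_app[OF u that] T by blast
    ultimately show "Fun_code F u \<in> elts ?T"
      using Fun[OF F] Fun_in_terms[OF F] unfolding T by blast
  qed
  then have "t \<in> elts ?T" using t unfolding elts_terms_in by blast
  then show ?thesis unfolding T by blast
qed

lemma term_cases:
  assumes "t \<in> elts (terms_in L X)"
  obtains (Var) k where "k \<in> elts X" "t = Var_code k"
  | (Fun) F u where "F \<in> elts (fun_syms L)" "u \<in> elts (funs (fun_arity L F) (terms_in L X))"
      "t = Fun_code F u"
proof -
  have "(\<exists>k\<in>elts X. t = Var_code k) \<or> (\<exists>F\<in>elts (fun_syms L).
      \<exists>u\<in>elts (funs (fun_arity L F) (terms_in L X)). t = Fun_code F u)"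
    by (rule term_induct[OF assms]) (intro fo_intros, blast+)
  then show thesis using Var Fun by blast
qed

lemma terms_in_mono:
  assumes "elts X \<subseteq> elts Y" shows "elts (terms_in L X) \<subseteq> elts (terms_in L Y)"
  using assms unfolding elts_terms_in term_closed_def by blast

lemma is_term_eval_unique:
  assumes v: "is_term_eval L M s v" and w: "is_term_eval L M s w" shows "v = w"
proof (rule function_eqI)
  show v': "function_on (terms_in L (vdom s)) v" and w': "function_on (terms_in L (vdom s)) w"
    using v w by (simp_all add: is_term_eval_def in_funs)
  show "app v t = app w t" if "t \<in> elts (terms_in L (vdom s))" for t
  proof (rule term_induct[OF that])
    show "app v (Var_code k) = app w (Var_code k)" if "k \<in> elts (vdom s)" for k
      using v w that by (simp add: is_term_eval_def)
    fix F u assume F: "F \<in> elts (fun_syms L)"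
      and u: "u \<in> elts (funs (fun_arity L F) (terms_in L (vdom s)))"
      and IH: "\<And>j. j \<in> elts (fun_arity L F) \<Longrightarrow> app v (app u j) = app w (app u j)"
    have "vcomp v u = vcomp w u"
      by (rule function_eqI[OF function_on_vcomp function_on_vcomp])
        (simp add: app_vcomp IH funs_vdom[OF u])
    then show "app v (Fun_code F u) = app w (Fun_code F u)"
      using v w F u by (simp add: is_term_eval_def)
  qed (intro fo_intros)
qed

lemma fo_is_term_eval_var: "fo (\<lambda>e. is_term_eval L (e 0) (e 1) (e 2))"
  unfolding is_term_eval_def by (intro fo_intros)
lemmas fo_is_term_eval = fo_pred3[where P = "is_term_eval L", OF fo_is_term_eval_var]

lemma ft_term_eval_var: "ft (\<lambda>e. term_eval L (e 0) (e 1))"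
  unfolding term_eval_def by (rule ft_The[OF is_term_eval_unique]) (assumption+, intro fo_intros fo_is_term_eval)
lemmas ft_term_eval = ft_fun2[where G = "term_eval L", OF ft_term_eval_var]

text \<open>Evaluation is a recursion along the relation between the entries of \<open>u\<close> and
  the term \<open>Fun_code F u\<close>. That the values stay in the universe is proved afterwards,
  by induction on terms.\<close>

lemma is_term_eval_term_eval:
  assumes M: "is_structure L M" and s: "s \<in> elts (funs X (universe M))"
  shows "is_term_eval L M s (term_eval L M s)"
proof -
  \<comment> \<open>The recursion step must be a total operation on the model, so it decodes its
    argument by projections. Its values at elements that are not terms are meaningless.\<close>
  define H where "H = (\<lambda>t f. if \<exists>k. t = Var_code k then app s (vsnd t)
    else app (fun_int M (vfst (vsnd t))) (vcomp f (vsnd (vsnd t))))"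
  define R where "R = (\<lambda>t' t. \<exists>F u. t = Fun_code F u \<and> (\<exists>j\<in>elts (vdom u). t' = app u j))"
  have HVar: "H (Var_code k) f = app s k" for k f
    unfolding H_def by (simp add: Var_code_def)
  have HFun: "H (Fun_code F u) f = app (fun_int M F) (vcomp f u)" for F u f
  proof -
    have "H (Fun_code F u) f = app (fun_int M (vfst (vsnd (Fun_code F u)))) (vcomp f (vsnd (vsnd (Fun_code F u))))"
      unfolding H_def by simp
    then show ?thesis by (simp add: Fun_code_def)
  qed
  obtain v where v: "function_on (terms_in L X) v"
    "\<And>t. t \<in> elts (terms_in L X) \<Longrightarrow> app v t = H t v"
  proof (rule recursion[of "terms_in L X" R H])
    show "fo (\<lambda>e. R (e 0) (e 1))" unfolding R_def by (intro fo_intros)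
    show "ft (\<lambda>e. H (e 0) (e 1))" unfolding H_def by (intro fo_intros)
    show "elts (terms_in L X) \<subseteq> elts S"
      if S: "\<And>t. t \<in> elts (terms_in L X) \<Longrightarrow>
        (\<And>t'. t' \<in> elts (terms_in L X) \<Longrightarrow> R t' t \<Longrightarrow> t' \<in> elts S) \<Longrightarrow> t \<in> elts S" for S
    proof
      show "t \<in> elts S" if "t \<in> elts (terms_in L X)" for t
      proof (rule term_induct[OF that])
        show "Var_code k \<in> elts S" if "k \<in> elts X" for k
          by (rule S[OF Var_in_terms[OF that]]) (simp add: R_def)
        show "Fun_code F u \<in> elts S" if F: "F \<in> elts (fun_syms L)"
          and u: "u \<in> elts (funs (fun_arity L F) (terms_in L X))"
          and IH: "\<And>j. j \<in> elts (fun_arity L F) \<Longrightarrow> app u j \<in> elts S" for F u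
          by (rule S[OF Fun_in_terms[OF F u]]) (use IH in \<open>auto simp: R_def funs_vdom[OF u]\<close>)
      qed (intro fo_intros)
    qed
    show "H t f = H t g" if t: "t \<in> elts (terms_in L X)" and fg: "\<And>t'. R t' t \<Longrightarrow> app f t' = app g t'"
      for t f g
      using t
    proof (cases rule: term_cases)
      case (Var k)
      then show ?thesis by (simp add: HVar)
    next
      case (Fun F u)
      have "vcomp f u = vcomp g u"
      proof (rule function_eqI[OF function_on_vcomp function_on_vcomp])
        fix j assume "j \<in> elts (vdom u)"
        then show "app (vcomp f u) j = app (vcomp g u) j"
          using fg[of "app u j"] Fun(3) by (auto simp: app_vcomp R_def)
      qed
      then show ?thesis by (simp add: Fun(3) HFun)
    qed
  qed (use that in blast)
  have vU: "app v t \<in> elts (universe M)" if "t \<in> elts (terms_in L X)" for t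
  proof (rule term_induct[OF that])
    show "app v (Var_code k) \<in> elts (universe M)" if "k \<in> elts X" for k
      using v(2)[OF Var_in_terms[OF that]] funs_app[OF s that] by (simp add: HVar)
    fix F u assume F: "F \<in> elts (fun_syms L)"
      and u: "u \<in> elts (funs (fun_arity L F) (terms_in L X))"
      and IH: "\<And>j. j \<in> elts (fun_arity L F) \<Longrightarrow> app v (app u j) \<in> elts (universe M)"
    have "vcomp v u \<in> elts (funs (fun_arity L F) (universe M))"
      unfolding in_funs using function_on_vcomp[of u v] IH funs_vdom[OF u] by (simp add: app_vcomp)
    then show "app v (Fun_code F u) \<in> elts (universe M)"
      using v(2)[OF Fun_in_terms[OF F u]] funs_app[OF fun_int_funs[OF M F]] by (simp add: HFun)
  qed (intro fo_intros)
  have "is_term_eval L M s v"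
    unfolding is_term_eval_def funs_vdom[OF s] in_funs
    using v vU Var_in_terms Fun_in_terms by (simp add: HVar HFun in_funs)
  then have "term_eval L M s = v"
    unfolding term_eval_def using is_term_eval_unique by blast
  with \<open>is_term_eval L M s v\<close> show ?thesis by simp
qed

lemma term_eval:
  assumes "is_structure L M" "s \<in> elts (funs X (universe M))"
  shows term_eval_in_funs: "term_eval L M s \<in> elts (funs (terms_in L X) (universe M))"
    and term_eval_Var: "k \<in> elts X \<Longrightarrow> app (term_eval L M s) (Var_code k) = app s k"
    and term_eval_Fun: "F \<in> elts (fun_syms L) \<Longrightarrow> u \<in> elts (funs (fun_arity L F) (terms_in L X)) \<Longrightarrow>
      app (term_eval L M s) (Fun_code F u) = app (fun_int M F) (vcomp (term_eval L M s) u)"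
  using is_term_eval_term_eval[OF assms] funs_vdom[OF assms(2)] by (simp_all add: is_term_eval_def)

end

section \<open>Formulas: codes, closure and induction\<close>

declare numeral_code.simps [simp del]

lemma formula_code_eq [simp]:
  "Eq_code t u = Eq_code t' u' \<longleftrightarrow> t = t' \<and> u = u'"
  "Rel_code R u = Rel_code R' u' \<longleftrightarrow> R = R' \<and> u = u'"
  "Neg_code \<phi> = Neg_code \<phi>' \<longleftrightarrow> \<phi> = \<phi>'"
  "Conj_code \<phi> \<psi> = Conj_code \<phi>' \<psi>' \<longleftrightarrow> \<phi> = \<phi>' \<and> \<psi> = \<psi>'"
  "Ex_code k \<phi> = Ex_code k' \<phi>' \<longleftrightarrow> k = k' \<and> \<phi> = \<phi>'"
  unfolding code_defs by simp_all

lemma ft_formula_pairs_var: "ft (\<lambda>e. formula_pairs (e 0))"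
  unfolding formula_pairs_def least_closed_def by (intro fo_intros)
lemmas ft_formula_pairs [fo_intros] = ft_fun1[where G = formula_pairs, OF ft_formula_pairs_var]

lemma ft_formulas_in_var: "ft (\<lambda>e. formulas_in (e 0) (e 1))"
  unfolding formulas_in_def by (intro fo_intros)
lemmas ft_formulas_in [fo_intros] = ft_fun2[where G = formulas_in, OF ft_formulas_in_var]

lemma in_formulas_in: "\<phi> \<in> elts (formulas_in L X) \<longleftrightarrow> vpair X \<phi> \<in> elts (formula_pairs L)"
proof -
  have "is_set {\<phi>. vpair X \<phi> \<in> elts (formula_pairs L)}"
  proof (rule is_set_subset)
    show "fo (\<lambda>e. e 0 \<in> {\<phi>. vpair X \<phi> \<in> elts (formula_pairs L)})" by (intro fo_intros)
    show "{\<phi>. vpair X \<phi> \<in> elts (formula_pairs L)} \<subseteq> elts (vset (vsnd ` elts (formula_pairs L)))"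
      by (force simp: elts_vset is_set_image ft_vsnd ft_var)
  qed
  then show ?thesis by (simp add: formulas_in_def elts_vset)
qed

definition formula_closed :: "'v \<Rightarrow> 'v \<Rightarrow> bool" where
  "formula_closed L W \<longleftrightarrow> (\<forall>X. elts X \<subseteq> elts omega \<longrightarrow>
     (\<forall>t\<in>elts (terms_in L X). \<forall>u\<in>elts (terms_in L X). vpair X (Eq_code t u) \<in> elts W) \<and>
     (\<forall>R\<in>elts (rel_syms L). \<forall>u\<in>elts (funs (rel_arity L R) (terms_in L X)).
        vpair X (Rel_code R u) \<in> elts W) \<and>
     (\<forall>\<phi>. vpair X \<phi> \<in> elts W \<longrightarrow> vpair X (Neg_code \<phi>) \<in> elts W) \<and>
     (\<forall>\<phi> \<psi>. vpair X \<phi> \<in> elts W \<and> vpair X \<psi> \<in> elts W \<longrightarrow> vpair X (Conj_code \<phi> \<psi>) \<in> elts W) \<and>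
     (\<forall>k\<in>elts omega. \<forall>\<phi>. vpair (vset (insert k (elts X))) \<phi> \<in> elts W \<longrightarrow>
        vpair X (Ex_code k \<phi>) \<in> elts W))"

text \<open>One closure condition that bounds all inductively defined sets of formulas below: the
  formulas over an index set, the quantifier-free ones and the levels of the prenex hierarchy. No
  language occurs in it, as the relation symbols are simply elements of the set.\<close>

definition code_closed :: "'v \<Rightarrow> bool" where
  "code_closed H \<longleftrightarrow>
     (\<forall>t\<in>elts H. \<forall>u\<in>elts H. Eq_code t u \<in> elts H) \<and>
     (\<forall>R\<in>elts H. \<forall>n\<in>elts omega. \<forall>u\<in>elts (funs n H). Rel_code R u \<in> elts H) \<and>
     (\<forall>\<phi>\<in>elts H. Neg_code \<phi> \<in> elts H) \<and>
     (\<forall>\<phi>\<in>elts H. \<forall>\<psi>\<in>elts H. Conj_code \<phi> \<psi> \<in> elts H) \<and>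
     (\<forall>k\<in>elts omega. \<forall>\<phi>\<in>elts H. Ex_code k \<phi> \<in> elts H)"

lemma code_closure:
  obtains H where "elts A \<subseteq> elts H" "code_closed H"
proof -
  obtain H where H: "elts A \<subseteq> elts H" "elts omega \<subseteq> elts H"
    "\<And>x y. x \<in> elts H \<Longrightarrow> y \<in> elts H \<Longrightarrow> vpair x y \<in> elts H"
    "\<And>n f. n \<in> elts omega \<Longrightarrow> f \<in> elts (funs n H) \<Longrightarrow> f \<in> elts H"
    using finitary_closure by metis
  have num: "numeral_code n \<in> elts H" for n using H(2) by (meson numeral_code_omega subsetD)
  have "code_closed H"
    unfolding code_closed_def code_defs
    by (intro conjI ballI H(3) num) (auto intro: H(4) subsetD[OF H(2)])
  then show thesis using H(1) that by blast
qed

context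
  fixes L assumes L: "is_language L"
begin

text \<open>The bounding set is the product of the power set of \<open>omega\<close> with a set
  \<open>H\<close> closed under the codes. It is enough that \<open>H\<close> contains the terms
  over \<open>omega\<close>, since these include the terms over every smaller index set.\<close>

lemma elts_formula_pairs: "elts (formula_pairs L) = {p. \<forall>W. formula_closed L W \<longrightarrow> p \<in> elts W}"
proof -
  obtain H where H: "elts (vset (elts (terms_in L omega) \<union> elts (rel_syms L))) \<subseteq> elts H"
    and closed: "code_closed H"
    by (rule code_closure)
  have sub: "elts (terms_in L X) \<subseteq> elts H" if "elts X \<subseteq> elts omega" for X
    using terms_in_mono[OF L that] H(1) by (auto simp: elts_vset)
  have rel: "elts (rel_syms L) \<subseteq> elts H"
    using H(1) by (simp add: elts_vset)
  let ?P = "vset {X. elts X \<subseteq> elts omega}"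
  have "formula_closed L (vtimes ?P H)"
    unfolding formula_closed_def vpair_in_vtimes elts_vset[OF is_set_Pow]
  proof (intro allI impI conjI ballI)
    show "Rel_code R u \<in> elts H" if "elts X \<subseteq> elts omega" "R \<in> elts (rel_syms L)"
      "u \<in> elts (funs (rel_arity L R) (terms_in L X))" for X R u
      using closed rel_arity_omega[OF L that(2)] funs_mono[OF that(3) sub[OF that(1)]] rel that(2)
      unfolding code_closed_def by blast
    show "Eq_code t u \<in> elts H"
      if "elts X \<subseteq> elts omega" "t \<in> elts (terms_in L X)" "u \<in> elts (terms_in L X)" for X t u
      using closed sub[OF that(1)] that(2,3) unfolding code_closed_def by blast
  qed (use closed in \<open>auto simp: elts_vset code_closed_def\<close>)
  moreover have "fo (\<lambda>e. formula_closed L (e 0))"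
    unfolding formula_closed_def by (intro fo_intros)
  moreover have "formula_pairs L = least_closed (formula_closed L)"
    unfolding formula_pairs_def formula_closed_def ..
  ultimately show ?thesis
    using elts_least_closed[of "formula_closed L" "vtimes ?P H"] by simp
qed

lemma formula_pairs_least: "formula_closed L W \<Longrightarrow> elts (formula_pairs L) \<subseteq> elts W"
  unfolding elts_formula_pairs by blast

lemma formula_closed_formula_pairs: "formula_closed L (formula_pairs L)"
  unfolding formula_closed_def
proof (intro allI impI conjI ballI)
  fix X assume X: "elts X \<subseteq> elts omega"
  note D = formula_closed_def[THEN iffD1, rule_format, OF _ X]
  show "vpair X (Eq_code t u) \<in> elts (formula_pairs L)"
    if "t \<in> elts (terms_in L X)" "u \<in> elts (terms_in L X)" for t u
    using D that unfolding elts_formula_pairs by blast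
  show "vpair X (Rel_code R u) \<in> elts (formula_pairs L)"
    if "R \<in> elts (rel_syms L)" "u \<in> elts (funs (rel_arity L R) (terms_in L X))" for R u
    using D that unfolding elts_formula_pairs by blast
  show "vpair X (Neg_code \<phi>) \<in> elts (formula_pairs L)" if "vpair X \<phi> \<in> elts (formula_pairs L)" for \<phi>
    using D that unfolding elts_formula_pairs by blast
  show "vpair X (Conj_code \<phi> \<psi>) \<in> elts (formula_pairs L)"
    if "vpair X \<phi> \<in> elts (formula_pairs L) \<and> vpair X \<psi> \<in> elts (formula_pairs L)" for \<phi> \<psi>
    using D that unfolding elts_formula_pairs by blast
  show "vpair X (Ex_code k \<phi>) \<in> elts (formula_pairs L)"
    if "k \<in> elts omega" "vpair (vset (insert k (elts X))) \<phi> \<in> elts (formula_pairs L)" for k \<phi>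
    using D that unfolding elts_formula_pairs by blast
qed

lemma formulas_in_intros:
  assumes X: "elts X \<subseteq> elts omega"
  shows Eq_in_formulas: "t \<in> elts (terms_in L X) \<Longrightarrow> u \<in> elts (terms_in L X) \<Longrightarrow>
      Eq_code t u \<in> elts (formulas_in L X)"
    and Rel_in_formulas: "R \<in> elts (rel_syms L) \<Longrightarrow>
      u \<in> elts (funs (rel_arity L R) (terms_in L X)) \<Longrightarrow> Rel_code R u \<in> elts (formulas_in L X)"
    and Neg_in_formulas: "\<phi> \<in> elts (formulas_in L X) \<Longrightarrow> Neg_code \<phi> \<in> elts (formulas_in L X)"
    and Conj_in_formulas: "\<phi> \<in> elts (formulas_in L X) \<Longrightarrow> \<psi> \<in> elts (formulas_in L X) \<Longrightarrow>
      Conj_code \<phi> \<psi> \<in> elts (formulas_in L X)"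
    and Ex_in_formulas: "k \<in> elts omega \<Longrightarrow>
      \<phi> \<in> elts (formulas_in L (vset (insert k (elts X)))) \<Longrightarrow> Ex_code k \<phi> \<in> elts (formulas_in L X)"
  using formula_closed_formula_pairs[unfolded formula_closed_def, rule_format, OF X]
  unfolding in_formulas_in by blast+

text \<open>The index set varies during the induction because the clause for the quantifier enlarges
  it. The conclusion is existential so as to deliver also that every member is a pair whose first
  component is a subset of \<open>omega\<close>.\<close>

lemma formula_pair_induct:
  assumes p: "p \<in> elts (formula_pairs L)" and P: "fo (\<lambda>e. P (e 0) (e 1))"
    and Eq: "\<And>X t u. elts X \<subseteq> elts omega \<Longrightarrow> t \<in> elts (terms_in L X) \<Longrightarrow> u \<in> elts (terms_in L X) \<Longrightarrow>
      P X (Eq_code t u)"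
    and Rel: "\<And>X R u. elts X \<subseteq> elts omega \<Longrightarrow> R \<in> elts (rel_syms L) \<Longrightarrow>
      u \<in> elts (funs (rel_arity L R) (terms_in L X)) \<Longrightarrow> P X (Rel_code R u)"
    and Neg: "\<And>X \<phi>. elts X \<subseteq> elts omega \<Longrightarrow> \<phi> \<in> elts (formulas_in L X) \<Longrightarrow> P X \<phi> \<Longrightarrow>
      P X (Neg_code \<phi>)"
    and Conj: "\<And>X \<phi> \<psi>. elts X \<subseteq> elts omega \<Longrightarrow> \<phi> \<in> elts (formulas_in L X) \<Longrightarrow> P X \<phi> \<Longrightarrow>
      \<psi> \<in> elts (formulas_in L X) \<Longrightarrow> P X \<psi> \<Longrightarrow> P X (Conj_code \<phi> \<psi>)"
    and Ex: "\<And>X k \<phi>. elts X \<subseteq> elts omega \<Longrightarrow> k \<in> elts omega \<Longrightarrow>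
      \<phi> \<in> elts (formulas_in L (vset (insert k (elts X)))) \<Longrightarrow> P (vset (insert k (elts X))) \<phi> \<Longrightarrow>
      P X (Ex_code k \<phi>)"
  obtains X \<phi> where "p = vpair X \<phi>" "elts X \<subseteq> elts omega" "\<phi> \<in> elts (formulas_in L X)" "P X \<phi>"
proof -
  define W where "W = vset {p \<in> elts (formula_pairs L).
    \<exists>X \<phi>. p = vpair X \<phi> \<and> elts X \<subseteq> elts omega \<and> P X \<phi>}"
  have P': "ft T \<Longrightarrow> ft U \<Longrightarrow> fo (\<lambda>e. P (T e) (U e))" for T U
    by (rule fo_pred2[where P = P, OF P])
  have elW: "elts W = {p \<in> elts (formula_pairs L).
      \<exists>X \<phi>. p = vpair X \<phi> \<and> elts X \<subseteq> elts omega \<and> P X \<phi>}"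
    unfolding W_def by (rule elts_vset[OF is_set_separation]) (intro fo_intros P')
  have W: "vpair X \<phi> \<in> elts W \<longleftrightarrow> \<phi> \<in> elts (formulas_in L X) \<and> elts X \<subseteq> elts omega \<and> P X \<phi>" for X \<phi>
    unfolding elW in_formulas_in by auto
  have "formula_closed L W"
    unfolding formula_closed_def W
    using formulas_in_intros Eq Rel Neg Conj Ex by auto
  then have "p \<in> elts W" using p formula_pairs_least by blast
  then show thesis using that unfolding elW in_formulas_in by blast
qed

lemma formula_induct:
  assumes \<phi>: "\<phi> \<in> elts (formulas_in L X)" and P: "fo (\<lambda>e. P (e 0) (e 1))"
    and "\<And>X t u. elts X \<subseteq> elts omega \<Longrightarrow> t \<in> elts (terms_in L X) \<Longrightarrow> u \<in> elts (terms_in L X) \<Longrightarrow>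
      P X (Eq_code t u)"
    and "\<And>X R u. elts X \<subseteq> elts omega \<Longrightarrow> R \<in> elts (rel_syms L) \<Longrightarrow>
      u \<in> elts (funs (rel_arity L R) (terms_in L X)) \<Longrightarrow> P X (Rel_code R u)"
    and "\<And>X \<phi>. elts X \<subseteq> elts omega \<Longrightarrow> \<phi> \<in> elts (formulas_in L X) \<Longrightarrow> P X \<phi> \<Longrightarrow>
      P X (Neg_code \<phi>)"
    and "\<And>X \<phi> \<psi>. elts X \<subseteq> elts omega \<Longrightarrow> \<phi> \<in> elts (formulas_in L X) \<Longrightarrow> P X \<phi> \<Longrightarrow>
      \<psi> \<in> elts (formulas_in L X) \<Longrightarrow> P X \<psi> \<Longrightarrow> P X (Conj_code \<phi> \<psi>)"
    and "\<And>X k \<phi>. elts X \<subseteq> elts omega \<Longrightarrow> k \<in> elts omega \<Longrightarrow>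
      \<phi> \<in> elts (formulas_in L (vset (insert k (elts X)))) \<Longrightarrow> P (vset (insert k (elts X))) \<phi> \<Longrightarrow>
      P X (Ex_code k \<phi>)"
  shows "P X \<phi>"
proof -
  obtain X' \<phi>' where "vpair X \<phi> = vpair X' \<phi>'" "P X' \<phi>'"
    by (rule formula_pair_induct[where P = P, OF \<phi>[unfolded in_formulas_in] assms(2-)])
  then show ?thesis by simp
qed

lemma formulas_in_omega:
  assumes "\<phi> \<in> elts (formulas_in L X)" shows "elts X \<subseteq> elts omega"
  by (rule formula_induct[OF assms, where P = "\<lambda>X \<phi>. elts X \<subseteq> elts omega"]) (intro fo_intros, assumption+)

end

section \<open>Satisfaction\<close>

context
  fixes L assumes L: "is_language L"
begin

lemma fo_is_satisfaction_var: "fo (\<lambda>e. is_satisfaction L (e 0) (e 1))"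
  unfolding is_satisfaction_def by (intro fo_intros ft_term_eval[OF L])
lemmas fo_is_satisfaction = fo_pred2[where P = "is_satisfaction L", OF fo_is_satisfaction_var]

lemma fo_satisfies_var: "fo (\<lambda>e. satisfies L (e 0) (e 1) (e 2))"
  unfolding satisfies_def by (intro fo_intros fo_is_satisfaction)
lemmas fo_satisfies = fo_pred3[where P = "satisfies L", OF fo_satisfies_var]

lemma is_satisfactionD:
  assumes S: "is_satisfaction L M S" and X: "elts X \<subseteq> elts omega" and s: "s \<in> elts (funs X (universe M))"
  shows "t \<in> elts (terms_in L X) \<Longrightarrow> u \<in> elts (terms_in L X) \<Longrightarrow>
      vpair (Eq_code t u) s \<in> elts S \<longleftrightarrow> app (term_eval L M s) t = app (term_eval L M s) u"
    and "R \<in> elts (rel_syms L) \<Longrightarrow> v \<in> elts (funs (rel_arity L R) (terms_in L X)) \<Longrightarrow>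
      vpair (Rel_code R v) s \<in> elts S \<longleftrightarrow> vcomp (term_eval L M s) v \<in> elts (rel_int M R)"
    and "\<phi> \<in> elts (formulas_in L X) \<Longrightarrow> vpair (Neg_code \<phi>) s \<in> elts S \<longleftrightarrow> vpair \<phi> s \<notin> elts S"
    and "\<phi> \<in> elts (formulas_in L X) \<Longrightarrow> \<psi> \<in> elts (formulas_in L X) \<Longrightarrow>
      vpair (Conj_code \<phi> \<psi>) s \<in> elts S \<longleftrightarrow> vpair \<phi> s \<in> elts S \<and> vpair \<psi> s \<in> elts S"
    and "k \<in> elts omega \<Longrightarrow> \<chi> \<in> elts (formulas_in L (vset (insert k (elts X)))) \<Longrightarrow>
      vpair (Ex_code k \<chi>) s \<in> elts S \<longleftrightarrow> (\<exists>a\<in>elts (universe M). vpair \<chi> (vupd s k a) \<in> elts S)"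
proof -
  note D = mp[OF spec[OF spec[OF S[unfolded is_satisfaction_def]]] conjI[OF X s]]
  note D2 = D[THEN conjunct2]
  note D3 = D2[THEN conjunct2]
  note D4 = D3[THEN conjunct2]
  show "vpair (Eq_code t u) s \<in> elts S \<longleftrightarrow> app (term_eval L M s) t = app (term_eval L M s) u"
    if "t \<in> elts (terms_in L X)" "u \<in> elts (terms_in L X)"
    by (rule D[THEN conjunct1, rule_format, OF that])
  show "vpair (Rel_code R v) s \<in> elts S \<longleftrightarrow> vcomp (term_eval L M s) v \<in> elts (rel_int M R)"
    if "R \<in> elts (rel_syms L)" "v \<in> elts (funs (rel_arity L R) (terms_in L X))"
    by (rule D2[THEN conjunct1, rule_format, OF that])
  show "vpair (Neg_code \<phi>) s \<in> elts S \<longleftrightarrow> vpair \<phi> s \<notin> elts S" if "\<phi> \<in> elts (formulas_in L X)"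
    by (rule D3[THEN conjunct1, rule_format, OF that])
  show "vpair (Conj_code \<phi> \<psi>) s \<in> elts S \<longleftrightarrow> vpair \<phi> s \<in> elts S \<and> vpair \<psi> s \<in> elts S"
    if "\<phi> \<in> elts (formulas_in L X)" "\<psi> \<in> elts (formulas_in L X)"
    by (rule D4[THEN conjunct1, rule_format, OF that])
  show "vpair (Ex_code k \<chi>) s \<in> elts S \<longleftrightarrow> (\<exists>a\<in>elts (universe M). vpair \<chi> (vupd s k a) \<in> elts S)"
    if "k \<in> elts omega" "\<chi> \<in> elts (formulas_in L (vset (insert k (elts X))))"
    by (rule D4[THEN conjunct2, rule_format, OF that])
qed

lemma satisfaction_unique:
  assumes S: "is_satisfaction L M S" and S': "is_satisfaction L M S'"
    and \<phi>: "\<phi> \<in> elts (formulas_in L X)" and s: "s \<in> elts (funs X (universe M))"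
  shows "vpair \<phi> s \<in> elts S \<longleftrightarrow> vpair \<phi> s \<in> elts S'"
proof -
  let ?P = "\<lambda>X \<phi>. \<forall>s\<in>elts (funs X (universe M)). vpair \<phi> s \<in> elts S \<longleftrightarrow> vpair \<phi> s \<in> elts S'"
  have "?P X \<phi>"
  proof (rule formula_induct[OF L \<phi>, where P = ?P])
    show "fo (\<lambda>e. ?P (e 0) (e 1))"
      by (intro fo_intros)
  next
    fix X k \<phi>
    assume X: "elts X \<subseteq> elts omega" and k: "k \<in> elts omega"
      and \<phi>: "\<phi> \<in> elts (formulas_in L (vset (insert k (elts X))))"
      and IH: "?P (vset (insert k (elts X))) \<phi>"
    show "?P X (Ex_code k \<phi>)"
    proof
      fix s assume s: "s \<in> elts (funs X (universe M))"
      have "vpair \<phi> (vupd s k a) \<in> elts S \<longleftrightarrow> vpair \<phi> (vupd s k a) \<in> elts S'" if "a \<in> elts (universe M)" for a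
        using IH vupd_in_funs[OF s that] by blast
      then show "vpair (Ex_code k \<phi>) s \<in> elts S \<longleftrightarrow> vpair (Ex_code k \<phi>) s \<in> elts S'"
        by (simp add: is_satisfactionD(5)[OF S X s k \<phi>] is_satisfactionD(5)[OF S' X s k \<phi>])
    qed
  qed (simp_all add: is_satisfactionD(1-4)[OF S] is_satisfactionD(1-4)[OF S'])
  then show ?thesis using s by blast
qed

text \<open>One step of Tarski's recursion: \<open>f\<close> maps a pair \<open>(X, \<phi>)\<close> to the set of assignments on \<open>X\<close>
  satisfying \<open>\<phi>\<close>.\<close>

definition sat_step :: "'v \<Rightarrow> 'v \<Rightarrow> 'v \<Rightarrow> 'v \<Rightarrow> 'v \<Rightarrow> bool" where
  "sat_step M X \<phi> f s \<longleftrightarrow>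
     vfst \<phi> = numeral_code 0 \<and>
       app (term_eval L M s) (vfst (vsnd \<phi>)) = app (term_eval L M s) (vsnd (vsnd \<phi>)) \<or>
     vfst \<phi> = numeral_code 1 \<and> vcomp (term_eval L M s) (vsnd (vsnd \<phi>)) \<in> elts (rel_int M (vfst (vsnd \<phi>))) \<or>
     vfst \<phi> = numeral_code 2 \<and> s \<notin> elts (app f (vpair X (vsnd \<phi>))) \<or>
     vfst \<phi> = numeral_code 3 \<and> s \<in> elts (app f (vpair X (vfst (vsnd \<phi>)))) \<and>
       s \<in> elts (app f (vpair X (vsnd (vsnd \<phi>)))) \<or>
     vfst \<phi> = numeral_code 4 \<and> (\<exists>a\<in>elts (universe M). vupd s (vfst (vsnd \<phi>)) a \<in>
       elts (app f (vpair (vset (insert (vfst (vsnd \<phi>)) (elts X))) (vsnd (vsnd \<phi>)))))"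

definition subformula_pair :: "'v \<Rightarrow> 'v \<Rightarrow> bool" where
  "subformula_pair q p \<longleftrightarrow>
     (\<exists>X \<phi>. p = vpair X (Neg_code \<phi>) \<and> q = vpair X \<phi>) \<or>
     (\<exists>X \<phi> \<psi>. p = vpair X (Conj_code \<phi> \<psi>) \<and> (q = vpair X \<phi> \<or> q = vpair X \<psi>)) \<or>
     (\<exists>X k \<phi>. p = vpair X (Ex_code k \<phi>) \<and> q = vpair (vset (insert k (elts X))) \<phi>)"

lemma sat_step_code:
  "sat_step M X (Eq_code t u) f s \<longleftrightarrow> app (term_eval L M s) t = app (term_eval L M s) u"
  "sat_step M X (Rel_code R v) f s \<longleftrightarrow> vcomp (term_eval L M s) v \<in> elts (rel_int M R)"
  "sat_step M X (Neg_code \<phi>) f s \<longleftrightarrow> s \<notin> elts (app f (vpair X \<phi>))"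
  "sat_step M X (Conj_code \<phi> \<psi>) f s \<longleftrightarrow>
     s \<in> elts (app f (vpair X \<phi>)) \<and> s \<in> elts (app f (vpair X \<psi>))"
  "sat_step M X (Ex_code k \<phi>) f s \<longleftrightarrow>
     (\<exists>a\<in>elts (universe M). vupd s k a \<in> elts (app f (vpair (vset (insert k (elts X))) \<phi>)))"
  unfolding sat_step_def code_defs by simp_all

lemma formula_pair_cases:
  assumes "p \<in> elts (formula_pairs L)"
  obtains (Eq) X t u where "p = vpair X (Eq_code t u)"
  | (Rel) X R u where "p = vpair X (Rel_code R u)"
  | (Neg) X \<phi> where "p = vpair X (Neg_code \<phi>)"
  | (Conj) X \<phi> \<psi> where "p = vpair X (Conj_code \<phi> \<psi>)"
  | (Ex) X k \<phi> where "p = vpair X (Ex_code k \<phi>)"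
proof -
  obtain X \<phi> where "p = vpair X \<phi>" "(\<exists>t u. \<phi> = Eq_code t u) \<or> (\<exists>R u. \<phi> = Rel_code R u) \<or>
    (\<exists>\<psi>. \<phi> = Neg_code \<psi>) \<or> (\<exists>\<psi> \<chi>. \<phi> = Conj_code \<psi> \<chi>) \<or> (\<exists>k \<psi>. \<phi> = Ex_code k \<psi>)"
    by (rule formula_pair_induct[OF L assms, where P = "\<lambda>X \<phi>. (\<exists>t u. \<phi> = Eq_code t u) \<or>
      (\<exists>R u. \<phi> = Rel_code R u) \<or> (\<exists>\<psi>. \<phi> = Neg_code \<psi>) \<or> (\<exists>\<psi> \<chi>. \<phi> = Conj_code \<psi> \<chi>) \<or>
      (\<exists>k \<psi>. \<phi> = Ex_code k \<psi>)"]) (intro fo_intros, blast+)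
  then show thesis using that by blast
qed

text \<open>Satisfaction in a structure that is an element of the model is a set of the model. The
  recursion runs over pairs of an index set and a formula, since passing under a quantifier changes
  the domain of the assignments.\<close>

lemma satisfaction_exists:
  assumes M: "is_structure L M"
  obtains S where "is_satisfaction L M S"
proof -
  let ?U = "universe M"
  define H where "H = (\<lambda>p f. vset {s \<in> elts (funs (vfst p) ?U). sat_step M (vfst p) (vsnd p) f s})"
  have step: "fo (\<lambda>e. sat_step M (T e) (U e) (V e) (W e))" if "ft T" "ft U" "ft V" "ft W" for T U V W
    by (rule fo_pred4[where P = "sat_step M", OF _ that], unfold sat_step_def)
      (intro fo_intros ft_term_eval[OF L])
  obtain F where F: "function_on (formula_pairs L) F"
    "\<And>p. p \<in> elts (formula_pairs L) \<Longrightarrow> app F p = H p F"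
  proof (rule recursion[of "formula_pairs L" subformula_pair H])
    show "fo (\<lambda>e. subformula_pair (e 0) (e 1))"
      unfolding subformula_pair_def by (intro fo_intros)
    show "ft (\<lambda>e. H (e 0) (e 1))"
      unfolding H_def by (intro fo_intros step)
    show "elts (formula_pairs L) \<subseteq> elts S"
      if S: "\<And>p. p \<in> elts (formula_pairs L) \<Longrightarrow>
        (\<And>q. q \<in> elts (formula_pairs L) \<Longrightarrow> subformula_pair q p \<Longrightarrow> q \<in> elts S) \<Longrightarrow> p \<in> elts S" for S
    proof
      fix p assume p: "p \<in> elts (formula_pairs L)"
      have S': "vpair X \<phi> \<in> elts S" if "\<phi> \<in> elts (formulas_in L X)"
        "\<And>q. subformula_pair q (vpair X \<phi>) \<Longrightarrow> q \<in> elts S" for X \<phi>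
        using S that unfolding in_formulas_in by blast
      obtain X \<phi> where "p = vpair X \<phi>" "vpair X \<phi> \<in> elts S"
      proof (rule formula_pair_induct[OF L p, where P = "\<lambda>X \<phi>. vpair X \<phi> \<in> elts S"])
        show "vpair X (Eq_code t u) \<in> elts S" if "elts X \<subseteq> elts omega"
          "t \<in> elts (terms_in L X)" "u \<in> elts (terms_in L X)" for X t u
          by (rule S'[OF Eq_in_formulas[OF L that]]) (simp add: subformula_pair_def code_defs)
        show "vpair X (Rel_code R u) \<in> elts S" if "elts X \<subseteq> elts omega"
          "R \<in> elts (rel_syms L)" "u \<in> elts (funs (rel_arity L R) (terms_in L X))" for X R u
          by (rule S'[OF Rel_in_formulas[OF L that]]) (simp add: subformula_pair_def code_defs)
        show "vpair X (Neg_code \<phi>) \<in> elts S" if "elts X \<subseteq> elts omega"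
          "\<phi> \<in> elts (formulas_in L X)" "vpair X \<phi> \<in> elts S" for X \<phi>
          by (rule S'[OF Neg_in_formulas[OF L that(1,2)]])
            (use that(3) in \<open>auto simp: subformula_pair_def code_defs\<close>)
        show "vpair X (Conj_code \<phi> \<psi>) \<in> elts S" if "elts X \<subseteq> elts omega"
          "\<phi> \<in> elts (formulas_in L X)" "vpair X \<phi> \<in> elts S"
          "\<psi> \<in> elts (formulas_in L X)" "vpair X \<psi> \<in> elts S" for X \<phi> \<psi>
          by (rule S'[OF Conj_in_formulas[OF L that(1,2,4)]])
            (use that(3,5) in \<open>auto simp: subformula_pair_def code_defs\<close>)
        show "vpair X (Ex_code k \<phi>) \<in> elts S" if "elts X \<subseteq> elts omega" "k \<in> elts omega"
          "\<phi> \<in> elts (formulas_in L (vset (insert k (elts X))))"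
          "vpair (vset (insert k (elts X))) \<phi> \<in> elts S" for X k \<phi>
          by (rule S'[OF Ex_in_formulas[OF L that(1,2,3)]])
            (use that(4) in \<open>auto simp: subformula_pair_def code_defs\<close>)
      qed (intro fo_intros)
      then show "p \<in> elts S" by simp
    qed
    show "H p f = H p g" if p: "p \<in> elts (formula_pairs L)"
      and fg: "\<And>q. subformula_pair q p \<Longrightarrow> app f q = app g q" for p f g
      using p
    proof (cases rule: formula_pair_cases)
      case (Neg X \<phi>)
      have "app f (vpair X \<phi>) = app g (vpair X \<phi>)" by (rule fg) (auto simp: Neg subformula_pair_def)
      then show ?thesis by (simp add: H_def Neg sat_step_code)
    next
      case (Conj X \<phi> \<psi>)
      have "app f (vpair X \<phi>) = app g (vpair X \<phi>)" "app f (vpair X \<psi>) = app g (vpair X \<psi>)"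
        by (rule fg; auto simp: Conj subformula_pair_def)+
      then show ?thesis by (simp add: H_def Conj sat_step_code)
    next
      case (Ex X k \<phi>)
      let ?q = "vpair (vset (insert k (elts X))) \<phi>"
      have "app f ?q = app g ?q" by (rule fg) (auto simp: Ex subformula_pair_def)
      then show ?thesis by (simp add: H_def Ex sat_step_code)
    qed (simp_all add: H_def sat_step_code)
  qed blast
  have appF: "s \<in> elts (app F (vpair X \<phi>)) \<longleftrightarrow> sat_step M X \<phi> F s"
    if "\<phi> \<in> elts (formulas_in L X)" "s \<in> elts (funs X ?U)" for X \<phi> s
  proof -
    have "is_set {s \<in> elts (funs X ?U). sat_step M X \<phi> F s}"
      by (rule is_set_separation) (intro step fo_intros)
    then show ?thesis
      using F(2) that unfolding in_formulas_in by (simp add: H_def elts_vset)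
  qed
  \<comment> \<open>The recursion is indexed by \<open>X\<close>, a satisfaction set is not. The
    index set is recovered as the domain of the assignment; \<open>?Q\<close> merely bounds the
    pairs in order to apply Separation.\<close>
  let ?Q = "vtimes (vset (vsnd ` elts (formula_pairs L))) (vset {s. elts s \<subseteq> elts (vtimes omega ?U)})"
  define S where "S = vset {p \<in> elts ?Q. vpair (vdom (vsnd p)) (vfst p) \<in> elts (formula_pairs L) \<and>
    vsnd p \<in> elts (app F (vpair (vdom (vsnd p)) (vfst p)))}"
  have elS: "elts S = {p \<in> elts ?Q. vpair (vdom (vsnd p)) (vfst p) \<in> elts (formula_pairs L) \<and>
    vsnd p \<in> elts (app F (vpair (vdom (vsnd p)) (vfst p)))}"
    unfolding S_def by (rule elts_vset[OF is_set_separation]) (intro fo_intros)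
  have S: "vpair \<phi> s \<in> elts S \<longleftrightarrow> sat_step M X \<phi> F s"
    if \<phi>: "\<phi> \<in> elts (formulas_in L X)" and s: "s \<in> elts (funs X ?U)" for X \<phi> s
  proof -
    have "vpair X \<phi> \<in> elts (formula_pairs L)" using \<phi> by (simp add: in_formulas_in)
    then have 1: "\<phi> \<in> elts (vset (vsnd ` elts (formula_pairs L)))"
      by (force simp: elts_vset is_set_image ft_vsnd ft_var)
    have "elts s \<subseteq> elts (vtimes omega ?U)"
      using s subsetD[OF formulas_in_omega[OF L \<phi>]] by (auto simp: in_funs function_on_elts)
    then have "vpair \<phi> s \<in> elts ?Q" using 1 by (simp add: elts_vset is_set_Pow)
    then show ?thesis
      using \<phi> appF[OF \<phi> s] unfolding elS in_formulas_in by (simp add: funs_vdom[OF s])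
  qed
  have "is_satisfaction L M S"
    unfolding is_satisfaction_def
  proof (intro allI impI conjI ballI; elim conjE)
    fix X s assume X: "elts X \<subseteq> elts omega" and s: "s \<in> elts (funs X ?U)"
    show "vpair (Eq_code t u) s \<in> elts S \<longleftrightarrow> app (term_eval L M s) t = app (term_eval L M s) u"
      if "t \<in> elts (terms_in L X)" "u \<in> elts (terms_in L X)" for t u
      using S[OF Eq_in_formulas[OF L X that] s] by (simp add: sat_step_code)
    show "vpair (Rel_code R u) s \<in> elts S \<longleftrightarrow> vcomp (term_eval L M s) u \<in> elts (rel_int M R)"
      if "R \<in> elts (rel_syms L)" "u \<in> elts (funs (rel_arity L R) (terms_in L X))" for R u
      using S[OF Rel_in_formulas[OF L X that] s] by (simp add: sat_step_code)
    show "vpair (Neg_code \<phi>) s \<in> elts S \<longleftrightarrow> vpair \<phi> s \<notin> elts S" if "\<phi> \<in> elts (formulas_in L X)" for \<phi>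
      using S[OF Neg_in_formulas[OF L X that] s] S[OF that s] appF[OF that s] by (simp add: sat_step_code)
    show "vpair (Conj_code \<phi> \<psi>) s \<in> elts S \<longleftrightarrow> vpair \<phi> s \<in> elts S \<and> vpair \<psi> s \<in> elts S"
      if "\<phi> \<in> elts (formulas_in L X)" "\<psi> \<in> elts (formulas_in L X)" for \<phi> \<psi>
      using S[OF Conj_in_formulas[OF L X that] s] S[OF that(1) s] S[OF that(2) s]
        appF[OF that(1) s] appF[OF that(2) s] by (simp add: sat_step_code)
    show "vpair (Ex_code k \<phi>) s \<in> elts S \<longleftrightarrow> (\<exists>a\<in>elts ?U. vpair \<phi> (vupd s k a) \<in> elts S)"
      if "k \<in> elts omega" "\<phi> \<in> elts (formulas_in L (vset (insert k (elts X))))" for k \<phi>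
      using S[OF Ex_in_formulas[OF L X that] s] S[OF that(2) vupd_in_funs[OF s]]
        appF[OF that(2) vupd_in_funs[OF s]] by (simp add: sat_step_code)
  qed
  then show thesis by (rule that)
qed

text \<open>The quantifier over satisfaction sets in \<open>satisfies\<close> may be read off at any
  single one: one exists, and any two agree on formulas and assignments over the same index
  set.\<close>

lemma satisfies_code:
  assumes M: "is_structure L M" and X: "elts X \<subseteq> elts omega" and s: "s \<in> elts (funs X (universe M))"
  shows satisfies_Eq: "t \<in> elts (terms_in L X) \<Longrightarrow> u \<in> elts (terms_in L X) \<Longrightarrow>
      satisfies L M (Eq_code t u) s \<longleftrightarrow> app (term_eval L M s) t = app (term_eval L M s) u"
    and satisfies_Rel: "R \<in> elts (rel_syms L) \<Longrightarrow> v \<in> elts (funs (rel_arity L R) (terms_in L X)) \<Longrightarrow>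
      satisfies L M (Rel_code R v) s \<longleftrightarrow> vcomp (term_eval L M s) v \<in> elts (rel_int M R)"
    and satisfies_Neg: "\<phi> \<in> elts (formulas_in L X) \<Longrightarrow>
      satisfies L M (Neg_code \<phi>) s \<longleftrightarrow> \<not> satisfies L M \<phi> s"
    and satisfies_Conj: "\<phi> \<in> elts (formulas_in L X) \<Longrightarrow> \<psi> \<in> elts (formulas_in L X) \<Longrightarrow>
      satisfies L M (Conj_code \<phi> \<psi>) s \<longleftrightarrow> satisfies L M \<phi> s \<and> satisfies L M \<psi> s"
    and satisfies_Ex: "k \<in> elts omega \<Longrightarrow> \<chi> \<in> elts (formulas_in L (vset (insert k (elts X)))) \<Longrightarrow>
      satisfies L M (Ex_code k \<chi>) s \<longleftrightarrow> (\<exists>a\<in>elts (universe M). satisfies L M \<chi> (vupd s k a))"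
proof -
  obtain S where S: "is_satisfaction L M S" using satisfaction_exists[OF M] .
  have sat: "satisfies L M \<phi> s \<longleftrightarrow> vpair \<phi> s \<in> elts S"
    if "\<phi> \<in> elts (formulas_in L X)" "s \<in> elts (funs X (universe M))" for \<phi> X s
    unfolding satisfies_def using S satisfaction_unique[OF _ S that] by blast
  note D = is_satisfactionD[OF S X s]
  show "satisfies L M (Eq_code t u) s \<longleftrightarrow> app (term_eval L M s) t = app (term_eval L M s) u"
    if "t \<in> elts (terms_in L X)" "u \<in> elts (terms_in L X)"
    using sat[OF Eq_in_formulas[OF L X that] s] D(1)[OF that] by simp
  show "satisfies L M (Rel_code R v) s \<longleftrightarrow> vcomp (term_eval L M s) v \<in> elts (rel_int M R)"
    if "R \<in> elts (rel_syms L)" "v \<in> elts (funs (rel_arity L R) (terms_in L X))"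
    using sat[OF Rel_in_formulas[OF L X that] s] D(2)[OF that] by simp
  show "satisfies L M (Neg_code \<phi>) s \<longleftrightarrow> \<not> satisfies L M \<phi> s" if "\<phi> \<in> elts (formulas_in L X)"
    using sat[OF Neg_in_formulas[OF L X that] s] sat[OF that s] D(3)[OF that] by simp
  show "satisfies L M (Conj_code \<phi> \<psi>) s \<longleftrightarrow> satisfies L M \<phi> s \<and> satisfies L M \<psi> s"
    if "\<phi> \<in> elts (formulas_in L X)" "\<psi> \<in> elts (formulas_in L X)"
    using sat[OF Conj_in_formulas[OF L X that] s] sat[OF that(1) s] sat[OF that(2) s] D(4)[OF that]
    by simp
  show "satisfies L M (Ex_code k \<chi>) s \<longleftrightarrow> (\<exists>a\<in>elts (universe M). satisfies L M \<chi> (vupd s k a))"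
    if "k \<in> elts omega" "\<chi> \<in> elts (formulas_in L (vset (insert k (elts X))))"
    using sat[OF Ex_in_formulas[OF L X that] s] sat[OF that(2) vupd_in_funs[OF s]] D(5)[OF that]
    by simp
qed

text \<open>The relation \<open>B\<close> must be definable since the induction on formulas takes
  place in the model. The lemma is used twice: for an isomorphism, with the graph of composition as
  \<open>B\<close>, and for equivalence relations, with equality of types.\<close>

lemma back_and_forth:
  assumes M: "is_structure L M" and N: "is_structure L N" and B: "fo (\<lambda>e. B (e 0) (e 1))"
    and Eq: "\<And>X s t a b. elts X \<subseteq> elts omega \<Longrightarrow> s \<in> elts (funs X (universe M)) \<Longrightarrow>
      t \<in> elts (funs X (universe N)) \<Longrightarrow> B s t \<Longrightarrow>
      a \<in> elts (terms_in L X) \<Longrightarrow> b \<in> elts (terms_in L X) \<Longrightarrow>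
      app (term_eval L M s) a = app (term_eval L M s) b \<longleftrightarrow>
      app (term_eval L N t) a = app (term_eval L N t) b"
    and Rel: "\<And>X s t R u. elts X \<subseteq> elts omega \<Longrightarrow> s \<in> elts (funs X (universe M)) \<Longrightarrow>
      t \<in> elts (funs X (universe N)) \<Longrightarrow> B s t \<Longrightarrow>
      R \<in> elts (rel_syms L) \<Longrightarrow> u \<in> elts (funs (rel_arity L R) (terms_in L X)) \<Longrightarrow>
      vcomp (term_eval L M s) u \<in> elts (rel_int M R) \<longleftrightarrow>
      vcomp (term_eval L N t) u \<in> elts (rel_int N R)"
    and fwd: "\<And>X s t k a. elts X \<subseteq> elts omega \<Longrightarrow> s \<in> elts (funs X (universe M)) \<Longrightarrow>
      t \<in> elts (funs X (universe N)) \<Longrightarrow> B s t \<Longrightarrow> k \<in> elts omega \<Longrightarrow> a \<in> elts (universe M) \<Longrightarrow>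
      \<exists>b\<in>elts (universe N). B (vupd s k a) (vupd t k b)"
    and bwd: "\<And>X s t k b. elts X \<subseteq> elts omega \<Longrightarrow> s \<in> elts (funs X (universe M)) \<Longrightarrow>
      t \<in> elts (funs X (universe N)) \<Longrightarrow> B s t \<Longrightarrow> k \<in> elts omega \<Longrightarrow> b \<in> elts (universe N) \<Longrightarrow>
      \<exists>a\<in>elts (universe M). B (vupd s k a) (vupd t k b)"
    and \<phi>: "\<phi> \<in> elts (formulas_in L X)" and st: "s \<in> elts (funs X (universe M))"
      "t \<in> elts (funs X (universe N))" "B s t"
  shows "satisfies L M \<phi> s \<longleftrightarrow> satisfies L N \<phi> t"
proof -
  have B': "ft T \<Longrightarrow> ft U \<Longrightarrow> fo (\<lambda>e. B (T e) (U e))" for T U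
    by (rule fo_pred2[where P = B, OF B])
  let ?P = "\<lambda>X \<phi>. \<forall>s\<in>elts (funs X (universe M)). \<forall>t\<in>elts (funs X (universe N)). B s t \<longrightarrow>
    (satisfies L M \<phi> s \<longleftrightarrow> satisfies L N \<phi> t)"
  have "?P X \<phi>"
  proof (rule formula_induct[OF L \<phi>, where P = ?P])
    show "fo (\<lambda>e. ?P (e 0) (e 1))"
      by (intro fo_intros B' fo_satisfies)
  next
    fix X k \<phi>
    assume X: "elts X \<subseteq> elts omega" and k: "k \<in> elts omega"
      and \<phi>: "\<phi> \<in> elts (formulas_in L (vset (insert k (elts X))))"
      and IH: "?P (vset (insert k (elts X))) \<phi>"
    show "?P X (Ex_code k \<phi>)"
    proof (intro ballI impI)
      fix s t assume s: "s \<in> elts (funs X (universe M))" and t: "t \<in> elts (funs X (universe N))"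
        and st: "B s t"
      have IH': "satisfies L M \<phi> (vupd s k a) \<longleftrightarrow> satisfies L N \<phi> (vupd t k b)"
        if "a \<in> elts (universe M)" "b \<in> elts (universe N)" "B (vupd s k a) (vupd t k b)" for a b
        using IH vupd_in_funs[OF s that(1)] vupd_in_funs[OF t that(2)] that(3) by blast
      have "(\<exists>a\<in>elts (universe M). satisfies L M \<phi> (vupd s k a)) \<longleftrightarrow>
          (\<exists>b\<in>elts (universe N). satisfies L N \<phi> (vupd t k b))"
      proof
        assume "\<exists>a\<in>elts (universe M). satisfies L M \<phi> (vupd s k a)"
        then obtain a where a: "a \<in> elts (universe M)" "satisfies L M \<phi> (vupd s k a)" by blast
        then show "\<exists>b\<in>elts (universe N). satisfies L N \<phi> (vupd t k b)"
          using fwd[OF X s t st k a(1)] IH'[OF a(1)] by blast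
      next
        assume "\<exists>b\<in>elts (universe N). satisfies L N \<phi> (vupd t k b)"
        then obtain b where b: "b \<in> elts (universe N)" "satisfies L N \<phi> (vupd t k b)" by blast
        then show "\<exists>a\<in>elts (universe M). satisfies L M \<phi> (vupd s k a)"
          using bwd[OF X s t st k b(1)] IH'[OF _ b(1)] by blast
      qed
      then show "satisfies L M (Ex_code k \<phi>) s \<longleftrightarrow> satisfies L N (Ex_code k \<phi>) t"
        by (simp add: satisfies_Ex[OF M X s k \<phi>] satisfies_Ex[OF N X t k \<phi>])
    qed
  qed (simp_all add: satisfies_Eq[OF M] satisfies_Eq[OF N] satisfies_Rel[OF M] satisfies_Rel[OF N]
      satisfies_Neg[OF M] satisfies_Neg[OF N] satisfies_Conj[OF M] satisfies_Conj[OF N] Eq Rel)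
  then show ?thesis using st by blast
qed

end

section \<open>Isomorphisms\<close>

lemma ft_vlam [fo_intros]:
  assumes "ft A" "ft (\<lambda>e. b (e 0) (\<lambda>n. e (Suc n)))" shows "ft (\<lambda>e. vlam (A e) (\<lambda>x. b x e))"
proof -
  have "ft (\<lambda>e. b (e 0) (\<lambda>n. e (Suc (Suc n))))"
    using ft_rename[OF assms(2), of "case_nat 0 (\<lambda>n. Suc (Suc n))"] by simp
  moreover have "ft (\<lambda>e. A (\<lambda>n. e (Suc (Suc n))))" by (rule ft_rename[OF assms(1)])
  ultimately show ?thesis unfolding vlam_def by (intro fo_intros)
qed

text \<open>The map is an argument here, so that one can be selected for each index. Bijectivity is
  split into two conditions that are visibly first-order.\<close>

definition isomorphism :: "'v \<Rightarrow> 'v \<Rightarrow> 'v \<Rightarrow> 'v \<Rightarrow> bool" where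
  "isomorphism L M N h \<longleftrightarrow> h \<in> elts (funs (universe M) (universe N)) \<and>
     inj_on (app h) (elts (universe M)) \<and> app h ` elts (universe M) = elts (universe N) \<and>
     (\<forall>R\<in>elts (rel_syms L). \<forall>x\<in>elts (funs (rel_arity L R) (universe M)).
        x \<in> elts (rel_int M R) \<longleftrightarrow> vcomp h x \<in> elts (rel_int N R)) \<and>
     (\<forall>F\<in>elts (fun_syms L). \<forall>x\<in>elts (funs (fun_arity L F) (universe M)).
        app h (app (fun_int M F) x) = app (fun_int N F) (vcomp h x))"

lemma isomorphic_iff: "isomorphic L M N \<longleftrightarrow> (\<exists>h. isomorphism L M N h)"
  unfolding isomorphic_def isomorphism_def bij_betw_def by blast

lemma fo_isomorphism_var: "fo (\<lambda>e. isomorphism L (e 0) (e 1) (e 2))"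
  unfolding isomorphism_def inj_on_def by (intro fo_intros)
lemmas fo_isomorphism [fo_intros] = fo_pred3[where P = "isomorphism L" for L, OF fo_isomorphism_var]

text \<open>Term values commute with \<open>h\<close>, so the pairs of \<open>s\<close> and
  \<open>vcomp h s\<close> form a back-and-forth system. The backward step is surjectivity.\<close>

lemma isomorphism_satisfies:
  assumes L: "is_language L" and M: "is_structure L M" and N: "is_structure L N"
    and h: "isomorphism L M N h"
    and \<phi>: "\<phi> \<in> elts (formulas_in L X)" and s: "s \<in> elts (funs X (universe M))"
  shows "satisfies L M \<phi> s \<longleftrightarrow> satisfies L N \<phi> (vcomp h s)"
proof -
  have hf: "h \<in> elts (funs (universe M) (universe N))"
    and hinj: "\<And>a b. a \<in> elts (universe M) \<Longrightarrow> b \<in> elts (universe M) \<Longrightarrow> app h a = app h b \<Longrightarrow> a = b"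
    and hsurj: "app h ` elts (universe M) = elts (universe N)"
    and hrel: "\<And>R x. R \<in> elts (rel_syms L) \<Longrightarrow> x \<in> elts (funs (rel_arity L R) (universe M)) \<Longrightarrow>
        x \<in> elts (rel_int M R) \<longleftrightarrow> vcomp h x \<in> elts (rel_int N R)"
    and hfun: "\<And>F x. F \<in> elts (fun_syms L) \<Longrightarrow> x \<in> elts (funs (fun_arity L F) (universe M)) \<Longrightarrow>
        app h (app (fun_int M F) x) = app (fun_int N F) (vcomp h x)"
    using h unfolding isomorphism_def inj_on_def by blast+
  have comp: "vcomp h s \<in> elts (funs X (universe N))" if "s \<in> elts (funs X (universe M))" for X s
    using vcomp_in_funs[OF that] funs_app[OF hf] by blast
  have ev: "app (term_eval L N (vcomp h s)) t = app h (app (term_eval L M s) t)"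
    if s: "s \<in> elts (funs X (universe M))" and t: "t \<in> elts (terms_in L X)" for X s t
  proof (rule term_induct[OF L t])
    show "app (term_eval L N (vcomp h s)) (Var_code k) = app h (app (term_eval L M s) (Var_code k))"
      if "k \<in> elts X" for k
      using that s by (simp add: term_eval_Var[OF L M s] term_eval_Var[OF L N comp[OF s]] app_vcomp funs_vdom)
    fix F u assume F: "F \<in> elts (fun_syms L)" and u: "u \<in> elts (funs (fun_arity L F) (terms_in L X))"
      and IH: "\<And>j. j \<in> elts (fun_arity L F) \<Longrightarrow>
        app (term_eval L N (vcomp h s)) (app u j) = app h (app (term_eval L M s) (app u j))"
    have te: "vcomp (term_eval L M s) u \<in> elts (funs (fun_arity L F) (universe M))"
      using vcomp_in_funs[OF u] funs_app[OF term_eval_in_funs[OF L M s]] by blast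
    have "vcomp (term_eval L N (vcomp h s)) u = vcomp h (vcomp (term_eval L M s) u)"
    proof (rule function_eqI)
      show "function_on (vdom u) (vcomp (term_eval L N (vcomp h s)) u)"
        "function_on (vdom u) (vcomp h (vcomp (term_eval L M s) u))"
        using function_on_vcomp[of u] function_on_vcomp[of "vcomp (term_eval L M s) u" h] by simp_all
    qed (simp add: app_vcomp IH funs_vdom[OF u])
    then show "app (term_eval L N (vcomp h s)) (Fun_code F u) = app h (app (term_eval L M s) (Fun_code F u))"
      by (simp add: term_eval_Fun[OF L M s F u] term_eval_Fun[OF L N comp[OF s] F u] hfun[OF F te])
  qed (intro fo_intros)
  show ?thesis
  proof (rule back_and_forth[OF L M N, where B = "\<lambda>s t. t = vcomp h s"])
    show "fo (\<lambda>e. e 1 = vcomp h (e 0))" by (intro fo_intros)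
    fix X s t assume s: "s \<in> elts (funs X (universe M))" and t: "t = vcomp h s"
    show "app (term_eval L M s) a = app (term_eval L M s) b \<longleftrightarrow>
      app (term_eval L N t) a = app (term_eval L N t) b"
      if "a \<in> elts (terms_in L X)" "b \<in> elts (terms_in L X)" for a b
      using hinj[OF funs_app[OF term_eval_in_funs[OF L M s] that(1)]
          funs_app[OF term_eval_in_funs[OF L M s] that(2)]]
      unfolding t ev[OF s that(1)] ev[OF s that(2)] by auto
    show "vcomp (term_eval L M s) u \<in> elts (rel_int M R) \<longleftrightarrow> vcomp (term_eval L N t) u \<in> elts (rel_int N R)"
      if R: "R \<in> elts (rel_syms L)" and u: "u \<in> elts (funs (rel_arity L R) (terms_in L X))" for R u
    proof -
      have te: "vcomp (term_eval L M s) u \<in> elts (funs (rel_arity L R) (universe M))"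
        using vcomp_in_funs[OF u] funs_app[OF term_eval_in_funs[OF L M s]] by blast
      have "vcomp (term_eval L N t) u = vcomp h (vcomp (term_eval L M s) u)"
      proof (rule function_eqI)
        show "function_on (vdom u) (vcomp (term_eval L N t) u)"
          "function_on (vdom u) (vcomp h (vcomp (term_eval L M s) u))"
          using function_on_vcomp[of u] function_on_vcomp[of "vcomp (term_eval L M s) u" h] by simp_all
      qed (use funs_app[OF u] in \<open>simp add: t app_vcomp ev[OF s] funs_vdom[OF u]\<close>)
      then show ?thesis using hrel[OF R te] by simp
    qed
    have sf: "function_on X s" using s by (simp add: in_funs)
    show "\<exists>b\<in>elts (universe N). vupd t k b = vcomp h (vupd s k a)" if "a \<in> elts (universe M)" for k a
      using funs_app[OF hf that] by (intro bexI[of _ "app h a"]) (simp_all add: t vcomp_vupd[OF sf])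
    show "\<exists>a\<in>elts (universe M). vupd t k b = vcomp h (vupd s k a)" if b: "b \<in> elts (universe N)" for k b
    proof -
      obtain a where "a \<in> elts (universe M)" "b = app h a" using b hsurj by blast
      then show ?thesis by (intro bexI[of _ a]) (simp_all add: t vcomp_vupd[OF sf])
    qed
  qed (use \<phi> s comp[OF s] in simp_all)
qed

lemma isomorphic_sentences:
  assumes "is_language L" "is_structure L M" "is_structure L N" "isomorphic L M N"
    and "\<phi> \<in> elts (formulas_in L (vset {}))"
  shows "satisfies L M \<phi> (vset {}) \<longleftrightarrow> satisfies L N \<phi> (vset {})"
proof -
  obtain h where h: "isomorphism L M N h" using assms(4) isomorphic_iff by blast
  have "vset {} \<in> elts (funs (vset {}) (universe M))" by (simp add: funs_empty)
  moreover have "vcomp h (vset {}) = vset {}"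
    using function_on_vcomp[of "vset {}" h] vdom_function_on[OF function_on_empty]
    by (simp add: function_on_empty_iff)
  ultimately show ?thesis
    using isomorphism_satisfies[OF assms(1-3) h assms(5)] by simp
qed

section \<open>Ultrafilters\<close>

text \<open>The quantifier "for \<open>U\<close>-almost all indices". As it asks for a member of
  \<open>U\<close> inside \<open>P\<close>, and not for the set of all \<open>i\<close> with
  \<open>P i\<close>, monotonicity and conjunction hold for arbitrary HOL predicates; definability
  enters only through \<open>often_mem\<close> and negation.\<close>

definition often :: "'v \<Rightarrow> ('v \<Rightarrow> bool) \<Rightarrow> bool" where
  "often U P \<longleftrightarrow> (\<exists>X\<in>elts U. \<forall>i\<in>elts X. P i)"

context
  fixes I U assumes U: "ultrafilter I U"
begin

lemma ultrafilter_subset: "X \<in> elts U \<Longrightarrow> elts X \<subseteq> elts I"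
  using U unfolding ultrafilter_def by blast

lemma often_mem:
  assumes "fo (\<lambda>e. P (e 0))" shows "vset {i \<in> elts I. P i} \<in> elts U \<longleftrightarrow> often U P"
proof
  have el: "elts (vset {i \<in> elts I. P i}) = {i \<in> elts I. P i}"
    by (rule elts_vset[OF is_set_separation[OF assms]])
  show "often U P" if "vset {i \<in> elts I. P i} \<in> elts U"
    using that el unfolding often_def by blast
  assume "often U P"
  then obtain X where "X \<in> elts U" "\<forall>i\<in>elts X. P i" unfolding often_def by blast
  moreover from this have "elts X \<subseteq> elts (vset {i \<in> elts I. P i})" "elts (vset {i \<in> elts I. P i}) \<subseteq> elts I"
    using ultrafilter_subset unfolding el by blast+
  ultimately show "vset {i \<in> elts I. P i} \<in> elts U"
    using U unfolding ultrafilter_def by blast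
qed

lemma often_mono:
  assumes "often U P" "\<And>i. i \<in> elts I \<Longrightarrow> P i \<Longrightarrow> Q i" shows "often U Q"
  using assms ultrafilter_subset unfolding often_def by blast

lemma often_cong: "(\<And>i. i \<in> elts I \<Longrightarrow> P i \<longleftrightarrow> Q i) \<Longrightarrow> often U P \<longleftrightarrow> often U Q"
  using often_mono[of P Q] often_mono[of Q P] by blast

lemma often_conj:
  assumes "often U P" "often U Q" shows "often U (\<lambda>i. P i \<and> Q i)"
proof -
  obtain X Y where XY: "X \<in> elts U" "Y \<in> elts U" "\<forall>i\<in>elts X. P i" "\<forall>i\<in>elts Y. Q i"
    using assms unfolding often_def by blast
  then have "vset (elts X \<inter> elts Y) \<in> elts U" using U unfolding ultrafilter_def by blast
  then show ?thesis unfolding often_def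
    by (rule rev_bexI) (use XY in \<open>auto simp: elts_vset\<close>)
qed

lemma often_conj_iff: "often U (\<lambda>i. P i \<and> Q i) \<longleftrightarrow> often U P \<and> often U Q"
  using often_conj often_mono[of "\<lambda>i. P i \<and> Q i"] by blast

lemma often_all_in: "(\<And>i. i \<in> elts I \<Longrightarrow> P i) \<Longrightarrow> often U P"
  using U unfolding ultrafilter_def often_def by blast

lemma not_often_False: "\<not> often U (\<lambda>i. False)"
  using U unfolding ultrafilter_def often_def by (metis elts_eq_empty equals0I)

lemma often_const: "often U (\<lambda>i. c) \<longleftrightarrow> c"
  using not_often_False often_all_in by (cases c) auto

text \<open>The ultrafilter decides sets of the model only, so the set of all \<open>i\<close> with
  \<open>P i\<close> has to exist there.\<close>

lemma often_not:
  assumes "fo (\<lambda>e. P (e 0))" shows "often U (\<lambda>i. \<not> P i) \<longleftrightarrow> \<not> often U P"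
proof
  assume "often U (\<lambda>i. \<not> P i)"
  then show "\<not> often U P" using often_conj[of P "\<lambda>i. \<not> P i"] not_often_False by auto
next
  have el: "elts (vset {i \<in> elts I. P i}) = {i \<in> elts I. P i}"
    by (rule elts_vset[OF is_set_separation[OF assms]])
  assume "\<not> often U P"
  then have "vset {i \<in> elts I. P i} \<notin> elts U" by (simp add: often_mem[OF assms])
  moreover have "elts (vset {i \<in> elts I. P i}) \<subseteq> elts I" unfolding el by blast
  ultimately have "vset (elts I - elts (vset {i \<in> elts I. P i})) \<in> elts U"
    using U unfolding ultrafilter_def by blast
  then show "often U (\<lambda>i. \<not> P i)"
    unfolding often_def
    by (rule rev_bexI) (simp add: elts_vset[OF is_set_Diff_elts], simp add: el)
qed

text \<open>Closure of \<open>U\<close> under intersections whose number is finite in the sense of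
  the model, hence by induction inside the model rather than by iterating \<open>often_conj\<close>
  in HOL.\<close>

lemma often_finite_all:
  assumes P: "fo (\<lambda>e. P (e 0) (e 1))" and n: "n \<in> elts omega"
    and often: "\<And>k. k \<in> elts n \<Longrightarrow> often U (P k)"
  shows "often U (\<lambda>i. \<forall>k\<in>elts n. P k i)"
proof -
  have P': "ft S \<Longrightarrow> ft T \<Longrightarrow> fo (\<lambda>e. P (S e) (T e))" for S T
    by (rule fo_pred2[where P = P, OF P])
  have "(\<forall>k\<in>elts n. often U (P k)) \<longrightarrow> often U (\<lambda>i. \<forall>k\<in>elts n. P k i)"
  proof (rule omega_induct[OF n])
    show "fo (\<lambda>e. (\<forall>k\<in>elts (e 0). often U (P k)) \<longrightarrow> often U (\<lambda>i. \<forall>k\<in>elts (e 0). P k i))"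
      unfolding often_def by (intro fo_intros P')
    show "(\<forall>k\<in>elts (vset {}). often U (P k)) \<longrightarrow> often U (\<lambda>i. \<forall>k\<in>elts (vset {}). P k i)"
      by (simp add: often_const)
    show "(\<forall>k\<in>elts (vsucc m). often U (P k)) \<longrightarrow> often U (\<lambda>i. \<forall>k\<in>elts (vsucc m). P k i)"
      if "(\<forall>k\<in>elts m. often U (P k)) \<longrightarrow> often U (\<lambda>i. \<forall>k\<in>elts m. P k i)" for m
      using that often_conj[of "P m" "\<lambda>i. \<forall>k\<in>elts m. P k i"] by simp
  qed
  then show ?thesis using often by blast
qed

end

section \<open>Ultraproducts\<close>

lemma elts_product: "elts (product I M) =
    {f. function_on I f \<and> (\<forall>i\<in>elts I. app f i \<in> elts (universe (app M i)))}"
  unfolding product_def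
proof (rule elts_vset, rule is_set_subset)
  show "fo (\<lambda>e. e 0 \<in> {f. function_on I f \<and> (\<forall>i\<in>elts I. app f i \<in> elts (universe (app M i)))})"
    by (intro fo_intros)
  have "is_set (\<Union>i\<in>elts I. elts (universe (app M i)))"
    by (rule is_set_UN) (intro fo_intros)
  then show "{f. function_on I f \<and> (\<forall>i\<in>elts I. app f i \<in> elts (universe (app M i)))} \<subseteq>
      elts (funs I (vset (\<Union>i\<in>elts I. elts (universe (app M i)))))"
    by (auto simp: in_funs elts_vset) blast
qed

lemma in_product: "f \<in> elts (product I M) \<longleftrightarrow>
    function_on I f \<and> (\<forall>i\<in>elts I. app f i \<in> elts (universe (app M i)))"
  by (simp add: elts_product)

lemma product_app: "f \<in> elts (product I M) \<Longrightarrow> i \<in> elts I \<Longrightarrow> app f i \<in> elts (universe (app M i))"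
  by (simp add: in_product)

lemma ft_tuple_at_var: "ft (\<lambda>e. tuple_at (e 0) (e 1))"
  unfolding tuple_at_def by (intro fo_intros)
lemmas ft_tuple_at [fo_intros] = ft_fun2[where G = tuple_at, OF ft_tuple_at_var]

lemma ft_ultra_class_var: "ft (\<lambda>e. ultra_class I U M (e 0))"
  unfolding ultra_class_def by (intro fo_intros)
lemmas ft_ultra_class [fo_intros] = ft_fun1[where G = "ultra_class I U M" for I U M, OF ft_ultra_class_var]

lemma ft_tuple_class_var: "ft (\<lambda>e. tuple_class I U M (e 0))"
  unfolding tuple_class_def by (intro fo_intros)
lemmas ft_tuple_class [fo_intros] = ft_fun1[where G = "tuple_class I U M" for I U M, OF ft_tuple_class_var]

lemma tuple_at:
  assumes "f \<in> elts (funs X (product I M))"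
  shows app_tuple_at: "k \<in> elts X \<Longrightarrow> app (tuple_at f i) k = app (app f k) i"
    and function_on_tuple_at: "function_on X (tuple_at f i)"
    and tuple_at_in_funs: "i \<in> elts I \<Longrightarrow> tuple_at f i \<in> elts (funs X (universe (app M i)))"
proof -
  have ft: "ft (\<lambda>e. app (app f (e 0)) i)" by (intro fo_intros)
  show 1: "function_on X (tuple_at f i)" and 2: "k \<in> elts X \<Longrightarrow> app (tuple_at f i) k = app (app f k) i" for k
    unfolding tuple_at_def funs_vdom[OF assms] using vlam[OF ft] by blast+
  show "tuple_at f i \<in> elts (funs X (universe (app M i)))" if "i \<in> elts I"
    using 1 2 product_app[OF funs_app[OF assms] that] by (simp add: in_funs)
qed

lemma tuple_class:
  assumes "f \<in> elts (funs X (product I M))"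
  shows app_tuple_class: "k \<in> elts X \<Longrightarrow> app (tuple_class I U M f) k = ultra_class I U M (app f k)"
    and function_on_tuple_class: "function_on X (tuple_class I U M f)"
proof -
  have ft: "ft (\<lambda>e. ultra_class I U M (app f (e 0)))" by (intro fo_intros)
  show "function_on X (tuple_class I U M f)"
    and "k \<in> elts X \<Longrightarrow> app (tuple_class I U M f) k = ultra_class I U M (app f k)"
    unfolding tuple_class_def funs_vdom[OF assms] using vlam[OF ft] by blast+
qed

text \<open>Together with its counterpart for classes, this matches an updated tuple of functions
  with the updated assignments in the factors and in the ultraproduct, as the quantifier step of
  Los's theorem requires.\<close>

lemma tuple_at_vupd:
  assumes "f \<in> elts (funs X (product I M))" "g \<in> elts (product I M)"
  shows "tuple_at (vupd f k g) i = vupd (tuple_at f i) k (app g i)"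
proof (rule function_eqI)
  let ?Y = "vset (insert k (elts X))"
  have 1: "vupd f k g \<in> elts (funs ?Y (product I M))" by (rule vupd_in_funs[OF assms])
  show "function_on ?Y (tuple_at (vupd f k g) i)" by (rule function_on_tuple_at[OF 1])
  show "function_on ?Y (vupd (tuple_at f i) k (app g i))"
    using function_on_vupd[of k "tuple_at f i"] vdom_function_on[OF function_on_tuple_at[OF assms(1)]] by simp
  show "app (tuple_at (vupd f k g) i) x = app (vupd (tuple_at f i) k (app g i)) x" if "x \<in> elts ?Y" for x
    using that vdom_function_on[OF function_on_tuple_at[OF assms(1), of i]]
    by (auto simp: app_tuple_at[OF 1] app_vupd funs_vdom[OF assms(1)] elts_vset app_tuple_at[OF assms(1)])
qed

lemma tuple_class_vupd:
  assumes "f \<in> elts (funs X (product I M))" "g \<in> elts (product I M)"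
  shows "tuple_class I U M (vupd f k g) = vupd (tuple_class I U M f) k (ultra_class I U M g)"
proof (rule function_eqI)
  let ?Y = "vset (insert k (elts X))"
  have 1: "vupd f k g \<in> elts (funs ?Y (product I M))" by (rule vupd_in_funs[OF assms])
  show "function_on ?Y (tuple_class I U M (vupd f k g))" by (rule function_on_tuple_class[OF 1])
  show "function_on ?Y (vupd (tuple_class I U M f) k (ultra_class I U M g))"
    using function_on_vupd[of k "tuple_class I U M f"] vdom_function_on[OF function_on_tuple_class[OF assms(1)]] by simp
  show "app (tuple_class I U M (vupd f k g)) x = app (vupd (tuple_class I U M f) k (ultra_class I U M g)) x"
    if "x \<in> elts ?Y" for x
    using that
    by (auto simp: vdom_function_on[OF function_on_tuple_class[OF assms(1)]] app_tuple_class[OF 1] app_vupd funs_vdom[OF assms(1)] elts_vset app_tuple_class[OF assms(1)])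
qed

text \<open>The choice principle to which all six statements are equivalent.\<close>

definition ultra_choice :: bool where
  "ultra_choice \<longleftrightarrow> (\<forall>I U A. ultrafilter I U \<and> function_on I A \<and> (\<forall>i\<in>elts I. elts (app A i) \<noteq> {}) \<longrightarrow>
     (\<exists>f. function_on I f \<and> often U (\<lambda>i. app f i \<in> elts (app A i))))"

context
  fixes L I U M
  assumes L: "is_language L" and U: "ultrafilter I U" and M: "structure_family L I M"
begin

lemma family_structure: "i \<in> elts I \<Longrightarrow> is_structure L (app M i)"
  using M unfolding structure_family_def by blast

lemma elts_ultra_class:
  "elts (ultra_class I U M f) = {g \<in> elts (product I M). often U (\<lambda>i. app f i = app g i)}"
proof -
  have *: "vset {i \<in> elts I. app f i = app g i} \<in> elts U \<longleftrightarrow> often U (\<lambda>i. app f i = app g i)" for g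
    by (rule often_mem[OF U]) (intro fo_intros)
  have "is_set {g \<in> elts (product I M). vset {i \<in> elts I. app f i = app g i} \<in> elts U}"
    by (rule is_set_separation) (intro fo_intros)
  then show ?thesis unfolding ultra_class_def by (simp add: elts_vset *)
qed

lemma ultra_class_eq:
  assumes "f \<in> elts (product I M)" "g \<in> elts (product I M)"
  shows "ultra_class I U M f = ultra_class I U M g \<longleftrightarrow> often U (\<lambda>i. app f i = app g i)"
proof
  assume "ultra_class I U M f = ultra_class I U M g"
  moreover have "g \<in> elts (ultra_class I U M g)"
    using assms(2) often_all_in[OF U] by (simp add: elts_ultra_class)
  ultimately have "g \<in> elts (ultra_class I U M f)" by simp
  then show "often U (\<lambda>i. app f i = app g i)" by (simp add: elts_ultra_class)
next
  assume fg: "often U (\<lambda>i. app f i = app g i)"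
  have "often U (\<lambda>i. app f i = app h i) \<longleftrightarrow> often U (\<lambda>i. app g i = app h i)" for h
  proof
    assume "often U (\<lambda>i. app f i = app h i)"
    then show "often U (\<lambda>i. app g i = app h i)"
      by (rule often_mono[OF U often_conj[OF U fg]]) auto
  next
    assume "often U (\<lambda>i. app g i = app h i)"
    then show "often U (\<lambda>i. app f i = app h i)"
      by (rule often_mono[OF U often_conj[OF U fg]]) auto
  qed
  then show "ultra_class I U M f = ultra_class I U M g"
    unfolding elts_inject[symmetric] elts_ultra_class by simp
qed

abbreviation "ult \<equiv> ultraproduct L I U M"

lemma universe_ultraproduct: "elts (universe ult) = ultra_class I U M ` elts (product I M)"
  unfolding ultraproduct_def universe_def vfst_vpair
  by (rule elts_vset[OF is_set_image]) (intro fo_intros)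

lemma tuple_class_in_funs:
  assumes "f \<in> elts (funs X (product I M))"
  shows "tuple_class I U M f \<in> elts (funs X (universe ult))"
  unfolding in_funs universe_ultraproduct
  using function_on_tuple_class[OF assms] app_tuple_class[OF assms] funs_app[OF assms] by auto

text \<open>One representative for each of finitely many classes, which \<open>finite_choice\<close>
  provides without further choice.\<close>

lemma tuple_class_representative:
  assumes n: "n \<in> elts omega" and x: "x \<in> elts (funs n (universe ult))"
  obtains f where "f \<in> elts (funs n (product I M))" "x = tuple_class I U M f"
proof -
  obtain f where f: "function_on n f"
    "\<And>k. k \<in> elts n \<Longrightarrow> app f k \<in> elts (product I M) \<and> app x k = ultra_class I U M (app f k)"
  proof (rule finite_choice[OF _ n, where R = "\<lambda>k g. g \<in> elts (product I M) \<and> app x k = ultra_class I U M g"])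
    show "fo (\<lambda>e. e 1 \<in> elts (product I M) \<and> app x (e 0) = ultra_class I U M (e 1))"
      by (intro fo_intros)
    show "\<exists>g. g \<in> elts (product I M) \<and> app x k = ultra_class I U M g" if "k \<in> elts n" for k
      using funs_app[OF x that] unfolding universe_ultraproduct by blast
  qed blast
  then have fn: "f \<in> elts (funs n (product I M))" by (simp add: in_funs)
  moreover have "x = tuple_class I U M f"
    by (rule function_eqI[of n])
      (use x f(2) in \<open>simp_all add: in_funs function_on_tuple_class[OF fn] app_tuple_class[OF fn]\<close>)
  ultimately show thesis by (rule that)
qed

text \<open>Equality of classes gives agreement almost everywhere for each coordinate separately. As
  the length is finite, the exceptional sets can be merged. This makes relations and functions of
  the ultraproduct independent of representatives.\<close>

lemma tuple_class_eqD:
  assumes n: "n \<in> elts omega" and f: "f \<in> elts (funs n (product I M))" and g: "g \<in> elts (funs n (product I M))"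
    and eq: "tuple_class I U M f = tuple_class I U M g"
  shows "often U (\<lambda>i. tuple_at f i = tuple_at g i)"
proof -
  have "often U (\<lambda>i. \<forall>k\<in>elts n. app (app f k) i = app (app g k) i)"
  proof (rule often_finite_all[OF U _ n])
    show "fo (\<lambda>e. app (app f (e 0)) (e 1) = app (app g (e 0)) (e 1))" by (intro fo_intros)
    show "often U (\<lambda>i. app (app f k) i = app (app g k) i)" if "k \<in> elts n" for k
      using eq app_tuple_class[OF f that, of U] app_tuple_class[OF g that, of U]
        ultra_class_eq[OF funs_app[OF f that] funs_app[OF g that]] by simp
  qed
  then show ?thesis
  proof (rule often_mono[OF U])
    show "tuple_at f i = tuple_at g i" if "\<forall>k\<in>elts n. app (app f k) i = app (app g k) i" for i
      by (rule function_eqI[OF function_on_tuple_at[OF f] function_on_tuple_at[OF g]])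
        (simp add: app_tuple_at[OF f] app_tuple_at[OF g] that)
  qed
qed

lemma elts_rel_int_ultraproduct:
  assumes R: "R \<in> elts (rel_syms L)"
  shows "elts (rel_int ult R) = {tuple_class I U M f | f. f \<in> elts (funs (rel_arity L R) (product I M)) \<and>
      often U (\<lambda>i. tuple_at f i \<in> elts (rel_int (app M i) R))}"
proof -
  have *: "vset {i \<in> elts I. tuple_at f i \<in> elts (rel_int (app M i) R)} \<in> elts U \<longleftrightarrow>
      often U (\<lambda>i. tuple_at f i \<in> elts (rel_int (app M i) R))" for f
    by (rule often_mem[OF U]) (intro fo_intros)
  let ?S = "\<lambda>R. {tuple_class I U M f | f. f \<in> elts (funs (rel_arity L R) (product I M)) \<and>
      vset {i \<in> elts I. tuple_at f i \<in> elts (rel_int (app M i) R)} \<in> elts U}"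
  have "ft (\<lambda>e. vset (?S (e 0)))" by (intro fo_intros)
  then have "rel_int ult R = vset (?S R)"
    unfolding rel_int_def ultraproduct_def vfst_vpair vsnd_vpair by (rule app_vlam[OF _ R])
  moreover have "is_set (?S R)"
  proof (rule is_set_subset)
    show "fo (\<lambda>e. e 0 \<in> ?S R)" by (intro fo_intros)
    show "?S R \<subseteq> elts (funs (rel_arity L R) (universe ult))"
      using tuple_class_in_funs by blast
  qed
  ultimately show ?thesis by (simp add: elts_vset *)
qed

text \<open>The interpretation asks for some suitable representative; by
  \<open>tuple_class_eqD\<close> every representative decides.\<close>

lemma tuple_class_in_rel_int:
  assumes R: "R \<in> elts (rel_syms L)" and f: "f \<in> elts (funs (rel_arity L R) (product I M))"
  shows "tuple_class I U M f \<in> elts (rel_int ult R) \<longleftrightarrow>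
    often U (\<lambda>i. tuple_at f i \<in> elts (rel_int (app M i) R))"
proof
  assume "tuple_class I U M f \<in> elts (rel_int ult R)"
  then obtain g where g: "g \<in> elts (funs (rel_arity L R) (product I M))"
    "tuple_class I U M f = tuple_class I U M g" "often U (\<lambda>i. tuple_at g i \<in> elts (rel_int (app M i) R))"
    unfolding elts_rel_int_ultraproduct[OF R] by blast
  show "often U (\<lambda>i. tuple_at f i \<in> elts (rel_int (app M i) R))"
    by (rule often_mono[OF U often_conj[OF U g(3) tuple_class_eqD[OF rel_arity_omega[OF L R] f g(1,2)]]]) simp
qed (use f elts_rel_int_ultraproduct[OF R] in blast)

definition fun_at :: "'v \<Rightarrow> 'v \<Rightarrow> 'v" where
  "fun_at F f = vlam I (\<lambda>i. app (fun_int (app M i) F) (tuple_at f i))"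

lemma fun_at:
  assumes F: "F \<in> elts (fun_syms L)" and f: "f \<in> elts (funs (fun_arity L F) (product I M))"
  shows app_fun_at: "i \<in> elts I \<Longrightarrow> app (fun_at F f) i = app (fun_int (app M i) F) (tuple_at f i)"
    and fun_at_product: "fun_at F f \<in> elts (product I M)"
proof -
  have ft: "ft (\<lambda>e. app (fun_int (app M (e 0)) F) (tuple_at f (e 0)))" by (intro fo_intros)
  show 1: "app (fun_at F f) i = app (fun_int (app M i) F) (tuple_at f i)" if "i \<in> elts I" for i
    unfolding fun_at_def by (rule app_vlam[OF ft that])
  have "function_on I (fun_at F f)" unfolding fun_at_def by (rule function_on_vlam[OF ft])
  then show "fun_at F f \<in> elts (product I M)"
    using 1 funs_app[OF fun_int_funs[OF family_structure F] tuple_at_in_funs[OF f]] by (simp add: in_product)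
qed

lemma fun_int_ultraproduct:
  assumes F: "F \<in> elts (fun_syms L)"
  shows fun_int_ultraproduct_in_funs:
      "fun_int ult F \<in> elts (funs (funs (fun_arity L F) (universe ult)) (universe ult))"
    and app_fun_int_ultraproduct: "f \<in> elts (funs (fun_arity L F) (product I M)) \<Longrightarrow>
      app (fun_int ult F) (tuple_class I U M f) = ultra_class I U M (fun_at F f)"
proof -
  let ?n = "fun_arity L F"
  let ?S = "\<lambda>F. {vpair (tuple_class I U M f) (ultra_class I U M (fun_at F f)) | f.
      f \<in> elts (funs (fun_arity L F) (product I M))}"
  have "ft (\<lambda>e. vset (?S (e 0)))" unfolding fun_at_def by (intro fo_intros)
  then have "fun_int ult F = vset (?S F)"
    unfolding fun_int_def ultraproduct_def vsnd_vpair fun_at_def by (rule app_vlam[OF _ F])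
  moreover have "is_set (?S F)"
  proof (rule is_set_subset)
    show "fo (\<lambda>e. e 0 \<in> ?S F)" unfolding fun_at_def by (intro fo_intros)
    show "?S F \<subseteq> elts (vtimes (funs ?n (universe ult)) (universe ult))"
      using tuple_class_in_funs fun_at_product[OF F] universe_ultraproduct by auto
  qed
  ultimately have el: "elts (fun_int ult F) = ?S F" by (simp add: elts_vset)
  have unique: "y = ultra_class I U M (fun_at F f)"
    if f: "f \<in> elts (funs ?n (product I M))" and y: "vpair (tuple_class I U M f) y \<in> elts (fun_int ult F)" for f y
  proof -
    obtain g where g: "g \<in> elts (funs ?n (product I M))" "tuple_class I U M f = tuple_class I U M g"
      "y = ultra_class I U M (fun_at F g)"
      using y unfolding el by auto
    have "often U (\<lambda>i. app (fun_at F f) i = app (fun_at F g) i)"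
      by (rule often_mono[OF U tuple_class_eqD[OF fun_arity_omega[OF L F] f g(1,2)]])
        (simp add: app_fun_at[OF F f] app_fun_at[OF F g(1)])
    then show ?thesis
      unfolding g(3) using ultra_class_eq[OF fun_at_product[OF F f] fun_at_product[OF F g(1)]] by simp
  qed
  have fn: "function_on (funs ?n (universe ult)) (fun_int ult F)"
    unfolding function_on_def
  proof (intro conjI ballI)
    show "\<exists>x\<in>elts (funs ?n (universe ult)). \<exists>y. p = vpair x y" if "p \<in> elts (fun_int ult F)" for p
      using that tuple_class_in_funs unfolding el by blast
    fix x assume "x \<in> elts (funs ?n (universe ult))"
    then obtain f where f: "f \<in> elts (funs ?n (product I M))" "x = tuple_class I U M f"
      by (rule tuple_class_representative[OF fun_arity_omega[OF L F]])
    show "\<exists>!y. vpair x y \<in> elts (fun_int ult F)"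
    proof (rule ex1I)
      show "vpair x (ultra_class I U M (fun_at F f)) \<in> elts (fun_int ult F)"
        unfolding el f(2) using f(1) by blast
    qed (use unique[OF f(1)] f(2) in blast)
  qed
  show app: "app (fun_int ult F) (tuple_class I U M f) = ultra_class I U M (fun_at F f)"
    if f: "f \<in> elts (funs ?n (product I M))" for f
    by (rule app_eqI[OF fn tuple_class_in_funs[OF f]]) (use f el in blast)
  show "fun_int ult F \<in> elts (funs (funs ?n (universe ult)) (universe ult))"
    unfolding in_funs
  proof (intro conjI fn ballI)
    fix x assume "x \<in> elts (funs ?n (universe ult))"
    then obtain f where f: "f \<in> elts (funs ?n (product I M))" "x = tuple_class I U M f"
      by (rule tuple_class_representative[OF fun_arity_omega[OF L F]])
    then show "app (fun_int ult F) x \<in> elts (universe ult)"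
      using app[OF f(1)] fun_at_product[OF F f(1)] universe_ultraproduct by simp
  qed
qed

lemma is_structure_ultraproduct:
  assumes "elts (product I M) \<noteq> {}" shows "is_structure L ult"
  unfolding is_structure_def
proof (intro exI conjI ballI)
  show "ult = vpair (universe ult) (vpair (vfst (vsnd ult)) (vsnd (vsnd ult)))"
    unfolding universe_def by (simp add: ultraproduct_def)
  show "elts (universe ult) \<noteq> {}" using assms by (simp add: universe_ultraproduct)
  show "function_on (rel_syms L) (vfst (vsnd ult))"
    unfolding ultraproduct_def vfst_vpair vsnd_vpair by (rule function_on_vlam) (intro fo_intros)
  show "function_on (fun_syms L) (vsnd (vsnd ult))"
    unfolding ultraproduct_def vfst_vpair vsnd_vpair by (rule function_on_vlam) (intro fo_intros)
  show "elts (app (vfst (vsnd ult)) R) \<subseteq> elts (funs (rel_arity L R) (universe ult))"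
    if "R \<in> elts (rel_syms L)" for R
    using elts_rel_int_ultraproduct[OF that, unfolded rel_int_def] by (auto intro: tuple_class_in_funs)
  show "app (vsnd (vsnd ult)) F \<in> elts (funs (funs (fun_arity L F) (universe ult)) (universe ult))"
    if "F \<in> elts (fun_syms L)" for F
    using fun_int_ultraproduct_in_funs[OF that, unfolded fun_int_def] .
qed

section \<open>Evaluation of terms and Los's theorem\<close>

context
  assumes nonempty: "elts (product I M) \<noteq> {}"
begin

lemmas ult_structure = is_structure_ultraproduct[OF nonempty]

definition term_at :: "'v \<Rightarrow> 'v \<Rightarrow> 'v" where
  "term_at f t = vlam I (\<lambda>i. app (term_eval L (app M i) (tuple_at f i)) t)"

lemma ft_term_at: "ft T \<Longrightarrow> ft (\<lambda>e. term_at f (T e))"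
  by (rule ft_fun1[where G = "term_at f"], unfold term_at_def) (intro fo_intros ft_term_eval[OF L])

lemma term_at:
  assumes f: "f \<in> elts (funs X (product I M))" and t: "t \<in> elts (terms_in L X)"
  shows app_term_at: "i \<in> elts I \<Longrightarrow> app (term_at f t) i = app (term_eval L (app M i) (tuple_at f i)) t"
    and term_at_product: "term_at f t \<in> elts (product I M)"
proof -
  have ft: "ft (\<lambda>e. app (term_eval L (app M (e 0)) (tuple_at f (e 0))) t)"
    by (intro fo_intros ft_term_eval[OF L])
  show 1: "app (term_at f t) i = app (term_eval L (app M i) (tuple_at f i)) t" if "i \<in> elts I" for i
    unfolding term_at_def by (rule app_vlam[OF ft that])
  have "function_on I (term_at f t)" unfolding term_at_def by (rule function_on_vlam[OF ft])
  then show "term_at f t \<in> elts (product I M)"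
    using 1 funs_app[OF term_eval_in_funs[OF L family_structure tuple_at_in_funs[OF f]] t]
    by (simp add: in_product)
qed

text \<open>A tuple of terms becomes the tuple of the elements of the product that they denote
  coordinatewise. To this tuple the clauses for relations and functions of the ultraproduct
  apply.\<close>

lemma terms_at:
  assumes f: "f \<in> elts (funs X (product I M))" and u: "u \<in> elts (funs n (terms_in L X))"
  defines "g \<equiv> vlam n (\<lambda>j. term_at f (app u j))"
  shows terms_at_in_funs: "g \<in> elts (funs n (product I M))"
    and app_terms_at: "j \<in> elts n \<Longrightarrow> app g j = term_at f (app u j)"
    and tuple_at_terms_at: "i \<in> elts I \<Longrightarrow> tuple_at g i = vcomp (term_eval L (app M i) (tuple_at f i)) u"
proof -
  have ft: "ft (\<lambda>e. term_at f (app u (e 0)))" by (intro ft_term_at fo_intros)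
  show app: "app g j = term_at f (app u j)" if "j \<in> elts n" for j
    unfolding g_def by (rule app_vlam[OF ft that])
  show g: "g \<in> elts (funs n (product I M))"
    unfolding in_funs using function_on_vlam[OF ft, of n] app term_at_product[OF f funs_app[OF u]]
    by (simp add: g_def)
  show "tuple_at g i = vcomp (term_eval L (app M i) (tuple_at f i)) u" if "i \<in> elts I"
  proof (rule function_eqI[OF function_on_tuple_at[OF g]])
    show "function_on n (vcomp (term_eval L (app M i) (tuple_at f i)) u)"
      using function_on_vcomp[of u] by (simp add: funs_vdom[OF u])
  qed (simp add: app_tuple_at[OF g] app app_term_at[OF f funs_app[OF u] that] app_vcomp funs_vdom[OF u])
qed

text \<open>Los's theorem for terms. It needs no choice, because the values in the factors are
  uniquely determined and so form an element of the product by themselves.\<close>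

lemma term_eval_ultraproduct:
  assumes f: "f \<in> elts (funs X (product I M))" and t: "t \<in> elts (terms_in L X)"
  shows "app (term_eval L ult (tuple_class I U M f)) t = ultra_class I U M (term_at f t)"
proof (rule term_induct[OF L t])
  let ?te = "term_eval L ult (tuple_class I U M f)"
  note te = term_eval[OF L ult_structure tuple_class_in_funs[OF f]]
  show "fo (\<lambda>e. app ?te (e 0) = ultra_class I U M (term_at f (e 0)))"
    by (intro fo_intros ft_term_at)
  show "app ?te (Var_code k) = ultra_class I U M (term_at f (Var_code k))" if k: "k \<in> elts X" for k
  proof -
    have "term_at f (Var_code k) = app f k"
    proof (rule function_eqI[of I])
      fix i assume i: "i \<in> elts I"
      show "app (term_at f (Var_code k)) i = app (app f k) i"
        using app_term_at[OF f Var_in_terms[OF L k] i]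
          term_eval_Var[OF L family_structure[OF i] tuple_at_in_funs[OF f i] k] app_tuple_at[OF f k] by simp
    qed (use term_at_product[OF f Var_in_terms[OF L k]] funs_app[OF f k] in \<open>simp_all add: in_product\<close>)
    then show ?thesis using te(2)[OF k] app_tuple_class[OF f k] by simp
  qed
  fix F u assume F: "F \<in> elts (fun_syms L)" and u: "u \<in> elts (funs (fun_arity L F) (terms_in L X))"
    and IH: "\<And>j. j \<in> elts (fun_arity L F) \<Longrightarrow> app ?te (app u j) = ultra_class I U M (term_at f (app u j))"
  define g where "g = vlam (fun_arity L F) (\<lambda>j. term_at f (app u j))"
  note g = terms_at[OF f u, folded g_def]
  have Fu: "Fun_code F u \<in> elts (terms_in L X)" by (rule Fun_in_terms[OF L F u])
  have "vcomp ?te u = tuple_class I U M g"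
  proof (rule function_eqI[OF _ function_on_tuple_class[OF g(1)]])
    show "function_on (fun_arity L F) (vcomp ?te u)"
      using function_on_vcomp[of u] by (simp add: funs_vdom[OF u])
  qed (simp add: app_vcomp funs_vdom[OF u] app_tuple_class[OF g(1)] g(2) IH)
  then have "app ?te (Fun_code F u) = ultra_class I U M (fun_at F g)"
    using te(3)[OF F u] app_fun_int_ultraproduct[OF F g(1)] by simp
  also have "fun_at F g = term_at f (Fun_code F u)"
  proof (rule function_eqI[of I])
    fix i assume i: "i \<in> elts I"
    show "app (fun_at F g) i = app (term_at f (Fun_code F u)) i"
      using app_fun_at[OF F g(1) i] app_term_at[OF f Fu i] g(3)[OF i]
        term_eval_Fun[OF L family_structure[OF i] tuple_at_in_funs[OF f i] F u] by simp
  qed (use fun_at_product[OF F g(1)] term_at_product[OF f Fu] in \<open>simp_all add: in_product\<close>)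
  finally show "app ?te (Fun_code F u) = ultra_class I U M (term_at f (Fun_code F u))" .
qed

lemma vcomp_term_eval_ultraproduct:
  assumes f: "f \<in> elts (funs X (product I M))" and u: "u \<in> elts (funs n (terms_in L X))"
  shows "vcomp (term_eval L ult (tuple_class I U M f)) u = tuple_class I U M (vlam n (\<lambda>j. term_at f (app u j)))"
proof (rule function_eqI[OF _ function_on_tuple_class[OF terms_at_in_funs[OF f u]]])
  show "function_on n (vcomp (term_eval L ult (tuple_class I U M f)) u)"
    using function_on_vcomp[of u] by (simp add: funs_vdom[OF u])
qed (simp add: app_vcomp funs_vdom[OF u] app_tuple_class[OF terms_at_in_funs[OF f u]]
    app_terms_at[OF f u] term_eval_ultraproduct[OF f funs_app[OF u]])

text \<open>The only case that needs choice: witnesses in almost all factors have to be assembled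
  into one element of the product.\<close>

lemma Los_step_Ex:
  assumes AC: ultra_choice and X: "elts X \<subseteq> elts omega" and k: "k \<in> elts omega"
    and \<phi>: "\<phi> \<in> elts (formulas_in L (vset (insert k (elts X))))"
    and IH: "\<And>f. f \<in> elts (funs (vset (insert k (elts X))) (product I M)) \<Longrightarrow>
      satisfies L ult \<phi> (tuple_class I U M f) \<longleftrightarrow> often U (\<lambda>i. satisfies L (app M i) \<phi> (tuple_at f i))"
    and f: "f \<in> elts (funs X (product I M))"
  shows "satisfies L ult (Ex_code k \<phi>) (tuple_class I U M f) \<longleftrightarrow>
    often U (\<lambda>i. satisfies L (app M i) (Ex_code k \<phi>) (tuple_at f i))"
proof -
  let ?sat = "\<lambda>i a. satisfies L (app M i) \<phi> (vupd (tuple_at f i) k a)"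
  have "satisfies L ult (Ex_code k \<phi>) (tuple_class I U M f) \<longleftrightarrow>
      (\<exists>g\<in>elts (product I M). satisfies L ult \<phi> (vupd (tuple_class I U M f) k (ultra_class I U M g)))"
    unfolding satisfies_Ex[OF L ult_structure X tuple_class_in_funs[OF f] k \<phi>] universe_ultraproduct by blast
  also have "\<dots> \<longleftrightarrow> (\<exists>g\<in>elts (product I M). often U (\<lambda>i. ?sat i (app g i)))"
  proof (intro bex_cong refl)
    fix g assume g: "g \<in> elts (product I M)"
    show "satisfies L ult \<phi> (vupd (tuple_class I U M f) k (ultra_class I U M g)) \<longleftrightarrow>
        often U (\<lambda>i. ?sat i (app g i))"
      using IH[OF vupd_in_funs[OF f g, of k]] by (simp add: tuple_class_vupd[OF f g] tuple_at_vupd[OF f g])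
  qed
  also have "\<dots> \<longleftrightarrow> often U (\<lambda>i. \<exists>a\<in>elts (universe (app M i)). ?sat i a)"
  proof
    assume "\<exists>g\<in>elts (product I M). often U (\<lambda>i. ?sat i (app g i))"
    then obtain g where g: "g \<in> elts (product I M)" "often U (\<lambda>i. ?sat i (app g i))" ..
    show "often U (\<lambda>i. \<exists>a\<in>elts (universe (app M i)). ?sat i a)"
      by (rule often_mono[OF U g(2)]) (use product_app[OF g(1)] in blast)
  next
    assume some: "often U (\<lambda>i. \<exists>a\<in>elts (universe (app M i)). ?sat i a)"
    \<comment> \<open>At indices without a witness the whole universe is offered, because
      \<open>ultra_choice\<close> demands that all sets be nonempty.\<close>
    define S where "S = (\<lambda>i. {a \<in> elts (universe (app M i)).
        ?sat i a \<or> \<not> (\<exists>b\<in>elts (universe (app M i)). ?sat i b)})"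
    have elS: "elts (vset (S i)) = S i" for i
      unfolding S_def by (rule elts_vset[OF is_set_separation]) (intro fo_intros fo_satisfies[OF L])
    have ftS: "ft (\<lambda>e. vset (S (e 0)))"
      unfolding S_def by (intro fo_intros fo_satisfies[OF L])
    have "elts (app (vlam I (\<lambda>i. vset (S i))) i) \<noteq> {}" if "i \<in> elts I" for i
      using universe_nonempty[OF family_structure[OF that]]
      unfolding app_vlam[OF ftS that] elS unfolding S_def by blast
    then obtain c where c: "often U (\<lambda>i. app c i \<in> elts (app (vlam I (\<lambda>i. vset (S i))) i))"
      using AC U function_on_vlam[OF ftS, of I] unfolding ultra_choice_def by blast
    obtain f0 where f0: "f0 \<in> elts (product I M)" using nonempty by blast
    \<comment> \<open>The choice function is controlled almost everywhere only. A fixed element of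
      the product supplies the other values, so that \<open>g\<close> belongs to the
      product.\<close>
    define g where "g = vlam I (\<lambda>i. if app c i \<in> elts (universe (app M i)) then app c i else app f0 i)"
    have ftg: "ft (\<lambda>e. if app c (e 0) \<in> elts (universe (app M (e 0))) then app c (e 0) else app f0 (e 0))"
      by (intro fo_intros)
    have g: "g \<in> elts (product I M)"
      unfolding in_product g_def using vlam[OF ftg] product_app[OF f0] by simp
    have "often U (\<lambda>i. ?sat i (app g i))"
    proof (rule often_mono[OF U often_conj[OF U c some]])
      fix i assume i: "i \<in> elts I" and *: "app c i \<in> elts (app (vlam I (\<lambda>i. vset (S i))) i) \<and>
        (\<exists>a\<in>elts (universe (app M i)). ?sat i a)"
      then have "app c i \<in> elts (universe (app M i))" "?sat i (app c i)"
        unfolding app_vlam[OF ftS i] elS unfolding S_def by blast+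
      then show "?sat i (app g i)" unfolding g_def by (simp add: app_vlam[OF ftg i])
    qed
    then show "\<exists>g\<in>elts (product I M). often U (\<lambda>i. ?sat i (app g i))" using g by blast
  qed
  also have "\<dots> \<longleftrightarrow> often U (\<lambda>i. satisfies L (app M i) (Ex_code k \<phi>) (tuple_at f i))"
    by (rule often_cong[OF U]) (simp add: satisfies_Ex[OF L family_structure X tuple_at_in_funs[OF f] k \<phi>])
  finally show ?thesis .
qed

text \<open>Stated for every index set \<open>X\<close>, not only for natural numbers, because
  adding a bound variable to a natural number need not give a natural number.\<close>

lemma Los_ultra_choice:
  assumes AC: ultra_choice and \<phi>: "\<phi> \<in> elts (formulas_in L X)" and f: "f \<in> elts (funs X (product I M))"
  shows "satisfies L ult \<phi> (tuple_class I U M f) \<longleftrightarrow> often U (\<lambda>i. satisfies L (app M i) \<phi> (tuple_at f i))"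
proof -
  let ?Q = "\<lambda>\<phi> f. satisfies L ult \<phi> (tuple_class I U M f) \<longleftrightarrow>
    often U (\<lambda>i. satisfies L (app M i) \<phi> (tuple_at f i))"
  let ?P = "\<lambda>X \<phi>. \<forall>f\<in>elts (funs X (product I M)). ?Q \<phi> f"
  have "?P X \<phi>"
  proof (rule formula_induct[OF L \<phi>, where P = ?P])
    show "fo (\<lambda>e. ?P (e 0) (e 1))"
      unfolding often_def by (intro fo_intros fo_satisfies[OF L])
  next
    fix X t u assume X: "elts X \<subseteq> elts omega" and tu: "t \<in> elts (terms_in L X)" "u \<in> elts (terms_in L X)"
    show "?P X (Eq_code t u)"
    proof
      fix f assume f: "f \<in> elts (funs X (product I M))"
      have "satisfies L ult (Eq_code t u) (tuple_class I U M f) \<longleftrightarrow>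
          often U (\<lambda>i. app (term_at f t) i = app (term_at f u) i)"
        by (simp add: satisfies_Eq[OF L ult_structure X tuple_class_in_funs[OF f] tu]
            term_eval_ultraproduct[OF f] tu ultra_class_eq term_at_product[OF f])
      also have "\<dots> \<longleftrightarrow> often U (\<lambda>i. satisfies L (app M i) (Eq_code t u) (tuple_at f i))"
        by (rule often_cong[OF U])
          (simp add: app_term_at[OF f] tu satisfies_Eq[OF L family_structure X tuple_at_in_funs[OF f] tu])
      finally show "?Q (Eq_code t u) f" .
    qed
  next
    fix X R u assume X: "elts X \<subseteq> elts omega" and R: "R \<in> elts (rel_syms L)"
      and u: "u \<in> elts (funs (rel_arity L R) (terms_in L X))"
    show "?P X (Rel_code R u)"
    proof
      fix f assume f: "f \<in> elts (funs X (product I M))"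
      note g = terms_at[OF f u]
      have "satisfies L ult (Rel_code R u) (tuple_class I U M f) \<longleftrightarrow>
          often U (\<lambda>i. tuple_at (vlam (rel_arity L R) (\<lambda>j. term_at f (app u j))) i \<in> elts (rel_int (app M i) R))"
        by (simp add: satisfies_Rel[OF L ult_structure X tuple_class_in_funs[OF f] R u]
            vcomp_term_eval_ultraproduct[OF f u] tuple_class_in_rel_int[OF R g(1)])
      also have "\<dots> \<longleftrightarrow> often U (\<lambda>i. satisfies L (app M i) (Rel_code R u) (tuple_at f i))"
        by (rule often_cong[OF U])
          (simp add: g(3) satisfies_Rel[OF L family_structure X tuple_at_in_funs[OF f] R u])
      finally show "?Q (Rel_code R u) f" .
    qed
  next
    fix X \<phi> assume X: "elts X \<subseteq> elts omega" and \<phi>: "\<phi> \<in> elts (formulas_in L X)"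
      and IH: "?P X \<phi>"
    show "?P X (Neg_code \<phi>)"
    proof
      fix f assume f: "f \<in> elts (funs X (product I M))"
      have "satisfies L ult (Neg_code \<phi>) (tuple_class I U M f) \<longleftrightarrow>
          often U (\<lambda>i. \<not> satisfies L (app M i) \<phi> (tuple_at f i))"
        unfolding satisfies_Neg[OF L ult_structure X tuple_class_in_funs[OF f] \<phi>] IH[rule_format, OF f]
        by (rule often_not[OF U, symmetric]) (intro fo_intros fo_satisfies[OF L])
      also have "\<dots> \<longleftrightarrow> often U (\<lambda>i. satisfies L (app M i) (Neg_code \<phi>) (tuple_at f i))"
        by (rule often_cong[OF U]) (simp add: satisfies_Neg[OF L family_structure X tuple_at_in_funs[OF f] \<phi>])
      finally show "?Q (Neg_code \<phi>) f" .
    qed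
  next
    fix X \<phi> \<psi> assume X: "elts X \<subseteq> elts omega" and \<phi>: "\<phi> \<in> elts (formulas_in L X)" and \<psi>: "\<psi> \<in> elts (formulas_in L X)"
      and IH: "?P X \<phi>"
      and IH': "?P X \<psi>"
    show "?P X (Conj_code \<phi> \<psi>)"
    proof
      fix f assume f: "f \<in> elts (funs X (product I M))"
      show "?Q (Conj_code \<phi> \<psi>) f"
        unfolding satisfies_Conj[OF L ult_structure X tuple_class_in_funs[OF f] \<phi> \<psi>]
          IH[rule_format, OF f] IH'[rule_format, OF f] often_conj_iff[OF U, symmetric]
        by (rule often_cong[OF U]) (simp add: satisfies_Conj[OF L family_structure X tuple_at_in_funs[OF f] \<phi> \<psi>])
    qed
  qed (use Los_step_Ex[OF AC] in blast)
  then show ?thesis using f by blast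
qed

end

end

theorem Los_if_ultra_choice:
  assumes ultra_choice shows Los_theorem
  unfolding Los_theorem_def
proof (intro allI impI ballI; elim conjE)
  fix L I U M n \<phi> f
  assume L: "is_language L" and U: "ultrafilter I U" and M: "structure_family L I M"
    and ne: "elts (product I M) \<noteq> {}" and \<phi>: "\<phi> \<in> elts (formulas_in L n)"
    and f: "f \<in> elts (funs n (product I M))"
  show "satisfies L (ultraproduct L I U M) \<phi> (tuple_class I U M f) \<longleftrightarrow>
      vset {i \<in> elts I. satisfies L (app M i) \<phi> (tuple_at f i)} \<in> elts U"
    unfolding Los_ultra_choice[OF L U M ne assms \<phi> f]
    by (rule often_mem[OF U, symmetric]) (intro fo_intros fo_satisfies[OF L])
qed

section \<open>Consequences of Los's theorem\<close>

lemma Los_sentence: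
  assumes Los_theorem "is_language L" "ultrafilter I U" "structure_family L I M"
    "elts (product I M) \<noteq> {}" "\<phi> \<in> elts (formulas_in L (vset {}))"
  shows "satisfies L (ultraproduct L I U M) \<phi> (vset {}) \<longleftrightarrow>
    often U (\<lambda>i. satisfies L (app M i) \<phi> (vset {}))"
proof -
  have f: "vset {} \<in> elts (funs (vset {}) (product I M))" by (simp add: funs_empty)
  have "tuple_class I U M (vset {}) = vset {}" "tuple_at (vset {}) i = vset {}" for i
    using function_on_tuple_class[OF f, of U] function_on_tuple_at[OF f, of i]
    by (simp_all add: function_on_empty_iff)
  moreover have "satisfies L (ultraproduct L I U M) \<phi> (tuple_class I U M (vset {})) \<longleftrightarrow>
      vset {i \<in> elts I. satisfies L (app M i) \<phi> (tuple_at (vset {}) i)} \<in> elts U"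
    using assms(1)[unfolded Los_theorem_def] assms(2-6) f zero_omega by blast
  moreover have "vset {i \<in> elts I. satisfies L (app M i) \<phi> (vset {})} \<in> elts U \<longleftrightarrow>
      often U (\<lambda>i. satisfies L (app M i) \<phi> (vset {}))"
    by (rule often_mem[OF assms(3)]) (intro fo_intros fo_satisfies[OF assms(2)])
  ultimately show ?thesis by simp
qed

lemma constant_family:
  assumes "is_structure L M"
  shows "structure_family L I (vlam I (\<lambda>_. M))"
    and app_constant_family: "i \<in> elts I \<Longrightarrow> app (vlam I (\<lambda>_. M)) i = M"
    and constant_product_nonempty: "elts (product I (vlam I (\<lambda>_. M))) \<noteq> {}"
proof -
  have M: "function_on I (vlam I (\<lambda>_. M))" "\<And>i. i \<in> elts I \<Longrightarrow> app (vlam I (\<lambda>_. M)) i = M" for M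
    using vlam[OF ft_const] by blast+
  show "structure_family L I (vlam I (\<lambda>_. M))"
    unfolding structure_family_def using M assms by simp
  show "i \<in> elts I \<Longrightarrow> app (vlam I (\<lambda>_. M)) i = M" by (rule M(2))
  obtain a where "a \<in> elts (universe M)" using universe_nonempty[OF assms] by blast
  then have "vlam I (\<lambda>_. a) \<in> elts (product I (vlam I (\<lambda>_. M)))"
    using M by (simp add: in_product)
  then show "elts (product I (vlam I (\<lambda>_. M))) \<noteq> {}" by blast
qed

lemma Los_ultrapower_sentence:
  assumes Los_theorem and L: "is_language L" and U: "ultrafilter I U" and M: "is_structure L M"
    and \<phi>: "\<phi> \<in> elts (formulas_in L (vset {}))"
  shows "satisfies L (ultrapower L I U M) \<phi> (vset {}) \<longleftrightarrow> satisfies L M \<phi> (vset {})"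
proof -
  have "satisfies L (ultrapower L I U M) \<phi> (vset {}) \<longleftrightarrow>
      often U (\<lambda>i. satisfies L (app (vlam I (\<lambda>_. M)) i) \<phi> (vset {}))"
    unfolding ultrapower_def
    by (rule Los_sentence[OF assms(1) L U constant_family(1,3)[OF M] \<phi>])
  also have "\<dots> \<longleftrightarrow> often U (\<lambda>i. satisfies L M \<phi> (vset {}))"
    by (rule often_cong[OF U]) (simp add: app_constant_family[OF M])
  finally show ?thesis by (simp add: often_const[OF U])
qed

lemma Los_imp_ultrapowers_Sigma2_equivalent:
  "Los_theorem \<Longrightarrow> ultrapowers_Sigma2_equivalent"
  unfolding ultrapowers_Sigma2_equivalent_def Sigma_equivalent_def
  by (simp add: Los_ultrapower_sentence)

lemma Los_imp_isomorphic_factors_Sigma1_equivalent: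
  assumes Los_theorem shows isomorphic_factors_Sigma1_equivalent
  unfolding isomorphic_factors_Sigma1_equivalent_def Sigma_equivalent_def
proof (intro allI impI ballI; elim conjE IntE)
  fix L I U M i \<phi>
  assume L: "is_language L" and M: "structure_family L I M" and U: "ultrafilter I U"
    and iso: "\<forall>i\<in>elts I. \<forall>j\<in>elts I. isomorphic L (app M i) (app M j)"
    and ne: "elts (product I M) \<noteq> {}" and i: "i \<in> elts I" and \<phi>: "\<phi> \<in> elts (formulas_in L (vset {}))"
  have "often U (\<lambda>j. satisfies L (app M j) \<phi> (vset {})) \<longleftrightarrow> often U (\<lambda>j. satisfies L (app M i) \<phi> (vset {}))"
    by (rule often_cong[OF U])
      (use i iso family_structure[OF L U M] in \<open>intro isomorphic_sentences[OF L _ _ _ \<phi>]; blast\<close>)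
  then show "satisfies L (ultraproduct L I U M) \<phi> (vset {}) \<longleftrightarrow> satisfies L (app M i) \<phi> (vset {})"
    by (simp add: Los_sentence[OF assms L U M ne \<phi>] often_const[OF U])
qed

lemma elementary_embedding_sentences:
  assumes "elementary_embedding L M N j" "\<phi> \<in> elts (formulas_in L (vset {}))"
  shows "satisfies L M \<phi> (vset {}) \<longleftrightarrow> satisfies L N \<phi> (vset {})"
proof -
  have "vcomp j (vset {}) = vset {}"
    using function_on_vcomp[of "vset {}" j] vdom_function_on[OF function_on_empty]
    by (simp add: function_on_empty_iff)
  moreover have "satisfies L M \<phi> (vset {}) \<longleftrightarrow> satisfies L N \<phi> (vcomp j (vset {}))"
    using assms zero_omega funs_empty[of "universe M"] unfolding elementary_embedding_def by blast
  ultimately show ?thesis by simp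
qed

lemma Los_imp_biembeddable_ultrapowers_Sigma2_equivalent:
  "Los_theorem \<Longrightarrow> biembeddable_ultrapowers_Sigma2_equivalent"
  unfolding biembeddable_ultrapowers_Sigma2_equivalent_def Sigma_equivalent_def
  using elementary_embedding_sentences by (simp add: Los_ultrapower_sentence) blast

lemma Los_imp_isomorphic_families_Sigma1_equivalent:
  assumes Los_theorem shows isomorphic_families_Sigma1_equivalent
  unfolding isomorphic_families_Sigma1_equivalent_def Sigma_equivalent_def
proof (intro allI impI ballI; elim conjE IntE)
  fix L I U M N \<phi>
  assume L: "is_language L" and M: "structure_family L I M" and N: "structure_family L I N"
    and U: "ultrafilter I U" and iso: "\<forall>i\<in>elts I. isomorphic L (app M i) (app N i)"
    and ne: "elts (product I M) \<noteq> {}" "elts (product I N) \<noteq> {}"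
    and \<phi>: "\<phi> \<in> elts (formulas_in L (vset {}))"
  show "satisfies L (ultraproduct L I U M) \<phi> (vset {}) \<longleftrightarrow> satisfies L (ultraproduct L I U N) \<phi> (vset {})"
    unfolding Los_sentence[OF assms L U M ne(1) \<phi>] Los_sentence[OF assms L U N ne(2) \<phi>]
    by (rule often_cong[OF U])
      (use iso family_structure[OF L U M] family_structure[OF L U N] in \<open>intro isomorphic_sentences[OF L _ _ _ \<phi>]; blast\<close>)
qed

text \<open>Isomorphisms chosen for almost all indices act coordinatewise. The induced map on
  classes is well defined and injective because the chosen maps are injective almost
  everywhere.\<close>

lemma isomorphic_ultraproducts:
  assumes AC: ultra_choice and L: "is_language L" and M: "structure_family L I M"
    and N: "structure_family L I N" and U: "ultrafilter I U"
    and iso: "\<And>i. i \<in> elts I \<Longrightarrow> isomorphic L (app M i) (app N i)"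
    and ne: "elts (product I M) \<noteq> {}" "elts (product I N) \<noteq> {}"
  shows "isomorphic L (ultraproduct L I U M) (ultraproduct L I U N)"
proof -
  define S where "S = (\<lambda>i. {h \<in> elts (funs (universe (app M i)) (universe (app N i))).
    isomorphism L (app M i) (app N i) h})"
  have elS: "elts (vset (S i)) = S i" for i
    unfolding S_def by (rule elts_vset[OF is_set_separation]) (intro fo_intros)
  have ftS: "ft (\<lambda>e. vset (S (e 0)))"
    unfolding S_def by (intro fo_intros)
  have "elts (app (vlam I (\<lambda>i. vset (S i))) i) \<noteq> {}" if i: "i \<in> elts I" for i
  proof -
    obtain h where "isomorphism L (app M i) (app N i) h" using iso[OF i] isomorphic_iff by blast
    then have "h \<in> S i" unfolding S_def by (simp add: isomorphism_def)
    then show ?thesis unfolding app_vlam[OF ftS i] elS by blast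
  qed
  then obtain c where c: "often U (\<lambda>i. app c i \<in> elts (app (vlam I (\<lambda>i. vset (S i))) i))"
    using AC U function_on_vlam[OF ftS, of I] unfolding ultra_choice_def by blast
  define good where "good = (\<lambda>i. isomorphism L (app M i) (app N i) (app c i))"
  have good: "often U good"
  proof (rule often_mono[OF U c])
    show "good i" if "i \<in> elts I" "app c i \<in> elts (app (vlam I (\<lambda>i. vset (S i))) i)" for i
      using that(2) unfolding app_vlam[OF ftS that(1)] elS by (simp add: S_def good_def)
  qed
  have fo_good: "ft T \<Longrightarrow> fo (\<lambda>e. good (T e))" for T
    unfolding good_def by (intro fo_intros)
  have good_funs: "app c i \<in> elts (funs (universe (app M i)) (universe (app N i)))"
    and good_inj: "inj_on (app (app c i)) (elts (universe (app M i)))"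
    and good_surj: "app (app c i) ` elts (universe (app M i)) = elts (universe (app N i))"
    and good_rel: "\<And>R x. R \<in> elts (rel_syms L) \<Longrightarrow> x \<in> elts (funs (rel_arity L R) (universe (app M i))) \<Longrightarrow>
        x \<in> elts (rel_int (app M i) R) \<longleftrightarrow> vcomp (app c i) x \<in> elts (rel_int (app N i) R)"
    and good_fun: "\<And>F x. F \<in> elts (fun_syms L) \<Longrightarrow> x \<in> elts (funs (fun_arity L F) (universe (app M i))) \<Longrightarrow>
        app (app c i) (app (fun_int (app M i) F) x) = app (fun_int (app N i) F) (vcomp (app c i) x)"
    if "good i" for i
    using that unfolding good_def isomorphism_def by blast+
  obtain f0 g0 where f0: "f0 \<in> elts (product I M)" and g0: "g0 \<in> elts (product I N)" using ne by blast
  \<comment> \<open>Outside the good indices the values of the fixed element \<open>g0\<close> are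
    taken, which keeps the image in the second product and does not influence its class.\<close>
  define push where "push = (\<lambda>f. vlam I (\<lambda>i. if good i then app (app c i) (app f i) else app g0 i))"
  have ft_push: "ft T \<Longrightarrow> ft (\<lambda>e. push (T e))" for T
    by (rule ft_fun1[where G = push], unfold push_def) (intro fo_intros fo_good)
  have ft_in: "ft (\<lambda>e. if good (e 0) then app (app c (e 0)) (app f (e 0)) else app g0 (e 0))" for f
    by (intro fo_intros fo_good)
  have push: "app (push f) i = (if good i then app (app c i) (app f i) else app g0 i)" if "i \<in> elts I" for f i
    unfolding push_def by (rule app_vlam[OF ft_in that])
  have push_product: "push f \<in> elts (product I N)" if f: "f \<in> elts (product I M)" for f
    unfolding in_product
  proof (intro conjI ballI)
    show "function_on I (push f)" unfolding push_def by (rule function_on_vlam[OF ft_in])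
    show "app (push f) i \<in> elts (universe (app N i))" if "i \<in> elts I" for i
      using push[OF that] product_app[OF f that] product_app[OF g0 that] funs_app[OF good_funs] by simp
  qed
  let ?cM = "ultra_class I U M" and ?cN = "ultra_class I U N"
  let ?uM = "ultraproduct L I U M" and ?uN = "ultraproduct L I U N"
  note eqM = ultra_class_eq[OF L U M] and eqN = ultra_class_eq[OF L U N]
    and universe_ultraproduct = universe_ultraproduct[OF L U M] universe_ultraproduct[OF L U N]
  have push_eq: "?cN (push f) = ?cN (push f') \<longleftrightarrow> ?cM f = ?cM f'"
    if f: "f \<in> elts (product I M)" and f': "f' \<in> elts (product I M)" for f f'
    unfolding eqM[OF f f'] eqN[OF push_product[OF f] push_product[OF f']]
  proof
    assume "often U (\<lambda>i. app (push f) i = app (push f') i)"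
    then show "often U (\<lambda>i. app f i = app f' i)"
    proof (rule often_mono[OF U often_conj[OF U good]])
      fix i assume i: "i \<in> elts I" and *: "good i \<and> app (push f) i = app (push f') i"
      then have "app (app c i) (app f i) = app (app c i) (app f' i)" by (auto simp: push[OF i])
      then show "app f i = app f' i"
        using inj_onD[OF good_inj _ product_app[OF f i] product_app[OF f' i]] * by blast
    qed
  next
    assume "often U (\<lambda>i. app f i = app f' i)"
    then show "often U (\<lambda>i. app (push f) i = app (push f') i)"
      by (rule often_mono[OF U]) (simp add: push)
  qed
  \<comment> \<open>The image of a class is described through an arbitrary representative;
    \<open>push_eq\<close> shows that the description is unique, so no representatives are
    chosen.\<close>
  obtain H where H: "function_on (universe ?uM) H"
    "\<And>x. x \<in> elts (universe ?uM) \<Longrightarrow> \<exists>f\<in>elts (product I M). x = ?cM f \<and> app H x = ?cN (push f)"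
  proof (rule function_by_description[of "\<lambda>x y. \<exists>f\<in>elts (product I M). x = ?cM f \<and> y = ?cN (push f)" "universe ?uM"])
    show "fo (\<lambda>e. \<exists>f\<in>elts (product I M). e 0 = ?cM f \<and> e 1 = ?cN (push f))"
      by (intro fo_intros ft_push)
    show "\<exists>!y. \<exists>f\<in>elts (product I M). x = ?cM f \<and> y = ?cN (push f)" if x: "x \<in> elts (universe ?uM)" for x
    proof -
      obtain f where f: "f \<in> elts (product I M)" "x = ?cM f"
        using x unfolding universe_ultraproduct by blast
      show ?thesis
      proof (rule ex1I[of _ "?cN (push f)"])
        show "\<exists>f'\<in>elts (product I M). x = ?cM f' \<and> ?cN (push f) = ?cN (push f')" using f by blast
        show "y = ?cN (push f)" if "\<exists>f'\<in>elts (product I M). x = ?cM f' \<and> y = ?cN (push f')" for y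
          using that push_eq[OF f(1)] f(2) by metis
      qed
    qed
  qed blast
  have H_app: "app H (?cM f) = ?cN (push f)" if f: "f \<in> elts (product I M)" for f
  proof -
    have "?cM f \<in> elts (universe ?uM)" using f by (simp add: universe_ultraproduct)
    then obtain f' where f': "f' \<in> elts (product I M)" "?cM f = ?cM f'" "app H (?cM f) = ?cN (push f')"
      using H(2) by blast
    then show ?thesis using push_eq[OF f f'(1)] by metis
  qed
  define pushes where "pushes = (\<lambda>f. vlam (vdom f) (\<lambda>k. push (app f k)))"
  have ft_in': "ft (\<lambda>e. push (app f (e 0)))" for f by (intro ft_push fo_intros)
  have app_pushes: "app (pushes f) k = push (app f k)"
    if "f \<in> elts (funs n (product I M))" "k \<in> elts n" for f n k
    unfolding pushes_def funs_vdom[OF that(1)] by (rule app_vlam[OF ft_in' that(2)])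
  have pushes: "pushes f \<in> elts (funs n (product I N))" if f: "f \<in> elts (funs n (product I M))" for f n
    unfolding in_funs using app_pushes[OF f] push_product[OF funs_app[OF f]] function_on_vlam[OF ft_in', of n f]
    by (simp add: pushes_def funs_vdom[OF f])
  have vcomp_H: "vcomp H (tuple_class I U M f) = tuple_class I U N (pushes f)"
    if f: "f \<in> elts (funs n (product I M))" for f n
  proof (rule function_eqI[OF _ function_on_tuple_class[OF pushes[OF f]]])
    show "function_on n (vcomp H (tuple_class I U M f))"
      using function_on_vcomp[of "tuple_class I U M f" H]
      by (simp add: vdom_function_on[OF function_on_tuple_class[OF f]])
    show "app (vcomp H (tuple_class I U M f)) k = app (tuple_class I U N (pushes f)) k" if "k \<in> elts n" for k
      using that H_app[OF funs_app[OF f that]]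
      by (simp add: app_vcomp vdom_function_on[OF function_on_tuple_class[OF f]] app_tuple_class[OF f]
          app_tuple_class[OF pushes[OF f]] app_pushes[OF f])
  qed
  have tuple_at_pushes: "tuple_at (pushes f) i = vcomp (app c i) (tuple_at f i)"
    if f: "f \<in> elts (funs n (product I M))" and i: "i \<in> elts I" "good i" for f n i
  proof (rule function_eqI[OF function_on_tuple_at[OF pushes[OF f]]])
    show "function_on n (vcomp (app c i) (tuple_at f i))"
      using function_on_vcomp[of "tuple_at f i" "app c i"]
      by (simp add: vdom_function_on[OF function_on_tuple_at[OF f]])
    show "app (tuple_at (pushes f) i) k = app (vcomp (app c i) (tuple_at f i)) k" if "k \<in> elts n" for k
      using that i by (simp add: app_tuple_at[OF pushes[OF f]] app_vcomp app_tuple_at[OF f] push app_pushes[OF f]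
          vdom_function_on[OF function_on_tuple_at[OF f]])
  qed
  have "isomorphism L ?uM ?uN H"
    unfolding isomorphism_def
  proof (intro conjI ballI)
    show "H \<in> elts (funs (universe ?uM) (universe ?uN))"
      unfolding in_funs using H(1) H_app push_product by (auto simp: universe_ultraproduct)
    show "inj_on (app H) (elts (universe ?uM))"
      unfolding inj_on_def universe_ultraproduct using H_app push_eq by auto
    show "app H ` elts (universe ?uM) = elts (universe ?uN)"
    proof
      show "app H ` elts (universe ?uM) \<subseteq> elts (universe ?uN)"
        using H_app push_product by (auto simp: universe_ultraproduct)
      show "elts (universe ?uN) \<subseteq> app H ` elts (universe ?uM)"
      proof
        fix y assume "y \<in> elts (universe ?uN)"
        then obtain g where g: "g \<in> elts (product I N)" "y = ?cN g" unfolding universe_ultraproduct by blast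
        \<comment> \<open>At good indices injectivity makes the preimage unique, and elsewhere it is
          fixed to be the value of \<open>f0\<close>. Hence the preimage is obtained by description
          rather than by choice.\<close>
        let ?R = "\<lambda>i a. (good i \<and> a \<in> elts (universe (app M i)) \<and> app (app c i) a = app g i) \<or>
          (\<not> good i \<and> a = app f0 i)"
        obtain f where f: "function_on I f" "\<And>i. i \<in> elts I \<Longrightarrow> ?R i (app f i)"
        proof (rule function_by_description[of ?R I])
          show "fo (\<lambda>e. ?R (e 0) (e 1))" by (intro fo_intros fo_good)
          show "\<exists>!a. ?R i a" if i: "i \<in> elts I" for i
          proof (cases "good i")
            case True
            have "app g i \<in> app (app c i) ` elts (universe (app M i))"
              unfolding good_surj[OF True] by (rule product_app[OF g(1) i])
            then obtain a where a: "a \<in> elts (universe (app M i))" "app (app c i) a = app g i"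
              by force
            show ?thesis
              by (rule ex1I[of _ a]) (use True a inj_onD[OF good_inj[OF True]] in auto)
          qed simp
        qed blast
        have fM: "f \<in> elts (product I M)"
          unfolding in_product using f product_app[OF f0] by metis
        have "?cN (push f) = y"
          unfolding g(2) eqN[OF push_product[OF fM] g(1)]
          by (rule often_mono[OF U good]) (use f(2) push in force)
        then have "y = app H (?cM f)" by (simp add: H_app[OF fM])
        then show "y \<in> app H ` elts (universe ?uM)"
          unfolding universe_ultraproduct by (simp add: fM)
      qed
    qed
  next
    fix R x assume R: "R \<in> elts (rel_syms L)" and x: "x \<in> elts (funs (rel_arity L R) (universe ?uM))"
    obtain f where f: "f \<in> elts (funs (rel_arity L R) (product I M))" "x = tuple_class I U M f"
      by (rule tuple_class_representative[OF L U M rel_arity_omega[OF L R] x])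
    have "often U (\<lambda>i. tuple_at f i \<in> elts (rel_int (app M i) R)) \<longleftrightarrow>
        often U (\<lambda>i. good i \<and> tuple_at f i \<in> elts (rel_int (app M i) R))"
      using good by (simp add: often_conj_iff[OF U])
    also have "\<dots> \<longleftrightarrow> often U (\<lambda>i. good i \<and> tuple_at (pushes f) i \<in> elts (rel_int (app N i) R))"
      by (rule often_cong[OF U])
        (use tuple_at_pushes[OF f(1)] good_rel[OF _ R tuple_at_in_funs[OF f(1)]] in auto)
    also have "\<dots> \<longleftrightarrow> often U (\<lambda>i. tuple_at (pushes f) i \<in> elts (rel_int (app N i) R))"
      using good by (simp add: often_conj_iff[OF U])
    finally show "x \<in> elts (rel_int ?uM R) \<longleftrightarrow> vcomp H x \<in> elts (rel_int ?uN R)"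
      unfolding f(2) vcomp_H[OF f(1)]
      by (simp add: tuple_class_in_rel_int[OF L U M R f(1)] tuple_class_in_rel_int[OF L U N R pushes[OF f(1)]])
  next
    fix F x assume F: "F \<in> elts (fun_syms L)" and x: "x \<in> elts (funs (fun_arity L F) (universe ?uM))"
    obtain f where f: "f \<in> elts (funs (fun_arity L F) (product I M))" "x = tuple_class I U M f"
      by (rule tuple_class_representative[OF L U M fun_arity_omega[OF L F] x])
    note fM = fun_at[OF L U M F f(1)] and fN = fun_at[OF L U N F pushes[OF f(1)]]
    have "?cN (push (fun_at I M F f)) = ?cN (fun_at I N F (pushes f))"
      unfolding eqN[OF push_product[OF fM(2)] fN(2)]
      by (rule often_mono[OF U good])
        (simp add: push fM(1) fN(1) tuple_at_pushes[OF f(1)] good_fun[OF _ F tuple_at_in_funs[OF f(1)]])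
    then show "app H (app (fun_int ?uM F) x) = app (fun_int ?uN F) (vcomp H x)"
      unfolding f(2) vcomp_H[OF f(1)]
      by (simp add: app_fun_int_ultraproduct[OF L U M F f(1)] H_app[OF fM(2)]
          app_fun_int_ultraproduct[OF L U N F pushes[OF f(1)]])
  qed
  then show ?thesis unfolding isomorphic_iff by blast
qed

lemma ultra_choice_imp_isomorphic_ultraproducts:
  "ultra_choice \<Longrightarrow> isomorphic_families_isomorphic_ultraproducts"
  unfolding isomorphic_families_isomorphic_ultraproducts_def
  using isomorphic_ultraproducts by blast

section \<open>Structures with one binary relation\<close>

definition "v0 = numeral_code 0"
definition "v1 = numeral_code 1"
definition "v2 = numeral_code 2"

lemma elts_v2: "elts v2 = {v0, v1}"
  by (auto simp: v0_def v1_def v2_def numeral_2_eq_2 numeral_code.simps)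

lemma v_simps [simp]: "v0 \<noteq> v1" "v1 \<noteq> v0" "v0 \<in> elts omega" "v1 \<in> elts omega" "v2 \<in> elts omega"
  by (simp_all add: v0_def v1_def v2_def)

text \<open>A tuple of length 2 in the sense of \<open>funs\<close>, which is the form of the
  arguments of a binary relation; it differs from the ordered pair \<open>vpair\<close>.\<close>

definition pair_tuple :: "'v \<Rightarrow> 'v \<Rightarrow> 'v" where
  "pair_tuple a b = vlam v2 (\<lambda>j. if j = v0 then a else b)"

lemma pair_tuple:
  shows function_on_pair_tuple: "function_on v2 (pair_tuple a b)"
    and app_pair_tuple [simp]: "app (pair_tuple a b) v0 = a" "app (pair_tuple a b) v1 = b"
proof -
  have ft: "ft (\<lambda>e. if e 0 = v0 then a else b)" by (intro fo_intros)
  show "function_on v2 (pair_tuple a b)" "app (pair_tuple a b) v0 = a" "app (pair_tuple a b) v1 = b"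
    unfolding pair_tuple_def using vlam[OF ft, where a = v2] by (simp_all add: elts_v2)
qed

lemma pair_tuple_in_funs [simp]: "pair_tuple a b \<in> elts (funs v2 A) \<longleftrightarrow> a \<in> elts A \<and> b \<in> elts A"
  using function_on_pair_tuple by (auto simp: in_funs elts_v2)

lemma function_on_v2_eqI:
  assumes "function_on v2 f" "app f v0 = a" "app f v1 = b" shows "f = pair_tuple a b"
  by (rule function_eqI[OF assms(1) function_on_pair_tuple]) (use assms in \<open>auto simp: elts_v2\<close>)

text \<open>All test structures use this one language. The number \<open>v0\<close> serves both as
  its only relation symbol and as the index of the first variable.\<close>

definition binary_language :: 'v where
  "binary_language = vpair (vlam (vset {v0}) (\<lambda>_. v2)) (vset {})"

lemma binary_language:
  shows is_language_binary: "is_language binary_language"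
    and elts_rel_syms_binary: "elts (rel_syms binary_language) = {v0}"
    and rel_arity_binary: "rel_arity binary_language v0 = v2"
    and elts_fun_syms_binary: "elts (fun_syms binary_language) = {}"
proof -
  have r: "function_on (vset {v0}) (vlam (vset {v0}) (\<lambda>_. v2))" "app (vlam (vset {v0}) (\<lambda>_. v2)) v0 = v2"
    using vlam[OF ft_const, where a = "vset {v0}"] by (simp_all add: elts_vset)
  have "is_set (elts omega - {vset {}})"
    using is_set_Diff_elts[of omega "vset {vset {}}"] by (simp add: elts_vset)
  moreover have "v2 \<noteq> vset {}"
    using elts_v2 by auto
  ultimately have "vlam (vset {v0}) (\<lambda>_. v2) \<in> elts (funs (vset {v0}) (vset (elts omega - {vset {}})))"
    using r by (simp add: in_funs elts_vset)
  moreover have "vset {} \<in> elts (funs (vset {}) omega)" by (simp add: funs_empty)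
  ultimately show "is_language binary_language"
    unfolding is_language_def binary_language_def by blast
  show "elts (rel_syms binary_language) = {v0}" "rel_arity binary_language v0 = v2"
    unfolding binary_language_def rel_syms_def rel_arity_def
    by (simp_all add: vdom_function_on[OF r(1)] r(2) elts_vset)
  show "elts (fun_syms binary_language) = {}"
    unfolding binary_language_def fun_syms_def by (simp add: vdom_function_on[OF function_on_empty])
qed

definition binary_structure :: "'v \<Rightarrow> ('v \<Rightarrow> 'v \<Rightarrow> bool) \<Rightarrow> 'v" where
  "binary_structure A P = vpair A (vpair (vlam (vset {v0}) (\<lambda>_.
     vset {x \<in> elts (funs v2 A). P (app x v0) (app x v1)})) (vset {}))"

lemma universe_binary_structure [simp]: "universe (binary_structure A P) = A"
  by (simp add: universe_def binary_structure_def)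

lemma ft_binary_structure:
  assumes "fo (\<lambda>e. P (e 0) (e 1))" "ft T" shows "ft (\<lambda>e. binary_structure (T e) P)"
  by (rule ft_fun1[where G = "\<lambda>A. binary_structure A P", OF _ assms(2)], unfold binary_structure_def)
    (intro fo_intros fo_pred2[where P = P, OF assms(1)])

lemma binary_structure:
  assumes P: "fo (\<lambda>e. P (e 0) (e 1))"
  shows elts_rel_int_binary: "elts (rel_int (binary_structure A P) v0) =
      {x \<in> elts (funs v2 A). P (app x v0) (app x v1)}"
    and is_structure_binary: "elts A \<noteq> {} \<Longrightarrow> is_structure binary_language (binary_structure A P)"
proof -
  let ?S = "{x \<in> elts (funs v2 A). P (app x v0) (app x v1)}"
  have r: "function_on (vset {v0}) (vlam (vset {v0}) (\<lambda>_. vset ?S))"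
    "app (vlam (vset {v0}) (\<lambda>_. vset ?S)) v0 = vset ?S"
    using vlam[OF ft_const, where a = "vset {v0}"] by (simp_all add: elts_vset)
  have el: "elts (vset ?S) = ?S"
    by (rule elts_vset[OF is_set_separation]) (intro fo_intros fo_pred2[where P = P, OF P])
  show "elts (rel_int (binary_structure A P) v0) = ?S"
    unfolding rel_int_def binary_structure_def by (simp add: r(2) el)
  have "rel_syms binary_language = vset {v0}" "fun_syms binary_language = vset {}"
    using elts_rel_syms_binary elts_fun_syms_binary elts_vset[of "{v0}"]
    by (simp_all flip: elts_inject add: elts_vset)
  then show "is_structure binary_language (binary_structure A P)" if "elts A \<noteq> {}"
    unfolding is_structure_def binary_structure_def using r that
    by (auto simp: elts_vset el rel_arity_binary)
qed

lemma pair_tuple_in_rel_int_binary: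
  assumes "fo (\<lambda>e. P (e 0) (e 1))" "a \<in> elts A" "b \<in> elts A"
  shows "pair_tuple a b \<in> elts (rel_int (binary_structure A P) v0) \<longleftrightarrow> P a b"
  using assms by (simp add: elts_rel_int_binary)

lemma binary_terms:
  assumes "t \<in> elts (terms_in binary_language X)"
  obtains k where "k \<in> elts X" "t = Var_code k"
  by (rule term_cases[OF is_language_binary assms]) (use that in \<open>simp_all add: elts_fun_syms_binary\<close>)

subsection \<open>Two test sentences\<close>

definition var_pair :: 'v where
  "var_pair = pair_tuple (Var_code v0) (Var_code v1)"

text \<open>It fails exactly when the relation is total. In an ultrapower, totality means that every
  function has a partner to which it is related almost everywhere, which is how choice is
  extracted.\<close>

definition dead_end_sentence :: 'v where
  "dead_end_sentence = Ex_code v0 (All_code v1 (Neg_code (Rel_code v0 var_pair)))"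

definition two_elements_sentence :: 'v where
  "two_elements_sentence = Ex_code v0 (Ex_code v1 (Neg_code (Eq_code (Var_code v0) (Var_code v1))))"

lemma Sigma_formulas_Suc:
  shows Pi_subset_Sigma: "elts (Pi_formulas n L) \<subseteq> elts (Sigma_formulas (Suc n) L)"
    and Ex_in_Sigma: "k \<in> elts omega \<Longrightarrow> \<phi> \<in> elts (Sigma_formulas (Suc n) L) \<Longrightarrow>
      Ex_code k \<phi> \<in> elts (Sigma_formulas (Suc n) L)"
proof -
  let ?C = "\<lambda>Q. elts (Pi_formulas n L) \<subseteq> elts Q \<and> (\<forall>k\<in>elts omega. \<forall>\<phi>\<in>elts Q. Ex_code k \<phi> \<in> elts Q)"
  obtain H where "elts (Pi_formulas n L) \<subseteq> elts H" "code_closed H" by (rule code_closure)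
  then have "?C H" unfolding code_closed_def by blast
  then have "elts (Sigma_formulas (Suc n) L) = {x. \<forall>Y. ?C Y \<longrightarrow> x \<in> elts Y}"
    unfolding Sigma_formulas.simps by (intro elts_least_closed fo_intros)
  then show "elts (Pi_formulas n L) \<subseteq> elts (Sigma_formulas (Suc n) L)"
    "k \<in> elts omega \<Longrightarrow> \<phi> \<in> elts (Sigma_formulas (Suc n) L) \<Longrightarrow>
      Ex_code k \<phi> \<in> elts (Sigma_formulas (Suc n) L)"
    by blast+
qed

lemma Pi_formulas_Suc:
  shows Sigma_subset_Pi: "elts (Sigma_formulas n L) \<subseteq> elts (Pi_formulas (Suc n) L)"
    and All_in_Pi: "k \<in> elts omega \<Longrightarrow> \<phi> \<in> elts (Pi_formulas (Suc n) L) \<Longrightarrow>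
      All_code k \<phi> \<in> elts (Pi_formulas (Suc n) L)"
proof -
  let ?C = "\<lambda>Q. elts (Sigma_formulas n L) \<subseteq> elts Q \<and> (\<forall>k\<in>elts omega. \<forall>\<phi>\<in>elts Q. All_code k \<phi> \<in> elts Q)"
  obtain H where "elts (Sigma_formulas n L) \<subseteq> elts H" "code_closed H" by (rule code_closure)
  then have "?C H" unfolding code_closed_def All_code_def by blast
  moreover have "fo (\<lambda>e. ?C (e 0))" unfolding All_code_def by (intro fo_intros)
  ultimately have "elts (Pi_formulas (Suc n) L) = {x. \<forall>Y. ?C Y \<longrightarrow> x \<in> elts Y}"
    unfolding Pi_formulas.simps by (intro elts_least_closed[where C = ?C])
  then show "elts (Sigma_formulas n L) \<subseteq> elts (Pi_formulas (Suc n) L)"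
    "k \<in> elts omega \<Longrightarrow> \<phi> \<in> elts (Pi_formulas (Suc n) L) \<Longrightarrow>
      All_code k \<phi> \<in> elts (Pi_formulas (Suc n) L)"
    by blast+
qed

lemma qf_formulas_intros:
  assumes L: "is_language L"
  shows "t \<in> elts (terms_in L omega) \<Longrightarrow> u \<in> elts (terms_in L omega) \<Longrightarrow> Eq_code t u \<in> elts (qf_formulas L)"
    and "R \<in> elts (rel_syms L) \<Longrightarrow> v \<in> elts (funs (rel_arity L R) (terms_in L omega)) \<Longrightarrow>
      Rel_code R v \<in> elts (qf_formulas L)"
    and "\<phi> \<in> elts (qf_formulas L) \<Longrightarrow> Neg_code \<phi> \<in> elts (qf_formulas L)"
proof -
  let ?C = "\<lambda>Q. (\<forall>t\<in>elts (terms_in L omega). \<forall>u\<in>elts (terms_in L omega). Eq_code t u \<in> elts Q) \<and>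
     (\<forall>R\<in>elts (rel_syms L). \<forall>u\<in>elts (funs (rel_arity L R) (terms_in L omega)). Rel_code R u \<in> elts Q) \<and>
     (\<forall>\<phi>\<in>elts Q. Neg_code \<phi> \<in> elts Q) \<and> (\<forall>\<phi>\<in>elts Q. \<forall>\<psi>\<in>elts Q. Conj_code \<phi> \<psi> \<in> elts Q)"
  obtain H where H: "elts (vset (elts (terms_in L omega) \<union> elts (rel_syms L))) \<subseteq> elts H" "code_closed H"
    by (rule code_closure)
  have sub: "elts (terms_in L omega) \<subseteq> elts H" "elts (rel_syms L) \<subseteq> elts H"
    using H(1) by (simp_all add: elts_vset)
  have "?C H"
  proof (intro conjI ballI)
    fix R u assume R: "R \<in> elts (rel_syms L)" and u: "u \<in> elts (funs (rel_arity L R) (terms_in L omega))"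
    show "Rel_code R u \<in> elts H"
      using H(2) R sub rel_arity_omega[OF L R] funs_mono[OF u sub(1)] unfolding code_closed_def by blast
  qed (use H(2) sub in \<open>unfold code_closed_def, blast+\<close>)
  then have el: "elts (qf_formulas L) = {x. \<forall>Y. ?C Y \<longrightarrow> x \<in> elts Y}"
    unfolding qf_formulas_def by (intro elts_least_closed[where C = ?C] fo_intros)
  show "t \<in> elts (terms_in L omega) \<Longrightarrow> u \<in> elts (terms_in L omega) \<Longrightarrow> Eq_code t u \<in> elts (qf_formulas L)"
    unfolding el by blast
  show "R \<in> elts (rel_syms L) \<Longrightarrow> v \<in> elts (funs (rel_arity L R) (terms_in L omega)) \<Longrightarrow>
      Rel_code R v \<in> elts (qf_formulas L)"
    unfolding el by blast
  show "\<phi> \<in> elts (qf_formulas L) \<Longrightarrow> Neg_code \<phi> \<in> elts (qf_formulas L)"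
    unfolding el by blast
qed

text \<open>Written literally as the formation rule for the quantifier and
  \<open>vupd_in_funs\<close> produce these index sets, starting from the empty one, so that the
  rules apply without rewriting.\<close>

abbreviation "X1 \<equiv> vset (insert v0 (elts (vset {})))"
abbreviation "X2 \<equiv> vset (insert v1 (elts X1))"

lemma elts_X: "elts X1 = {v0}" "elts X2 = {v0, v1}"
  by (auto simp: elts_vset)

lemma X_subset_omega: "elts (vset {}) \<subseteq> elts omega" "elts X1 \<subseteq> elts omega" "elts X2 \<subseteq> elts omega"
  by (simp_all add: elts_vset)

lemma var_terms:
  shows var_pair_in_funs: "v0 \<in> elts X \<Longrightarrow> v1 \<in> elts X \<Longrightarrow> var_pair \<in> elts (funs v2 (terms_in binary_language X))"
    and Var_in_binary_terms: "k \<in> elts X \<Longrightarrow> Var_code k \<in> elts (terms_in binary_language X)"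
  using Var_in_terms[OF is_language_binary] by (simp_all add: var_pair_def)

lemma test_matrices:
  shows Rel_matrix: "Rel_code v0 var_pair \<in> elts (formulas_in binary_language X2)"
    and Eq_matrix: "Eq_code (Var_code v0) (Var_code v1) \<in> elts (formulas_in binary_language X2)"
  using Rel_in_formulas[OF is_language_binary X_subset_omega(3), of v0 var_pair]
    Eq_in_formulas[OF is_language_binary X_subset_omega(3)] var_pair_in_funs[of X2]
    Var_in_binary_terms[of v0 X2] Var_in_binary_terms[of v1 X2] elts_X
  by (simp_all add: elts_rel_syms_binary rel_arity_binary)

lemmas binary_Neg = Neg_in_formulas[OF is_language_binary]
  and binary_Ex = Ex_in_formulas[OF is_language_binary]

lemma dead_end_sentence_in_Sigma2:
  "dead_end_sentence \<in> elts (Sigma_formulas 2 binary_language) \<inter> elts (formulas_in binary_language (vset {}))"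
proof
  have "Neg_code (Rel_code v0 var_pair) \<in> elts (Sigma_formulas 0 binary_language)"
    using qf_formulas_intros[OF is_language_binary] var_pair_in_funs[of omega] Var_in_binary_terms[of _ omega]
    by (simp add: elts_rel_syms_binary rel_arity_binary)
  then have "All_code v1 (Neg_code (Rel_code v0 var_pair)) \<in> elts (Pi_formulas (Suc 0) binary_language)"
    using All_in_Pi Sigma_subset_Pi v_simps(3,4) by blast
  then show "dead_end_sentence \<in> elts (Sigma_formulas 2 binary_language)"
    unfolding dead_end_sentence_def numeral_2_eq_2
    using Ex_in_Sigma Pi_subset_Sigma v_simps(3,4) by blast
  show "dead_end_sentence \<in> elts (formulas_in binary_language (vset {}))"
    unfolding dead_end_sentence_def All_code_def
    by (intro binary_Ex binary_Neg X_subset_omega v_simps(3,4) Rel_matrix)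
qed

lemma two_elements_sentence_in_Sigma1:
  "two_elements_sentence \<in> elts (Sigma_formulas 1 binary_language) \<inter> elts (formulas_in binary_language (vset {}))"
proof
  have "Neg_code (Eq_code (Var_code v0) (Var_code v1)) \<in> elts (Pi_formulas 0 binary_language)"
    using qf_formulas_intros[OF is_language_binary] var_pair_in_funs[of omega] Var_in_binary_terms[of _ omega] by simp
  then have "Ex_code v1 (Neg_code (Eq_code (Var_code v0) (Var_code v1))) \<in>
      elts (Sigma_formulas (Suc 0) binary_language)"
    using Ex_in_Sigma Pi_subset_Sigma v_simps(3,4) by blast
  then show "two_elements_sentence \<in> elts (Sigma_formulas 1 binary_language)"
    unfolding two_elements_sentence_def One_nat_def using Ex_in_Sigma v_simps(3,4) by blast
  show "two_elements_sentence \<in> elts (formulas_in binary_language (vset {}))"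
    unfolding two_elements_sentence_def
    by (intro binary_Ex binary_Neg X_subset_omega v_simps(3,4) Eq_matrix)
qed

lemma assignments:
  assumes "a \<in> elts A" "b \<in> elts A"
  shows "vset {} \<in> elts (funs (vset {}) A)" "vupd (vset {}) v0 a \<in> elts (funs X1 A)"
    "vupd (vupd (vset {}) v0 a) v1 b \<in> elts (funs X2 A)"
    "app (vupd (vupd (vset {}) v0 a) v1 b) v0 = a" "app (vupd (vupd (vset {}) v0 a) v1 b) v1 = b"
proof -
  show 0: "vset {} \<in> elts (funs (vset {}) A)" by (simp add: funs_empty)
  show 1: "vupd (vset {}) v0 a \<in> elts (funs X1 A)" by (rule vupd_in_funs[OF 0 assms(1)])
  show "vupd (vupd (vset {}) v0 a) v1 b \<in> elts (funs X2 A)" by (rule vupd_in_funs[OF 1 assms(2)])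
  show "app (vupd (vupd (vset {}) v0 a) v1 b) v0 = a" "app (vupd (vupd (vset {}) v0 a) v1 b) v1 = b"
    by (simp_all add: app_vupd vdom_function_on[OF function_on_empty] elts_vset)
qed

lemma satisfies_dead_end_sentence:
  assumes M: "is_structure binary_language M"
  shows "satisfies binary_language M dead_end_sentence (vset {}) \<longleftrightarrow>
    (\<exists>a\<in>elts (universe M). \<not> (\<exists>b\<in>elts (universe M). pair_tuple a b \<in> elts (rel_int M v0)))"
proof -
  let ?R = "Rel_code v0 var_pair" and ?sat = "satisfies binary_language M"
  note L = is_language_binary
  \<comment> \<open>The double negation arises because \<open>All_code\<close> is an abbreviation
    for a negated existential of a negation.\<close>
  have 2: "?sat (Neg_code (Neg_code ?R)) (vupd (vupd (vset {}) v0 a) v1 b) \<longleftrightarrow> pair_tuple a b \<in> elts (rel_int M v0)"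
    if ab: "a \<in> elts (universe M)" "b \<in> elts (universe M)" for a b
  proof -
    let ?s = "vupd (vupd (vset {}) v0 a) v1 b"
    note s = assignments[OF ab]
    have v: "var_pair \<in> elts (funs v2 (terms_in binary_language X2))"
      using var_pair_in_funs[of X2] elts_X by simp
    have "vcomp (term_eval binary_language M ?s) var_pair = pair_tuple a b"
    proof (rule function_on_v2_eqI)
      show "function_on v2 (vcomp (term_eval binary_language M ?s) var_pair)"
        using function_on_vcomp[of var_pair] by (simp add: funs_vdom[OF v])
      show "app (vcomp (term_eval binary_language M ?s) var_pair) v0 = a"
        "app (vcomp (term_eval binary_language M ?s) var_pair) v1 = b"
        using term_eval_Var[OF L M s(3)] s(4,5) elts_X
        by (simp_all add: app_vcomp funs_vdom[OF v] elts_v2) (simp_all add: var_pair_def)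
    qed
    then show ?thesis
      using Rel_matrix binary_Neg[OF X_subset_omega(3) Rel_matrix] v
      by (simp add: satisfies_Neg[OF L M X_subset_omega(3) s(3)] satisfies_Rel[OF L M X_subset_omega(3) s(3)]
          elts_rel_syms_binary rel_arity_binary)
  qed
  have \<chi>: "Neg_code (Neg_code ?R) \<in> elts (formulas_in binary_language X2)"
    by (intro binary_Neg X_subset_omega Rel_matrix)
  have \<psi>: "Ex_code v1 (Neg_code (Neg_code ?R)) \<in> elts (formulas_in binary_language X1)"
    by (intro binary_Ex X_subset_omega v_simps(3,4) \<chi>)
  have 1: "?sat (All_code v1 (Neg_code ?R)) (vupd (vset {}) v0 a) \<longleftrightarrow>
      \<not> (\<exists>b\<in>elts (universe M). pair_tuple a b \<in> elts (rel_int M v0))" if a: "a \<in> elts (universe M)" for a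
    unfolding All_code_def satisfies_Neg[OF L M X_subset_omega(2) assignments(2)[OF a a] \<psi>]
      satisfies_Ex[OF L M X_subset_omega(2) assignments(2)[OF a a] v_simps(4) \<chi>]
    using 2[OF a] by simp
  have "vset {} \<in> elts (funs (vset {}) (universe M))" by (simp add: funs_empty)
  moreover have "All_code v1 (Neg_code ?R) \<in> elts (formulas_in binary_language X1)"
    unfolding All_code_def by (intro binary_Neg X_subset_omega \<psi>)
  ultimately show ?thesis
    unfolding dead_end_sentence_def
    using 1 by (simp add: satisfies_Ex[OF L M X_subset_omega(1)])
qed

lemma satisfies_two_elements_sentence:
  assumes M: "is_structure binary_language M"
  shows "satisfies binary_language M two_elements_sentence (vset {}) \<longleftrightarrow>
    (\<exists>a\<in>elts (universe M). \<exists>b\<in>elts (universe M). a \<noteq> b)"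
proof -
  let ?R = "Eq_code (Var_code v0) (Var_code v1)" and ?sat = "satisfies binary_language M"
  note L = is_language_binary
  have t: "Var_code v0 \<in> elts (terms_in binary_language X2)" "Var_code v1 \<in> elts (terms_in binary_language X2)"
    using Var_in_binary_terms[of _ X2] elts_X by simp_all
  have 2: "?sat (Neg_code ?R) (vupd (vupd (vset {}) v0 a) v1 b) \<longleftrightarrow> a \<noteq> b"
    if ab: "a \<in> elts (universe M)" "b \<in> elts (universe M)" for a b
  proof -
    note s = assignments[OF ab]
    show ?thesis
      unfolding satisfies_Neg[OF L M X_subset_omega(3) s(3) Eq_matrix]
        satisfies_Eq[OF L M X_subset_omega(3) s(3) t]
      using term_eval_Var[OF L M s(3)] s(4,5) elts_X by simp
  qed
  have \<chi>: "Neg_code ?R \<in> elts (formulas_in binary_language X2)"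
    by (intro binary_Neg X_subset_omega Eq_matrix)
  have \<psi>: "Ex_code v1 (Neg_code ?R) \<in> elts (formulas_in binary_language X1)"
    by (intro binary_Ex X_subset_omega v_simps(3,4) \<chi>)
  have 1: "?sat (Ex_code v1 (Neg_code ?R)) (vupd (vset {}) v0 a) \<longleftrightarrow>
      (\<exists>b\<in>elts (universe M). a \<noteq> b)" if a: "a \<in> elts (universe M)" for a
    unfolding satisfies_Ex[OF L M X_subset_omega(2) assignments(2)[OF a a] v_simps(4) \<chi>]
    using 2[OF a] by simp
  have s: "vset {} \<in> elts (funs (vset {}) (universe M))" by (simp add: funs_empty)
  show ?thesis
    unfolding two_elements_sentence_def satisfies_Ex[OF L M X_subset_omega(1) s v_simps(3) \<psi>]
    using 1 by simp
qed

section \<open>Choice from the weakenings of Los's theorem\<close>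

lemma ultrafilter_index_nonempty: "ultrafilter I U \<Longrightarrow> elts I \<noteq> {}"
  unfolding ultrafilter_def by (metis elts_eq_empty)

text \<open>Translates the sentence from classes to functions. Its failure turns any
  \<open>f\<close> into a function \<open>g\<close> with \<open>P (app f i) (app g i)\<close> almost
  everywhere.\<close>

lemma dead_end_ultrapower_binary:
  assumes P: "fo (\<lambda>e. P (e 0) (e 1))" and W: "elts W \<noteq> {}" and U: "ultrafilter I U"
  shows "satisfies binary_language (ultrapower binary_language I U (binary_structure W P)) dead_end_sentence (vset {}) \<longleftrightarrow>
        (\<exists>f\<in>elts (funs I W). \<not> (\<exists>g\<in>elts (funs I W). often U (\<lambda>i. P (app f i) (app g i))))"
proof -
  let ?M = "binary_structure W P"
  let ?F = "vlam I (\<lambda>_. ?M)"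
  note L = is_language_binary and M = is_structure_binary[OF P W]
  note F = constant_family[OF M, where I = I]
  note ult = universe_ultraproduct[OF L U F(1)]
  have prod: "elts (product I ?F) = elts (funs I W)"
    by (auto simp: in_product in_funs F(2))
  have str: "is_structure binary_language (ultrapower binary_language I U ?M)"
    unfolding ultrapower_def by (rule is_structure_ultraproduct[OF L U F(1,3)])
  have rel: "pair_tuple (ultra_class I U ?F f) (ultra_class I U ?F g) \<in>
      elts (rel_int (ultrapower binary_language I U ?M) v0) \<longleftrightarrow> often U (\<lambda>i. P (app f i) (app g i))"
    if f: "f \<in> elts (funs I W)" and g: "g \<in> elts (funs I W)" for f g
  proof -
    have fg: "pair_tuple f g \<in> elts (funs v2 (product I ?F))" using f g by (simp add: prod)
    have "tuple_class I U ?F (pair_tuple f g) = pair_tuple (ultra_class I U ?F f) (ultra_class I U ?F g)"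
      by (rule function_on_v2_eqI[OF function_on_tuple_class[OF fg]])
        (simp_all add: app_tuple_class[OF fg] elts_v2)
    moreover have "tuple_at (pair_tuple f g) i = pair_tuple (app f i) (app g i)" for i
      by (rule function_on_v2_eqI[OF function_on_tuple_at[OF fg]])
        (simp_all add: app_tuple_at[OF fg] elts_v2)
    moreover have "tuple_class I U ?F (pair_tuple f g) \<in> elts (rel_int (ultrapower binary_language I U ?M) v0) \<longleftrightarrow>
        often U (\<lambda>i. tuple_at (pair_tuple f g) i \<in> elts (rel_int (app ?F i) v0))"
      unfolding ultrapower_def
      by (rule tuple_class_in_rel_int[OF L U F(1)]) (use fg in \<open>simp_all add: elts_rel_syms_binary rel_arity_binary\<close>)
    moreover have "often U (\<lambda>i. pair_tuple (app f i) (app g i) \<in> elts (rel_int (app ?F i) v0)) \<longleftrightarrow>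
        often U (\<lambda>i. P (app f i) (app g i))"
      by (rule often_cong[OF U])
        (simp add: F(2) pair_tuple_in_rel_int_binary[OF P] funs_app[OF f] funs_app[OF g])
    ultimately show ?thesis by simp
  qed
  show "satisfies binary_language (ultrapower binary_language I U ?M) dead_end_sentence (vset {}) \<longleftrightarrow>
        (\<exists>f\<in>elts (funs I W). \<not> (\<exists>g\<in>elts (funs I W). often U (\<lambda>i. P (app f i) (app g i))))"
    unfolding satisfies_dead_end_sentence[OF str]
    using rel by (simp add: ultrapower_def ult prod)
qed

lemma ultrapowers_Sigma2_equivalent_imp_ultra_choice:
  assumes eq: ultrapowers_Sigma2_equivalent shows ultra_choice
  unfolding ultra_choice_def
proof (intro allI impI; elim conjE)
  fix I U A
  assume U: "ultrafilter I U" and A: "function_on I A" and ne: "\<forall>i\<in>elts I. elts (app A i) \<noteq> {}"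
  define W where "W = vset (elts I \<union> elts (vset (\<Union>i\<in>elts I. elts (app A i))))"
  have "is_set (\<Union>i\<in>elts I. elts (app A i))" by (rule is_set_UN) (intro fo_intros)
  then have W: "elts W = elts I \<union> (\<Union>i\<in>elts I. elts (app A i))"
    unfolding W_def elts_vset[OF is_set_Un_elts] by (simp add: elts_vset)
  \<comment> \<open>Elements of \<open>W\<close> outside \<open>I\<close> are related to everything,
    so totality on \<open>W\<close> comes down to the sets being nonempty.\<close>
  define P where "P = (\<lambda>x y. x \<in> elts I \<longrightarrow> y \<in> elts (app A x))"
  have P: "fo (\<lambda>e. P (e 0) (e 1))" unfolding P_def by (intro fo_intros)
  have Wne: "elts W \<noteq> {}" using ultrafilter_index_nonempty[OF U] W by blast
  let ?M = "binary_structure W P"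
  note M = is_structure_binary[OF P Wne]
  have "\<exists>b\<in>elts W. P a b" if "a \<in> elts W" for a
    using that ne unfolding W P_def by blast
  then have "\<not> satisfies binary_language ?M dead_end_sentence (vset {})"
    by (simp add: satisfies_dead_end_sentence[OF M] pair_tuple_in_rel_int_binary[OF P])
  moreover have "Sigma_equivalent 2 binary_language (ultrapower binary_language I U ?M) ?M"
    using eq is_language_binary M U unfolding ultrapowers_Sigma2_equivalent_def by blast
  ultimately have *: "\<not> satisfies binary_language (ultrapower binary_language I U ?M) dead_end_sentence (vset {})"
    using dead_end_sentence_in_Sigma2 unfolding Sigma_equivalent_def by blast
  define d where "d = vlam I (\<lambda>i. i)"
  have d: "function_on I d" "\<And>i. i \<in> elts I \<Longrightarrow> app d i = i"
    unfolding d_def using vlam[OF ft_var] by blast+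
  then have "d \<in> elts (funs I W)" unfolding in_funs W by simp
  then obtain g where g: "g \<in> elts (funs I W)" "often U (\<lambda>i. P (app d i) (app g i))"
    using * unfolding dead_end_ultrapower_binary[OF P Wne U] by blast
  have "often U (\<lambda>i. app g i \<in> elts (app A i))"
    by (rule often_mono[OF U g(2)]) (simp add: d P_def)
  then show "\<exists>f. function_on I f \<and> often U (\<lambda>i. app f i \<in> elts (app A i))"
    using g(1) in_funs by blast
qed

subsection \<open>Equinumerous sets\<close>

definition equinumerous :: "'v \<Rightarrow> 'v \<Rightarrow> bool" where
  "equinumerous A B \<longleftrightarrow> (\<exists>h\<in>elts (funs A B). bij_betw (app h) (elts A) (elts B))"

lemma equinumerous_sym:
  assumes "equinumerous A B" shows "equinumerous B A"
proof -
  obtain h where h: "h \<in> elts (funs A B)" "bij_betw (app h) (elts A) (elts B)"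
    using assms unfolding equinumerous_def by blast
  obtain g where g: "function_on B g" "\<And>y. y \<in> elts B \<Longrightarrow> app g y \<in> elts A \<and> app h (app g y) = y"
  proof (rule function_by_description[of "\<lambda>y x. x \<in> elts A \<and> app h x = y" B])
    show "fo (\<lambda>e. e 1 \<in> elts A \<and> app h (e 1) = e 0)" by (intro fo_intros)
    show "\<exists>!x. x \<in> elts A \<and> app h x = y" if y: "y \<in> elts B" for y
    proof -
      have "y \<in> app h ` elts A"
        using y by (simp add: bij_betw_imp_surj_on[OF h(2)])
      then obtain x where "x \<in> elts A" "app h x = y" by blast
      then show ?thesis
        using inj_onD[OF bij_betw_imp_inj_on[OF h(2)]] by (intro ex1I[of _ x]) auto
    qed
  qed blast
  have "bij_betw (app g) (elts B) (elts A)"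
  proof (rule bij_betw_byWitness[where f' = "app h"])
    show "\<forall>a\<in>elts A. app g (app h a) = a"
      using g(2) funs_app[OF h(1)] inj_onD[OF bij_betw_imp_inj_on[OF h(2)]] by blast
  qed (use g(2) funs_app[OF h(1)] in auto)
  then show ?thesis
    unfolding equinumerous_def using g by (auto simp: in_funs)
qed

lemma equinumerous_trans:
  assumes "equinumerous A B" "equinumerous B C" shows "equinumerous A C"
proof -
  obtain h where h: "h \<in> elts (funs A B)" "bij_betw (app h) (elts A) (elts B)"
    using assms unfolding equinumerous_def by blast
  obtain g where g: "g \<in> elts (funs B C)" "bij_betw (app g) (elts B) (elts C)"
    using assms unfolding equinumerous_def by blast
  have "bij_betw (app (vcomp g h)) (elts A) (elts C) \<longleftrightarrow> bij_betw (app g \<circ> app h) (elts A) (elts C)"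
    by (rule bij_betw_cong) (simp add: app_vcomp funs_vdom[OF h(1)])
  then have "bij_betw (app (vcomp g h)) (elts A) (elts C)"
    using bij_betw_trans[OF h(2) g(2)] by simp
  moreover have "vcomp g h \<in> elts (funs A C)" using vcomp_in_funs[OF h(1)] funs_app[OF g(1)] by blast
  ultimately show ?thesis unfolding equinumerous_def by blast
qed

lemma equinumerous_insert:
  assumes "equinumerous A B" "z \<notin> elts A" "z \<notin> elts B"
  shows "equinumerous (vset (insert z (elts A))) (vset (insert z (elts B)))"
proof -
  obtain h where h: "h \<in> elts (funs A B)" "bij_betw (app h) (elts A) (elts B)"
    using assms unfolding equinumerous_def by blast
  have app: "app (vupd h z z) x = (if x = z then z else app h x)" if "x \<in> insert z (elts A)" for x
    using that by (intro app_vupd) (simp add: funs_vdom[OF h(1)])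
  have "bij_betw (app (vupd h z z)) (elts A) (elts B) \<longleftrightarrow> bij_betw (app h) (elts A) (elts B)"
    by (rule bij_betw_cong) (use app assms(2) in auto)
  then have "bij_betw (app (vupd h z z)) (insert z (elts A)) (insert z (elts B))"
    using notIn_Un_bij_betw[of z "elts A" "app (vupd h z z)" "elts B"] assms(2,3) h(2) app[of z] by simp
  moreover have "vupd h z z \<in> elts (funs (vset (insert z (elts A))) (vset (insert z (elts B))))"
    using function_on_vupd[of z h z] app funs_app[OF h(1)] by (auto simp: in_funs funs_vdom[OF h(1)] elts_vset)
  ultimately show ?thesis unfolding equinumerous_def by (auto simp: elts_vset)
qed

text \<open>As in the Schroeder-Bernstein theorem, \<open>h\<close> is \<open>g\<close> on the closure of \<open>Z \ B\<close> under \<open>g\<close>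
  and the identity elsewhere.\<close>

lemma equinumerous_subset:
  assumes sub: "elts B \<subseteq> elts Z" and g: "g \<in> elts (funs Z B)" and inj: "inj_on (app g) (elts Z)"
  shows "equinumerous Z B"
proof -
  define C where "C = {z \<in> elts Z. \<forall>S. elts Z - elts B \<subseteq> elts S \<and> (\<forall>x\<in>elts S \<inter> elts Z. app g x \<in> elts S) \<longrightarrow> z \<in> elts S}"
  have foC: "ft T \<Longrightarrow> fo (\<lambda>e. T e \<in> C)" for T
    by (rule fo_pred1[where P = "\<lambda>x. x \<in> C"], unfold C_def) (intro fo_intros)
  have CZ: "C \<subseteq> elts Z" unfolding C_def by blast
  have base: "z \<in> C" if "z \<in> elts Z" "z \<notin> elts B" for z
    using that unfolding C_def by blast
  have gZ: "app g z \<in> elts B" "app g z \<in> elts Z" if "z \<in> elts Z" for z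
    using funs_app[OF g that] sub by blast+
  have step: "app g z \<in> C" if "z \<in> C" for z
    using that gZ unfolding C_def by blast
  have elC: "elts (vset (C - {y})) = C - {y}" for y
  proof (rule elts_vset, rule is_set_subset)
    show "fo (\<lambda>e. e 0 \<in> C - {y})" by (intro fo_intros foC)
    show "C - {y} \<subseteq> elts Z" using CZ by blast
  qed
  \<comment> \<open>If \<open>y\<close> were not the image of a member of \<open>C\<close>, removing
    it from \<open>C\<close> would leave a set that still contains the part of \<open>Z\<close>
    outside \<open>B\<close> and is closed under \<open>g\<close>, against the minimality of
    \<open>C\<close>.\<close>
  have inv: "\<exists>z\<in>C. y = app g z" if y: "y \<in> C" "y \<in> elts B" for y
  proof (rule ccontr)
    assume no: "\<not> (\<exists>z\<in>C. y = app g z)"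
    have "elts Z - elts B \<subseteq> elts (vset (C - {y}))" unfolding elC using base y by blast
    moreover have "\<forall>x\<in>elts (vset (C - {y})) \<inter> elts Z. app g x \<in> elts (vset (C - {y}))"
      unfolding elC using step no by blast
    ultimately have "y \<in> elts (vset (C - {y}))" using y(1) unfolding C_def by blast
    then show False unfolding elC by blast
  qed
  define h where "h = vlam Z (\<lambda>z. if z \<in> C then app g z else z)"
  have fth: "ft (\<lambda>e. if e 0 \<in> C then app g (e 0) else e 0)" by (intro fo_intros foC)
  have h: "function_on Z h" "\<And>z. z \<in> elts Z \<Longrightarrow> app h z = (if z \<in> C then app g z else z)"
    unfolding h_def using vlam[OF fth] by blast+
  have hB: "app h z \<in> elts B" if "z \<in> elts Z" for z
    using gZ[OF that] base that h(2)[OF that] by auto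
  have "inj_on (app h) (elts Z)"
  proof (rule inj_onI)
    fix x y assume xy: "x \<in> elts Z" "y \<in> elts Z" "app h x = app h y"
    show "x = y"
      using xy(3) step[of x] step[of y] inj_onD[OF inj _ xy(1,2)]
      unfolding h(2)[OF xy(1)] h(2)[OF xy(2)] by (auto split: if_splits)
  qed
  moreover have "app h ` elts Z = elts B"
  proof
    show "app h ` elts Z \<subseteq> elts B" using hB by blast
    show "elts B \<subseteq> app h ` elts Z"
    proof
      fix y assume y: "y \<in> elts B"
      show "y \<in> app h ` elts Z"
      proof (cases "y \<in> C")
        case True
        then obtain z where "z \<in> C" "y = app g z" using inv y by blast
        then have "z \<in> elts Z" "app h z = y" using CZ h(2)[of z] by auto
        then show ?thesis by blast
      next
        case False
        then have "app h y = y" "y \<in> elts Z" using sub y h(2)[of y] by auto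
        then show ?thesis by force
      qed
    qed
  qed
  ultimately show ?thesis
    unfolding equinumerous_def bij_betw_def using h(1) hB by (auto simp: in_funs)
qed

subsection \<open>Families of isomorphic pointed sets\<close>

text \<open>The relation is empty, so every bijection between the universes is an
  isomorphism.\<close>

abbreviation bare :: "'v \<Rightarrow> 'v" where
  "bare A \<equiv> binary_structure A (\<lambda>_ _. False)"

lemma equinumerous_isomorphic:
  assumes "equinumerous A B" shows "isomorphic binary_language (bare A) (bare B)"
  using assms unfolding isomorphic_def equinumerous_def
  by (auto simp: elts_rel_syms_binary elts_fun_syms_binary elts_rel_int_binary fo_const)

text \<open>Closure under pairing puts A_i x Z inside \<open>Z\<close>, and fixing one element
  \<open>a\<close> of A_i maps \<open>Z\<close> injectively back. The bijection depends on
  \<open>a\<close>, so each isomorphism exists but nothing selects one for every \<open>i\<close>.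
  The base point is \<open>Z\<close> itself, which lies outside \<open>Z\<close> and hence outside
  all A_i x Z.\<close>

lemma pointed_family:
  assumes A: "function_on I A" and ne: "\<And>i. i \<in> elts I \<Longrightarrow> elts (app A i) \<noteq> {}"
  obtains Z M where "elts Z \<noteq> {}" "\<And>i. i \<in> elts I \<Longrightarrow> Z \<notin> elts (vtimes (app A i) Z)"
    "function_on I M" "\<forall>i\<in>elts I. app M i = bare (vset (insert Z (elts (vtimes (app A i) Z))))"
    "\<And>i. i \<in> elts I \<Longrightarrow> isomorphic binary_language (app M i) (bare (vset (insert Z (elts Z))))"
    "\<And>i j. i \<in> elts I \<Longrightarrow> j \<in> elts I \<Longrightarrow> isomorphic binary_language (app M i) (app M j)"
proof -
  have is_set: "is_set (\<Union>i\<in>elts I. elts (app A i))" by (rule is_set_UN) (intro fo_intros)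
  obtain Z where Z: "elts (vset (\<Union>i\<in>elts I. elts (app A i))) \<subseteq> elts Z" "elts omega \<subseteq> elts Z"
    "\<And>x y. x \<in> elts Z \<Longrightarrow> y \<in> elts Z \<Longrightarrow> vpair x y \<in> elts Z"
    using finitary_closure by metis
  have AZ: "elts (app A i) \<subseteq> elts Z" if "i \<in> elts I" for i
    using Z(1) that unfolding elts_vset[OF is_set] by blast
  have sub: "elts (vtimes (app A i) Z) \<subseteq> elts Z" if "i \<in> elts I" for i
    using AZ[OF that] Z(3) by (auto simp: elts_vtimes)
  have eq: "equinumerous Z (vtimes (app A i) Z)" if i: "i \<in> elts I" for i
  proof -
    obtain a where a: "a \<in> elts (app A i)" using ne[OF i] by blast
    have ft: "ft (\<lambda>e. vpair a (e 0))" by (intro fo_intros)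
    note g = vlam[OF ft, where a = Z]
    show ?thesis
      by (rule equinumerous_subset[OF sub[OF i], of "vlam Z (vpair a)"])
        (use g a in \<open>auto simp: in_funs inj_on_def\<close>)
  qed
  have Zin: "Z \<notin> elts Z" "Z \<notin> elts (vtimes (app A i) Z)" if "i \<in> elts I" for i
    using not_in_self[of Z] sub[OF that] by blast+
  let ?N = "vset (insert Z (elts Z))"
  let ?M = "\<lambda>i. vset (insert Z (elts (vtimes (app A i) Z)))"
  have eq1: "equinumerous (?M i) ?N" if "i \<in> elts I" for i
    by (rule equinumerous_sym[OF equinumerous_insert[OF eq[OF that] Zin[OF that]]])
  have ft: "ft (\<lambda>e. bare (?M (e 0)))" by (intro ft_binary_structure fo_intros)
  define M where "M = vlam I (\<lambda>i. bare (?M i))"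
  have M: "function_on I M" "\<forall>i\<in>elts I. app M i = bare (?M i)"
    unfolding M_def using vlam[OF ft] by blast+
  show thesis
  proof (rule that[of Z M])
    show "elts Z \<noteq> {}" using Z(2) zero_omega by blast
    show "isomorphic binary_language (app M i) (bare ?N)" if "i \<in> elts I" for i
      unfolding M(2)[rule_format, OF that] by (rule equinumerous_isomorphic[OF eq1[OF that]])
    show "isomorphic binary_language (app M i) (app M j)" if ij: "i \<in> elts I" "j \<in> elts I" for i j
      unfolding M(2)[rule_format, OF ij(1)] M(2)[rule_format, OF ij(2)]
      by (rule equinumerous_isomorphic[OF equinumerous_trans[OF eq1[OF ij(1)] equinumerous_sym[OF eq1[OF ij(2)]]]])
  qed (use M Zin in blast)+
qed

text \<open>The sets \<open>B i\<close> are left open in order to cover both the family of the sets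
  A_i x Z and the constant family. In either case the constant function at the base point is in the
  product.\<close>

lemma pointed_structure_family:
  assumes M: "function_on I M" "\<forall>i\<in>elts I. app M i = bare (vset (insert z (elts (B i))))"
  shows "structure_family binary_language I M" and "vlam I (\<lambda>_. z) \<in> elts (product I M)"
    and "elts (product I M) \<noteq> {}"
proof -
  have "is_structure binary_language (app M i)" if "i \<in> elts I" for i
    unfolding M(2)[rule_format, OF that] by (rule is_structure_binary) (simp_all add: fo_const elts_vset)
  then show "structure_family binary_language I M"
    unfolding structure_family_def using M(1) by blast
  show "vlam I (\<lambda>_. z) \<in> elts (product I M)"
    using vlam[OF ft_const, where a = I] by (simp add: in_product M(2) elts_vset)
  then show "elts (product I M) \<noteq> {}" by blast
qed

text \<open>Two distinct classes are represented by functions that differ almost everywhere, so almost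
  everywhere one of them avoids the base point.\<close>

lemma choice_from_two_elements:
  assumes U: "ultrafilter I U"
    and M: "function_on I M" "\<forall>i\<in>elts I. app M i = bare (vset (insert Z (elts (vtimes (app A i) Z))))"
    and two: "satisfies binary_language (ultraproduct binary_language I U M) two_elements_sentence (vset {})"
  shows "\<exists>f. function_on I f \<and> often U (\<lambda>i. app f i \<in> elts (app A i))"
proof -
  note fam = pointed_structure_family[OF M] and L = is_language_binary
  have str: "is_structure binary_language (ultraproduct binary_language I U M)"
    by (rule is_structure_ultraproduct[OF L U fam(1,3)])
  obtain f g where fg: "f \<in> elts (product I M)" "g \<in> elts (product I M)" "ultra_class I U M f \<noteq> ultra_class I U M g"
    using two unfolding satisfies_two_elements_sentence[OF str] universe_ultraproduct[OF L U fam(1)] by blast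
  have "fo (\<lambda>e. app f (e 0) = app g (e 0))" by (intro fo_intros)
  note often_not[OF U this]
  then have often: "often U (\<lambda>i. app f i \<noteq> app g i)"
    using fg(3) by (simp add: ultra_class_eq[OF L U fam(1) fg(1,2)])
  have ft: "ft (\<lambda>e. vfst (if app f (e 0) = Z then app g (e 0) else app f (e 0)))" by (intro fo_intros)
  define c where "c = vlam I (\<lambda>i. vfst (if app f i = Z then app g i else app f i))"
  have c: "function_on I c" "\<And>i. i \<in> elts I \<Longrightarrow> app c i = vfst (if app f i = Z then app g i else app f i)"
    unfolding c_def using vlam[OF ft] by blast+
  have "often U (\<lambda>i. app c i \<in> elts (app A i))"
  proof (rule often_mono[OF U often])
    fix i assume i: "i \<in> elts I" and ne: "app f i \<noteq> app g i"
    have "app f i \<in> insert Z (elts (vtimes (app A i) Z))" "app g i \<in> insert Z (elts (vtimes (app A i) Z))"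
      using product_app[OF fg(1) i] product_app[OF fg(2) i] by (simp_all add: M(2)[rule_format, OF i] elts_vset)
    then show "app c i \<in> elts (app A i)"
      unfolding c(2)[OF i] using ne by (auto simp: elts_vtimes)
  qed
  then show ?thesis using c(1) by blast
qed

lemma isomorphic_factors_Sigma1_equivalent_imp_ultra_choice:
  assumes eq: isomorphic_factors_Sigma1_equivalent shows ultra_choice
  unfolding ultra_choice_def
proof (intro allI impI; elim conjE)
  fix I U A
  assume U: "ultrafilter I U" and A: "function_on I A" and ne: "\<forall>i\<in>elts I. elts (app A i) \<noteq> {}"
  obtain Z M where Z: "elts Z \<noteq> {}" "\<And>i. i \<in> elts I \<Longrightarrow> Z \<notin> elts (vtimes (app A i) Z)"
    and M: "function_on I M"
    "\<forall>i\<in>elts I. app M i = bare (vset (insert Z (elts (vtimes (app A i) Z))))"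
    and iso: "\<And>i j. i \<in> elts I \<Longrightarrow> j \<in> elts I \<Longrightarrow> isomorphic binary_language (app M i) (app M j)"
    using pointed_family[OF A] ne by metis
  note fam = pointed_structure_family[OF M]
  obtain i where i: "i \<in> elts I" using ultrafilter_index_nonempty[OF U] by blast
  have str: "is_structure binary_language (app M i)"
    using fam(1) i unfolding structure_family_def by blast
  obtain a z where "a \<in> elts (app A i)" "z \<in> elts Z" using ne i Z(1) by blast
  then have "vpair a z \<in> elts (vtimes (app A i) Z)" by simp
  then have "vpair a z \<in> elts (universe (app M i))" "Z \<in> elts (universe (app M i))" "vpair a z \<noteq> Z"
    using Z(2)[OF i] by (auto simp: M(2)[rule_format, OF i] elts_vset)
  then have "satisfies binary_language (app M i) two_elements_sentence (vset {})"
    unfolding satisfies_two_elements_sentence[OF str] by blast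
  moreover have "Sigma_equivalent 1 binary_language (ultraproduct binary_language I U M) (app M i)"
    using eq is_language_binary fam U iso i unfolding isomorphic_factors_Sigma1_equivalent_def by blast
  ultimately have "satisfies binary_language (ultraproduct binary_language I U M) two_elements_sentence (vset {})"
    using two_elements_sentence_in_Sigma1 unfolding Sigma_equivalent_def by blast
  then show "\<exists>f. function_on I f \<and> often U (\<lambda>i. app f i \<in> elts (app A i))"
    by (rule choice_from_two_elements[where A = A and Z = Z, OF U M])
qed

text \<open>In the constant family two different classes can be named without choice, by the
  constant functions at an element of \<open>Z\<close> and at the base point.\<close>

lemma two_elements_constant_pointed:
  assumes U: "ultrafilter I U" and Z: "elts Z \<noteq> {}"
  defines "N \<equiv> vlam I (\<lambda>_. bare (vset (insert Z (elts Z))))"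
  shows "satisfies binary_language (ultraproduct binary_language I U N) two_elements_sentence (vset {})"
proof -
  note L = is_language_binary
  have N: "function_on I N" "\<forall>i\<in>elts I. app N i = bare (vset (insert Z (elts Z)))"
    unfolding N_def using vlam[OF ft_const] by blast+
  note fam = pointed_structure_family[of I N Z "\<lambda>_. Z", OF N]
  have str: "is_structure binary_language (ultraproduct binary_language I U N)"
    by (rule is_structure_ultraproduct[OF L U fam(1,3)])
  obtain z where z: "z \<in> elts Z" using Z by blast
  then have "z \<noteq> Z" using not_in_self by blast
  have c: "function_on I (vlam I (\<lambda>_. x))" "\<And>i. i \<in> elts I \<Longrightarrow> app (vlam I (\<lambda>_. x)) i = x" for x
    using vlam[OF ft_const] by blast+
  have zN: "vlam I (\<lambda>_. z) \<in> elts (product I N)"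
    using c z by (simp add: in_product N(2) elts_vset)
  have "often U (\<lambda>i. app (vlam I (\<lambda>_. z)) i = app (vlam I (\<lambda>_. Z)) i) \<longleftrightarrow> often U (\<lambda>i. z = Z)"
    by (rule often_cong[OF U]) (simp add: c)
  then have "ultra_class I U N (vlam I (\<lambda>_. z)) \<noteq> ultra_class I U N (vlam I (\<lambda>_. Z))"
    using ultra_class_eq[OF L U fam(1) zN fam(2)] \<open>z \<noteq> Z\<close> by (simp add: often_const[OF U])
  then show ?thesis
    unfolding satisfies_two_elements_sentence[OF str] universe_ultraproduct[OF L U fam(1)]
    using zN fam(2) by blast
qed

text \<open>The common core of (5) and (6): all that is extracted from either is the transfer of one
  sentence from the ultraproduct of a constant family to that of an isomorphic family.\<close>

lemma pointed_families_imp_ultra_choice: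
  assumes eq: "\<And>I U M N. ultrafilter I U \<Longrightarrow> structure_family binary_language I M \<Longrightarrow>
      structure_family binary_language I N \<Longrightarrow>
      (\<And>i. i \<in> elts I \<Longrightarrow> isomorphic binary_language (app M i) (app N i)) \<Longrightarrow>
      elts (product I M) \<noteq> {} \<Longrightarrow> elts (product I N) \<noteq> {} \<Longrightarrow>
      satisfies binary_language (ultraproduct binary_language I U N) two_elements_sentence (vset {}) \<Longrightarrow>
      satisfies binary_language (ultraproduct binary_language I U M) two_elements_sentence (vset {})"
  shows ultra_choice
  unfolding ultra_choice_def
proof (intro allI impI; elim conjE)
  fix I U A
  assume U: "ultrafilter I U" and A: "function_on I A" and ne: "\<forall>i\<in>elts I. elts (app A i) \<noteq> {}"
  obtain Z M where Z: "elts Z \<noteq> {}" and M: "function_on I M"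
    "\<forall>i\<in>elts I. app M i = bare (vset (insert Z (elts (vtimes (app A i) Z))))"
    and iso: "\<And>i. i \<in> elts I \<Longrightarrow> isomorphic binary_language (app M i) (bare (vset (insert Z (elts Z))))"
    using pointed_family[OF A] ne by metis
  define N where "N = vlam I (\<lambda>_. bare (vset (insert Z (elts Z))))"
  have N: "function_on I N" "\<forall>i\<in>elts I. app N i = bare (vset (insert Z (elts Z)))"
    unfolding N_def using vlam[OF ft_const] by blast+
  note famM = pointed_structure_family[OF M] and famN = pointed_structure_family[of I N Z "\<lambda>_. Z", OF N]
  have "satisfies binary_language (ultraproduct binary_language I U M) two_elements_sentence (vset {})"
  proof (rule eq[OF U famM(1) famN(1)])
    show "satisfies binary_language (ultraproduct binary_language I U N) two_elements_sentence (vset {})"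
      unfolding N_def by (rule two_elements_constant_pointed[OF U Z])
  qed (use iso N(2) famM(3) famN(3) in auto)
  then show "\<exists>f. function_on I f \<and> often U (\<lambda>i. app f i \<in> elts (app A i))"
    by (rule choice_from_two_elements[where A = A and Z = Z, OF U M])
qed

lemma isomorphic_families_Sigma1_equivalent_imp_ultra_choice:
  assumes eq: isomorphic_families_Sigma1_equivalent shows ultra_choice
proof (rule pointed_families_imp_ultra_choice)
  fix I U M N
  assume "ultrafilter I U" "structure_family binary_language I M" "structure_family binary_language I N"
    "\<And>i. i \<in> elts I \<Longrightarrow> isomorphic binary_language (app M i) (app N i)"
    "elts (product I M) \<noteq> {}" "elts (product I N) \<noteq> {}"
    and N: "satisfies binary_language (ultraproduct binary_language I U N) two_elements_sentence (vset {})"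
  then have "Sigma_equivalent 1 binary_language (ultraproduct binary_language I U M) (ultraproduct binary_language I U N)"
    using eq is_language_binary unfolding isomorphic_families_Sigma1_equivalent_def by blast
  then show "satisfies binary_language (ultraproduct binary_language I U M) two_elements_sentence (vset {})"
    using N two_elements_sentence_in_Sigma1 unfolding Sigma_equivalent_def by blast
qed

lemma isomorphic_families_isomorphic_ultraproducts_imp_ultra_choice:
  assumes eq: isomorphic_families_isomorphic_ultraproducts shows ultra_choice
proof (rule pointed_families_imp_ultra_choice)
  fix I U M N
  assume U: "ultrafilter I U" and M: "structure_family binary_language I M"
    and N: "structure_family binary_language I N"
    and iso: "\<And>i. i \<in> elts I \<Longrightarrow> isomorphic binary_language (app M i) (app N i)"
    and ne: "elts (product I M) \<noteq> {}" "elts (product I N) \<noteq> {}"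
    and sat: "satisfies binary_language (ultraproduct binary_language I U N) two_elements_sentence (vset {})"
  note L = is_language_binary
  have "isomorphic binary_language (ultraproduct binary_language I U M) (ultraproduct binary_language I U N)"
    using eq L U M N iso ne unfolding isomorphic_families_isomorphic_ultraproducts_def by blast
  then show "satisfies binary_language (ultraproduct binary_language I U M) two_elements_sentence (vset {})"
    using isomorphic_sentences[OF L is_structure_ultraproduct[OF L U M ne(1)] is_structure_ultraproduct[OF L U N ne(2)]]
      sat two_elements_sentence_in_Sigma1 by blast
qed

section \<open>Choice from the equivalence of ultrapowers of biembeddable structures\<close>

text \<open>
  A point is a quadruple \<open>((i, n), (x, m))\<close>; two distinct points are related if they agree in
  \<open>(i, n)\<close>. A set of points \<open>K\<close> between the points with \<open>x \<in> A\<^sub>i\<close> and those with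
  \<open>x \<in> A\<^sub>i \<union> {*}\<close> is an equivalence relation with infinitely many classes, all of them infinite, so
  that all embeddings between such sets that preserve classes and non-classes are elementary.
  If all points with \<open>x = *\<close> are present, then \<open>m \<mapsto> m + 1\<close> is a choice function for the relation.
  If in the classes \<open>(i, 0)\<close> only \<open>m = 0\<close> is allowed for \<open>x = *\<close>, then a point related to
  \<open>((i, 0), (*, 0))\<close> yields an element of \<open>A\<^sub>i\<close>. The map \<open>n \<mapsto> n + 1\<close> embeds the former set into the latter.
\<close>

definition same_class :: "'v \<Rightarrow> 'v \<Rightarrow> bool" where
  "same_class p q \<longleftrightarrow> vfst p = vfst q \<and> p \<noteq> q"

lemma fo_same_class: "fo (\<lambda>e. same_class (e 0) (e 1))"
  unfolding same_class_def by (intro fo_intros)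

text \<open>\<open>T i x\<close> stands for membership of \<open>x\<close> in A_i. The last two
  conditions guarantee, for each \<open>i\<close> in \<open>I\<close>, a class for every
  \<open>n\<close> and a point in each of these classes for every \<open>m\<close>, which is the
  supply of fresh classes and fresh points.\<close>

definition points :: "'v \<Rightarrow> 'v \<Rightarrow> ('v \<Rightarrow> 'v \<Rightarrow> bool) \<Rightarrow> bool" where
  "points I K T \<longleftrightarrow> (\<forall>p\<in>elts K. \<exists>i\<in>elts I. \<exists>n\<in>elts omega. \<exists>x. \<exists>m\<in>elts omega. p = vpair (vpair i n) (vpair x m)) \<and>
     (\<forall>i\<in>elts I. \<exists>x. T i x) \<and>
     (\<forall>i\<in>elts I. \<forall>n\<in>elts omega. \<forall>m\<in>elts omega. \<forall>x. T i x \<longrightarrow> vpair (vpair i n) (vpair x m) \<in> elts K)"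

text \<open>If all points of a tuple are below \<open>b\<close>, then the value \<open>b\<close> for
  \<open>n\<close> opens a class that the tuple does not meet, and the value \<open>b\<close> for
  \<open>m\<close> gives a point that is not in the tuple.\<close>

definition below :: "'v \<Rightarrow> 'v \<Rightarrow> bool" where
  "below b p \<longleftrightarrow> vsnd (vfst p) \<in> elts b \<and> vsnd (vsnd p) \<in> elts b"

lemma fo_below [fo_intros]: "ft T \<Longrightarrow> ft U \<Longrightarrow> fo (\<lambda>e. below (T e) (U e))"
  by (rule fo_pred2[where P = below], unfold below_def) (intro fo_intros)

lemma below_mono: "elts b \<subseteq> elts c \<Longrightarrow> below b p \<Longrightarrow> below c p"
  unfolding below_def by blast

lemma below_exists:
  assumes K: "points I K T" and p: "p \<in> elts K"
  shows "\<exists>b\<in>elts omega. below b p"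
proof -
  obtain i n x m where nm: "n \<in> elts omega" "m \<in> elts omega" "p = vpair (vpair i n) (vpair x m)"
    using K p unfolding points_def by blast
  obtain b where "b \<in> elts omega" "elts (vsucc n) \<subseteq> elts b" "elts (vsucc m) \<subseteq> elts b"
    using omega_directed[OF vsucc_omega[OF nm(1)] vsucc_omega[OF nm(2)]] .
  then show ?thesis unfolding nm(3) below_def by auto
qed

text \<open>The bound leaves room for fresh points in the back-and-forth construction.\<close>

definition same_type :: "'v \<Rightarrow> 'v \<Rightarrow> bool" where
  "same_type s t \<longleftrightarrow> (\<forall>k\<in>elts (vdom s). \<forall>l\<in>elts (vdom s).
     (app s k = app s l \<longleftrightarrow> app t k = app t l) \<and> (vfst (app s k) = vfst (app s l) \<longleftrightarrow> vfst (app t k) = vfst (app t l))) \<and>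
     (\<exists>b\<in>elts omega. \<forall>k\<in>elts (vdom s). below b (app s k) \<and> below b (app t k))"

lemma fo_same_type: "fo (\<lambda>e. same_type (e 0) (e 1))"
  unfolding same_type_def by (intro fo_intros)

lemma same_type_sym: "vdom s = vdom t \<Longrightarrow> same_type s t \<Longrightarrow> same_type t s"
  unfolding same_type_def by metis

lemma same_type_extend:
  assumes K: "points I K T" and K': "points I K' T"
    and s: "s \<in> elts (funs X K)" and t: "t \<in> elts (funs X K')" and st: "same_type s t" and a: "a \<in> elts K"
  shows "\<exists>b\<in>elts K'. same_type (vupd s k a) (vupd t k b)"
proof -
  obtain \<beta> where \<beta>: "\<beta> \<in> elts omega" "\<And>l. l \<in> elts X \<Longrightarrow> below \<beta> (app s l) \<and> below \<beta> (app t l)"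
    using st unfolding same_type_def funs_vdom[OF s] by blast
  have ty: "app s l = app s l' \<longleftrightarrow> app t l = app t l'"
      "vfst (app s l) = vfst (app s l') \<longleftrightarrow> vfst (app t l) = vfst (app t l')"
    if "l \<in> elts X" "l' \<in> elts X" for l l'
    using st that unfolding same_type_def funs_vdom[OF s] by blast+
  have "\<exists>b\<in>elts K'. \<forall>l\<in>elts X. (a = app s l \<longleftrightarrow> b = app t l) \<and> (vfst a = vfst (app s l) \<longleftrightarrow> vfst b = vfst (app t l))"
  proof -
    consider (old) l where "l \<in> elts X" "a = app s l"
      | (new) l where "l \<in> elts X" "vfst a = vfst (app s l)" "\<And>l. l \<in> elts X \<Longrightarrow> a \<noteq> app s l"
      | (fresh) "\<And>l. l \<in> elts X \<Longrightarrow> vfst a \<noteq> vfst (app s l)"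
      by blast
    then show ?thesis
    proof cases
      case old
      show ?thesis
        by (rule bexI[OF _ funs_app[OF t old(1)]]) (simp add: old(2) ty[OF old(1)])
    next
      case new
      obtain i n where i: "i \<in> elts I" "n \<in> elts omega" "vfst (app t l) = vpair i n"
        using K' funs_app[OF t new(1)] unfolding points_def by (metis vfst_vpair)
      obtain x where x: "T i x" using K' i(1) unfolding points_def by blast
      \<comment> \<open>The class is that of an earlier entry. The bound as last coordinate makes
        the point differ from all entries of \<open>t\<close>.\<close>
      define b where "b = vpair (vpair i n) (vpair x \<beta>)"
      have "b \<in> elts K'" using K' i(1,2) x \<beta>(1) unfolding points_def b_def by blast
      moreover have "b \<noteq> app t l'" if "l' \<in> elts X" for l'
      proof
        assume "b = app t l'"
        then have "vsnd (vsnd (app t l')) = \<beta>" by (simp add: b_def flip: \<open>b = app t l'\<close>)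
        then show False using \<beta>(2)[OF that] not_in_self[of \<beta>] unfolding below_def by simp
      qed
      moreover have "vfst b = vfst (app t l)" by (simp add: b_def i(3))
      ultimately show ?thesis
        using new ty(2)[OF new(1)] by (intro bexI[of _ b]) auto
    next
      case fresh
      obtain i where i: "i \<in> elts I" using K a unfolding points_def by blast
      obtain x where x: "T i x" using K' i(1) unfolding points_def by blast
      \<comment> \<open>The bound as number of the class makes the class new, whatever the index
        \<open>i\<close>; the last coordinate is immaterial and set to zero.\<close>
      define b where "b = vpair (vpair i \<beta>) (vpair x (vset {}))"
      have "b \<in> elts K'" using K' i(1) x \<beta>(1) zero_omega unfolding points_def b_def by blast
      moreover have "vfst b \<noteq> vfst (app t l')" if "l' \<in> elts X" for l'
      proof
        assume "vfst b = vfst (app t l')"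
        then have "vsnd (vfst (app t l')) = \<beta>" by (simp add: b_def flip: \<open>vfst b = vfst (app t l')\<close>)
        then show False using \<beta>(2)[OF that] not_in_self[of \<beta>] unfolding below_def by simp
      qed
      ultimately show ?thesis
        using fresh by (intro bexI[of _ b]) auto
    qed
  qed
  then obtain b where b: "b \<in> elts K'"
    "\<And>l. l \<in> elts X \<Longrightarrow> (a = app s l \<longleftrightarrow> b = app t l) \<and> (vfst a = vfst (app s l) \<longleftrightarrow> vfst b = vfst (app t l))"
    by blast
  obtain \<gamma> \<delta> where \<gamma>: "\<gamma> \<in> elts omega" "below \<gamma> a" and \<delta>: "\<delta> \<in> elts omega" "below \<delta> b"
    using below_exists[OF K a] below_exists[OF K' b(1)] by blast
  obtain \<epsilon> where \<epsilon>: "\<epsilon> \<in> elts omega" "elts \<beta> \<subseteq> elts \<epsilon>" "elts \<gamma> \<subseteq> elts \<epsilon>"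
    using omega_directed[OF \<beta>(1) \<gamma>(1)] .
  obtain \<zeta> where \<zeta>: "\<zeta> \<in> elts omega" "elts \<epsilon> \<subseteq> elts \<zeta>" "elts \<delta> \<subseteq> elts \<zeta>"
    using omega_directed[OF \<epsilon>(1) \<delta>(1)] .
  have bound: "below \<zeta> a" "below \<zeta> b" "\<And>l. l \<in> elts X \<Longrightarrow> below \<zeta> (app s l) \<and> below \<zeta> (app t l)"
    using below_mono \<epsilon> \<zeta> \<gamma>(2) \<delta>(2) \<beta>(2) by (meson subset_trans)+
  have sa: "app (vupd s k a) l = (if l = k then a else app s l)"
    and ta: "app (vupd t k b) l = (if l = k then b else app t l)" if "l = k \<or> l \<in> elts X" for l
    using app_vupd that by (simp_all add: funs_vdom[OF s] funs_vdom[OF t])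
  have dom: "l \<in> elts (vdom (vupd s k a)) \<longleftrightarrow> l = k \<or> l \<in> elts X" for l
    by (simp add: funs_vdom[OF s] elts_vset)
  have "same_type (vupd s k a) (vupd t k b)"
    unfolding same_type_def
  proof (intro conjI ballI bexI[OF _ \<zeta>(1)])
    fix l l' assume l: "l \<in> elts (vdom (vupd s k a))" and l': "l' \<in> elts (vdom (vupd s k a))"
    note sl = l[unfolded dom] l'[unfolded dom]
    show "app (vupd s k a) l = app (vupd s k a) l' \<longleftrightarrow> app (vupd t k b) l = app (vupd t k b) l'"
      using sl b(2)[of l] b(2)[of l'] ty(1)[of l l'] by (auto simp: sa[OF sl(1)] sa[OF sl(2)] ta[OF sl(1)] ta[OF sl(2)])
    show "vfst (app (vupd s k a) l) = vfst (app (vupd s k a) l') \<longleftrightarrow>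
        vfst (app (vupd t k b) l) = vfst (app (vupd t k b) l')"
      using sl b(2)[of l] b(2)[of l'] ty(2)[of l l'] by (auto simp: sa[OF sl(1)] sa[OF sl(2)] ta[OF sl(1)] ta[OF sl(2)])
  next
    fix l assume "l \<in> elts (vdom (vupd s k a))"
    then have sl: "l = k \<or> l \<in> elts X" by (simp only: dom)
    show "below \<zeta> (app (vupd s k a) l)" "below \<zeta> (app (vupd t k b) l)"
      using bound sl by (auto simp: sa[OF sl] ta[OF sl])
  qed
  then show ?thesis using b(1) by blast
qed

text \<open>Elimination of quantifiers in semantic form: truth of a formula depends only on which
  entries coincide and which share a class, because \<open>same_type_extend\<close> supplies both
  directions of the back-and-forth argument.\<close>

lemma same_type_satisfies:
  assumes K: "points I K T" and K': "points I K' T" and ne: "elts K \<noteq> {}" "elts K' \<noteq> {}"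
    and \<phi>: "\<phi> \<in> elts (formulas_in binary_language X)" and s: "s \<in> elts (funs X K)" and t: "t \<in> elts (funs X K')"
    and st: "same_type s t"
  shows "satisfies binary_language (binary_structure K same_class) \<phi> s \<longleftrightarrow>
    satisfies binary_language (binary_structure K' same_class) \<phi> t"
proof -
  let ?M = "binary_structure K same_class" and ?N = "binary_structure K' same_class"
  note L = is_language_binary
  note M = is_structure_binary[OF fo_same_class ne(1)] and N = is_structure_binary[OF fo_same_class ne(2)]
  show ?thesis
  proof (rule back_and_forth[OF L M N fo_same_type])
    fix X s t assume s: "s \<in> elts (funs X (universe ?M))" and t: "t \<in> elts (funs X (universe ?N))"
      and st: "same_type s t"
    have ty: "app s l = app s l' \<longleftrightarrow> app t l = app t l'"
      "vfst (app s l) = vfst (app s l') \<longleftrightarrow> vfst (app t l) = vfst (app t l')"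
      if "l \<in> elts X" "l' \<in> elts X" for l l'
      using st that unfolding same_type_def funs_vdom[OF s] by blast+
    show "app (term_eval binary_language ?M s) a = app (term_eval binary_language ?M s) b \<longleftrightarrow>
        app (term_eval binary_language ?N t) a = app (term_eval binary_language ?N t) b"
      if a: "a \<in> elts (terms_in binary_language X)" and b: "b \<in> elts (terms_in binary_language X)" for a b
    proof -
      obtain k where k: "k \<in> elts X" "a = Var_code k" by (rule binary_terms[OF a])
      obtain l where l: "l \<in> elts X" "b = Var_code l" by (rule binary_terms[OF b])
      show ?thesis
        unfolding k(2) l(2) term_eval_Var[OF L M s k(1)] term_eval_Var[OF L M s l(1)]
          term_eval_Var[OF L N t k(1)] term_eval_Var[OF L N t l(1)] by (rule ty(1)[OF k(1) l(1)])
    qed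
    show "vcomp (term_eval binary_language ?M s) u \<in> elts (rel_int ?M R) \<longleftrightarrow>
        vcomp (term_eval binary_language ?N t) u \<in> elts (rel_int ?N R)"
      if R: "R \<in> elts (rel_syms binary_language)"
        and u: "u \<in> elts (funs (rel_arity binary_language R) (terms_in binary_language X))" for R u
    proof -
      have R0: "R = v0" using R by (simp add: elts_rel_syms_binary)
      have u: "u \<in> elts (funs v2 (terms_in binary_language X))" using u by (simp add: R0 rel_arity_binary)
      obtain k where k: "k \<in> elts X" "app u v0 = Var_code k"
        using binary_terms[OF funs_app[OF u]] elts_v2 by blast
      obtain l where l: "l \<in> elts X" "app u v1 = Var_code l"
        using binary_terms[OF funs_app[OF u]] elts_v2 by blast
      have fn: "function_on v2 (vcomp f u)" for f
        using function_on_vcomp[of u f] by (simp add: funs_vdom[OF u])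
      have 1: "vcomp (term_eval binary_language ?M s) u = pair_tuple (app s k) (app s l)"
        by (rule function_on_v2_eqI[OF fn]) (simp_all add: app_vcomp funs_vdom[OF u] elts_v2 k l term_eval_Var[OF L M s])
      have 2: "vcomp (term_eval binary_language ?N t) u = pair_tuple (app t k) (app t l)"
        by (rule function_on_v2_eqI[OF fn]) (simp_all add: app_vcomp funs_vdom[OF u] elts_v2 k l term_eval_Var[OF L N t])
      have "app s k \<in> elts K" "app s l \<in> elts K" "app t k \<in> elts K'" "app t l \<in> elts K'"
        using funs_app[OF s] funs_app[OF t] k l by simp_all
      then show ?thesis
        unfolding 1 2 R0 using ty[OF k(1) l(1)]
        by (simp add: pair_tuple_in_rel_int_binary[OF fo_same_class] same_class_def)
    qed
    show "\<exists>b\<in>elts (universe ?N). same_type (vupd s k a) (vupd t k b)" if "a \<in> elts (universe ?M)" for k a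
      using same_type_extend[OF K K' _ _ st] s t that by simp
    show "\<exists>a\<in>elts (universe ?M). same_type (vupd s k a) (vupd t k b)" if b: "b \<in> elts (universe ?N)" for k b
    proof -
      have "vdom s = vdom t" using s t by (simp add: funs_vdom)
      then have "same_type t s" using st same_type_sym by blast
      then obtain a where a: "a \<in> elts K" "same_type (vupd t k b) (vupd s k a)"
        using same_type_extend[OF K' K, of t X s b k] s t b by auto
      have "vdom (vupd t k b) = vdom (vupd s k a)" using \<open>vdom s = vdom t\<close> by simp
      then have "same_type (vupd s k a) (vupd t k b)" using a(2) by (rule same_type_sym)
      then show ?thesis using a(1) by auto
    qed
  qed (use \<phi> s t st in simp_all)
qed

lemma elementary_embedding_points:
  assumes K: "points I K T" and K': "points I K' T" and ne: "elts K \<noteq> {}"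
    and j: "j \<in> elts (funs K K')"
    and inj: "\<And>p q. p \<in> elts K \<Longrightarrow> q \<in> elts K \<Longrightarrow> app j p = app j q \<Longrightarrow> p = q"
    and classes: "\<And>p q. p \<in> elts K \<Longrightarrow> q \<in> elts K \<Longrightarrow> vfst (app j p) = vfst (app j q) \<longleftrightarrow> vfst p = vfst q"
  shows "elementary_embedding binary_language (binary_structure K same_class) (binary_structure K' same_class) j"
  unfolding elementary_embedding_def
proof (intro conjI ballI)
  show "j \<in> elts (funs (universe (binary_structure K same_class)) (universe (binary_structure K' same_class)))"
    using j by simp
  fix n \<phi> s
  assume n: "n \<in> elts omega" and \<phi>: "\<phi> \<in> elts (formulas_in binary_language n)"
    and s: "s \<in> elts (funs n (universe (binary_structure K same_class)))"
  have s: "s \<in> elts (funs n K)" using s by simp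
  have js: "vcomp j s \<in> elts (funs n K')" using vcomp_in_funs[OF s] funs_app[OF j] by blast
  have app: "app (vcomp j s) k = app j (app s k)" if "k \<in> elts n" for k
    using that by (simp add: app_vcomp funs_vdom[OF s])
  \<comment> \<open>The common bound demanded by \<open>same_type\<close> exists because the tuple
    is finite in the sense of the model; infinite assignments need not have one.\<close>
  obtain b where b: "b \<in> elts omega" "\<And>k. k \<in> elts n \<Longrightarrow> below b (app s k) \<and> below b (app j (app s k))"
  proof (rule omega_bounded[where P = "\<lambda>k b. below b (app s k) \<and> below b (app j (app s k))", OF _ _ n])
    show "fo (\<lambda>e. below (e 1) (app s (e 0)) \<and> below (e 1) (app j (app s (e 0))))" by (intro fo_intros)
    show "\<exists>b\<in>elts omega. below b (app s k) \<and> below b (app j (app s k))" if k: "k \<in> elts n" for k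
    proof -
      obtain b c where b: "b \<in> elts omega" "below b (app s k)" and c: "c \<in> elts omega" "below c (app j (app s k))"
        using below_exists[OF K funs_app[OF s k]] below_exists[OF K' funs_app[OF j funs_app[OF s k]]] by blast
      obtain d where "d \<in> elts omega" "elts b \<subseteq> elts d" "elts c \<subseteq> elts d"
        using omega_directed[OF b(1) c(1)] .
      then show ?thesis using below_mono b(2) c(2) by blast
    qed
  qed (use below_mono in blast)+
  have "same_type s (vcomp j s)"
    unfolding same_type_def funs_vdom[OF s]
  proof (intro conjI ballI bexI[OF _ b(1)])
    fix k l assume k: "k \<in> elts n" and l: "l \<in> elts n"
    show "app s k = app s l \<longleftrightarrow> app (vcomp j s) k = app (vcomp j s) l"
      using inj[OF funs_app[OF s k] funs_app[OF s l]] by (auto simp: app k l)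
    show "vfst (app s k) = vfst (app s l) \<longleftrightarrow> vfst (app (vcomp j s) k) = vfst (app (vcomp j s) l)"
      using classes[OF funs_app[OF s k] funs_app[OF s l]] by (simp add: app k l)
  qed (use b(2) app in simp_all)
  moreover have "elts K' \<noteq> {}" using ne funs_app[OF j] by blast
  ultimately show "satisfies binary_language (binary_structure K same_class) \<phi> s \<longleftrightarrow>
      satisfies binary_language (binary_structure K' same_class) \<phi> (vcomp j s)"
    by (intro same_type_satisfies[OF K K' ne _ \<phi> s js])
qed

lemma vsucc_omega_inject:
  assumes "m \<in> elts omega" "n \<in> elts omega" shows "vsucc m = vsucc n \<longleftrightarrow> m = n"
proof
  assume eq: "vsucc m = vsucc n"
  have "insert m (elts m) = insert n (elts n)" using arg_cong[OF eq, of elts] by simp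
  then have "m = n \<or> m \<in> elts n \<and> n \<in> elts m" by (metis insertE insertI1)
  then show "m = n"
    using omega_elt_subset[OF assms(2), of m] not_in_self[of n] by blast
qed simp

lemma biembeddable_ultrapowers_Sigma2_equivalent_imp_ultra_choice:
  assumes eq: biembeddable_ultrapowers_Sigma2_equivalent shows ultra_choice
  unfolding ultra_choice_def
proof (intro allI impI; elim conjE)
  fix I U A
  assume U: "ultrafilter I U" and A: "function_on I A" and ne: "\<forall>i\<in>elts I. elts (app A i) \<noteq> {}"
  note L = is_language_binary
  have "is_set (\<Union>i\<in>elts I. elts (app A i))" by (rule is_set_UN) (intro fo_intros)
  \<comment> \<open>The union of all A_i plays the extra label *. By Foundation it is a member of
    none of them.\<close>
  then obtain B where B: "elts B = (\<Union>i\<in>elts I. elts (app A i))" unfolding is_set_def by blast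
  have star: "B \<notin> elts (app A i)" if "i \<in> elts I" for i
    using not_in_self[of B] that unfolding B by blast
  let ?Q = "vtimes (vtimes I omega) (vtimes (vset (insert B (elts B))) omega)"
  let ?i = "\<lambda>p. vfst (vfst p)" and ?n = "\<lambda>p. vsnd (vfst p)" and ?x = "\<lambda>p. vfst (vsnd p)" and ?m = "\<lambda>p. vsnd (vsnd p)"
  \<comment> \<open>\<open>N\<close> has the label * everywhere and thus a definable choice
    function. \<open>M\<close> is thinned out in the classes \<open>(i, 0)\<close>, where only one
    point labelled * remains.\<close>
  define N where "N = vset {p \<in> elts ?Q. ?x p = B \<or> ?x p \<in> elts (app A (?i p))}"
  define M where "M = vset {p \<in> elts N. ?n p = vset {} \<and> ?x p = B \<longrightarrow> ?m p = vset {}}"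
  have N: "elts N = {p \<in> elts ?Q. ?x p = B \<or> ?x p \<in> elts (app A (?i p))}"
    unfolding N_def by (rule elts_vset[OF is_set_separation]) (intro fo_intros)
  have M: "elts M = {p \<in> elts N. ?n p = vset {} \<and> ?x p = B \<longrightarrow> ?m p = vset {}}"
    unfolding M_def by (rule elts_vset[OF is_set_separation]) (intro fo_intros)
  have inN: "vpair (vpair i n) (vpair x m) \<in> elts N \<longleftrightarrow> i \<in> elts I \<and> n \<in> elts omega \<and> m \<in> elts omega \<and>
      (x = B \<or> x \<in> elts (app A i))" for i n x m
  proof -
    have "x \<in> elts B" if "i \<in> elts I" "x \<in> elts (app A i)" using that unfolding B by blast
    then show ?thesis unfolding N by (auto simp: elts_vset)
  qed
  have inM: "vpair (vpair i n) (vpair x m) \<in> elts M \<longleftrightarrow> i \<in> elts I \<and> n \<in> elts omega \<and> m \<in> elts omega \<and>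
      (x = B \<or> x \<in> elts (app A i)) \<and> (n = vset {} \<and> x = B \<longrightarrow> m = vset {})" for i n x m
    unfolding M using inN by auto
  have MN: "elts M \<subseteq> elts N" unfolding M by blast
  have Ncases: "\<exists>i\<in>elts I. \<exists>n\<in>elts omega. \<exists>x. \<exists>m\<in>elts omega. p = vpair (vpair i n) (vpair x m)" if "p \<in> elts N" for p
    using that unfolding N by (auto simp: elts_vtimes)
  let ?T = "\<lambda>i x. x \<in> elts (app A i)"
  have pN: "points I N ?T"
    unfolding points_def using Ncases ne inN by blast
  have pM: "points I M ?T"
    unfolding points_def using Ncases MN ne inM star by blast
  obtain i0 where i0: "i0 \<in> elts I" using ultrafilter_index_nonempty[OF U] by blast
  have "vpair (vpair i0 (vset {})) (vpair B (vset {})) \<in> elts M" using i0 by (simp add: inM)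
  then have neM: "elts M \<noteq> {}" and neN: "elts N \<noteq> {}" using MN by blast+
  let ?SM = "binary_structure M same_class" and ?SN = "binary_structure N same_class"
  have "elementary_embedding binary_language ?SM ?SN (vlam M (\<lambda>p. p))"
    using vlam[OF ft_var, where a = M] MN
    by (intro elementary_embedding_points[OF pM pN neM]) (auto simp: in_funs)
  moreover have "elementary_embedding binary_language ?SN ?SM
      (vlam N (\<lambda>p. vpair (vpair (?i p) (vsucc (?n p))) (vsnd p)))" (is "elementary_embedding _ _ _ ?j")
  proof -
    have ft: "ft (\<lambda>e. vpair (vpair (?i (e 0)) (vsucc (?n (e 0)))) (vsnd (e 0)))" by (intro fo_intros)
    note j = vlam[OF ft, where a = N]
    \<comment> \<open>The shifted class is never of the form \<open>(i, 0)\<close>, so the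
      restriction on the label * in \<open>M\<close> is satisfied by the image.\<close>
    have succ: "vsucc n \<noteq> vset {}" for n using elts_vsucc[of n] by (metis elts_empty insert_not_empty)
    show ?thesis
    proof (rule elementary_embedding_points[OF pN pM neN])
      show "?j \<in> elts (funs N M)"
        unfolding in_funs
      proof (intro conjI ballI j(1))
        fix p assume p: "p \<in> elts N"
        obtain i n x m where p': "p = vpair (vpair i n) (vpair x m)" using Ncases[OF p] by blast
        show "app ?j p \<in> elts M" using p unfolding j(2)[OF p] by (simp add: p' inM inN succ)
      qed
      fix p q assume p: "p \<in> elts N" and q: "q \<in> elts N"
      obtain i n x m where p': "p = vpair (vpair i n) (vpair x m)" "n \<in> elts omega" using Ncases[OF p] by blast
      obtain i' n' x' m' where q': "q = vpair (vpair i' n') (vpair x' m')" "n' \<in> elts omega" using Ncases[OF q] by blast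
      show "p = q" if "app ?j p = app ?j q"
        using that vsucc_omega_inject[OF p'(2) q'(2)] unfolding j(2)[OF p] j(2)[OF q] by (simp add: p'(1) q'(1))
      show "vfst (app ?j p) = vfst (app ?j q) \<longleftrightarrow> vfst p = vfst q"
        using vsucc_omega_inject[OF p'(2) q'(2)] unfolding j(2)[OF p] j(2)[OF q] by (simp add: p'(1) q'(1))
    qed
  qed
  ultimately have "Sigma_equivalent 2 binary_language (ultrapower binary_language I U ?SM) (ultrapower binary_language I U ?SN)"
    using eq L U is_structure_binary[OF fo_same_class neM] is_structure_binary[OF fo_same_class neN]
    unfolding biembeddable_ultrapowers_Sigma2_equivalent_def by blast
  then have equiv: "satisfies binary_language (ultrapower binary_language I U ?SM) dead_end_sentence (vset {}) \<longleftrightarrow>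
      satisfies binary_language (ultrapower binary_language I U ?SN) dead_end_sentence (vset {})"
    using dead_end_sentence_in_Sigma2 unfolding Sigma_equivalent_def by blast
  have "\<exists>g\<in>elts (funs I N). often U (\<lambda>i. same_class (app f i) (app g i))" if f: "f \<in> elts (funs I N)" for f
  proof -
    define g where "g = vlam I (\<lambda>i. vpair (vfst (app f i)) (vpair (?x (app f i)) (vsucc (?m (app f i)))))"
    have ft: "ft (\<lambda>e. vpair (vfst (app f (e 0))) (vpair (?x (app f (e 0))) (vsucc (?m (app f (e 0))))))"
      by (intro fo_intros)
    have g: "function_on I g" "\<And>i. i \<in> elts I \<Longrightarrow> app g i = vpair (vfst (app f i)) (vpair (?x (app f i)) (vsucc (?m (app f i))))"
      unfolding g_def using vlam[OF ft] by blast+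
    have *: "app g i \<in> elts N \<and> same_class (app f i) (app g i)" if i: "i \<in> elts I" for i
    proof -
      obtain i' n x m where fi: "app f i = vpair (vpair i' n) (vpair x m)"
        using Ncases[OF funs_app[OF f i]] by blast
      have "m \<noteq> vsucc m" using not_in_self[of m] elts_vsucc[of m] by (metis insertI1)
      then show ?thesis
        using funs_app[OF f i] by (simp add: g(2)[OF i] fi inN same_class_def)
    qed
    then have "g \<in> elts (funs I N)" using g(1) by (simp add: in_funs)
    moreover have "often U (\<lambda>i. same_class (app f i) (app g i))"
      by (rule often_all_in[OF U]) (use * in blast)
    ultimately show ?thesis by blast
  qed
  then have "\<not> satisfies binary_language (ultrapower binary_language I U ?SN) dead_end_sentence (vset {})"
    unfolding dead_end_ultrapower_binary[OF fo_same_class neN U] by blast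
  then have choice: "\<exists>g\<in>elts (funs I M). often U (\<lambda>i. same_class (app f i) (app g i))" if "f \<in> elts (funs I M)" for f
    using that equiv unfolding dead_end_ultrapower_binary[OF fo_same_class neM U] by blast
  define f where "f = vlam I (\<lambda>i. vpair (vpair i (vset {})) (vpair B (vset {})))"
  have ftf: "ft (\<lambda>e. vpair (vpair (e 0) (vset {})) (vpair B (vset {})))" by (intro fo_intros)
  have f: "function_on I f" "\<And>i. i \<in> elts I \<Longrightarrow> app f i = vpair (vpair i (vset {})) (vpair B (vset {}))"
    unfolding f_def using vlam[OF ftf] by blast+
  then have "f \<in> elts (funs I M)" by (simp add: in_funs inM)
  then obtain g where g: "g \<in> elts (funs I M)" "often U (\<lambda>i. same_class (app f i) (app g i))"
    using choice by blast
  have ftc: "ft (\<lambda>e. ?x (app g (e 0)))" by (intro fo_intros)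
  note c = vlam[OF ftc, where a = I]
  have "often U (\<lambda>i. app (vlam I (\<lambda>i. ?x (app g i))) i \<in> elts (app A i))"
  proof (rule often_mono[OF U g(2)])
    fix i assume i: "i \<in> elts I" and sc: "same_class (app f i) (app g i)"
    obtain i' n x m where gi: "app g i = vpair (vpair i' n) (vpair x m)"
      using Ncases MN funs_app[OF g(1) i] by blast
    \<comment> \<open>Being in the class \<open>(i, 0)\<close> but different from its only point
      labelled *, the partner must carry a label from A_i.\<close>
    have "i' = i \<and> n = vset {} \<and> \<not> (x = B \<and> m = vset {})"
      using sc unfolding same_class_def gi f(2)[OF i] by auto
    moreover have "vpair (vpair i' n) (vpair x m) \<in> elts M"
      using funs_app[OF g(1) i] unfolding gi .
    ultimately show "app (vlam I (\<lambda>i. ?x (app g i))) i \<in> elts (app A i)"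
      unfolding c(2)[OF i] gi by (auto simp: inM)
  qed
  then show "\<exists>f. function_on I f \<and> often U (\<lambda>i. app f i \<in> elts (app A i))"
    using c(1) by blast
qed

end

theorem theorem1p5:
  fixes E :: "'v \<Rightarrow> 'v \<Rightarrow> bool"
  assumes "ZF_model E"
  shows "(membership.Los_theorem E \<longleftrightarrow> membership.ultrapowers_Sigma2_equivalent E) \<and>
    (membership.Los_theorem E \<longleftrightarrow> membership.isomorphic_factors_Sigma1_equivalent E) \<and>
    (membership.Los_theorem E \<longleftrightarrow> membership.biembeddable_ultrapowers_Sigma2_equivalent E) \<and>
    (membership.Los_theorem E \<longleftrightarrow> membership.isomorphic_families_Sigma1_equivalent E) \<and>
    (membership.Los_theorem E \<longleftrightarrow> membership.isomorphic_families_isomorphic_ultraproducts E)"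
proof -
  interpret ZF_model E by (rule assms)
  \<comment> \<open>The circle through (2) makes Los's theorem and \<open>ultra_choice\<close>
    interchangeable. Each remaining statement follows from one of the two and implies the
    second.\<close>
  have "Los_theorem \<longleftrightarrow> ultra_choice"
    using Los_if_ultra_choice Los_imp_ultrapowers_Sigma2_equivalent
      ultrapowers_Sigma2_equivalent_imp_ultra_choice by blast
  then show ?thesis
    using Los_imp_ultrapowers_Sigma2_equivalent ultrapowers_Sigma2_equivalent_imp_ultra_choice
      Los_imp_isomorphic_factors_Sigma1_equivalent isomorphic_factors_Sigma1_equivalent_imp_ultra_choice
      Los_imp_biembeddable_ultrapowers_Sigma2_equivalent biembeddable_ultrapowers_Sigma2_equivalent_imp_ultra_choice
      Los_imp_isomorphic_families_Sigma1_equivalent isomorphic_families_Sigma1_equivalent_imp_ultra_choice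
      ultra_choice_imp_isomorphic_ultraproducts isomorphic_families_isomorphic_ultraproducts_imp_ultra_choice
    by blast
qed

end
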